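(* Let $v\in C^\infty(\mathbb T,\mathbb R)$ and $j\in\mathbb Z\setminus\{0\}$ with Fourier coefficient $v_j\ne0$. Then $V(t,x):=\cos(jt)\,v(x)$ is a transporter for the half-wave equation $\mathrm i\partial_t\psi=|D|\psi+V(t,x)\psi$, $x\in\mathbb T$: for every $r>0$ there exist a solution $\psi(t)\in H^r(\mathbb T)$ and constants $C,T>0$ with $\|\psi(t)\|_{H^r}\ge C\langle t\rangle^r$ for all $t>T$.
   Context: $\mathbb T=\mathbb R/2\pi\mathbb Z$; $\psi_j=\frac1{2\pi}\int_{\mathbb T}\psi(x)e^{-\mathrm ijx}dx$; $|D|\psi=\sum_j|j|\psi_je^{\mathrm ijx}$. The Sobolev norm is $\|\psi\|_{H^r}=\|(|D|+1)^r\psi\|_{L^2}$. A potential is a transporter if for every $r>0$ some solution in $H^r$ has unbounded $H^r$-norm as $t\to\infty$. $\langle t\rangle=\sqrt{1+t^2}$. *)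

theory Defs
  imports "HOL-Analysis.Analysis"
begin

text \<open>Functions on the torus T = R/2piZ are represented as 2pi-periodic functions on R.\<close>

definition periodic_2pi :: "(real \<Rightarrow> 'a) \<Rightarrow> bool" where
  "periodic_2pi f \<longleftrightarrow> (\<forall>x. f (x + 2 * pi) = f x)"

definition smooth_real :: "(real \<Rightarrow> real) \<Rightarrow> bool" where
  "smooth_real v \<longleftrightarrow> (\<forall>n x. ((deriv ^^ n) v) differentiable (at x))"

definition fcoef :: "(real \<Rightarrow> complex) \<Rightarrow> int \<Rightarrow> complex" where
  "fcoef f k = complex_of_real (1 / (2 * pi)) *
     (LINT x:{0..2*pi}|lborel. f x * cis (- (of_int k * x)))"

definition in_Hr :: "real \<Rightarrow> (real \<Rightarrow> complex) \<Rightarrow> bool" where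
  "in_Hr r f \<longleftrightarrow> periodic_2pi f \<and> f \<in> borel_measurable borel \<and>
     set_integrable lborel {0..2*pi} (\<lambda>x. (cmod (f x))\<^sup>2) \<and>
     (\<lambda>k::int. (real_of_int \<bar>k\<bar> + 1) powr (2 * r) * (cmod (fcoef f k))\<^sup>2) summable_on UNIV"

text \<open>||psi||_{H^r} = ||(|D|+1)^r psi||_{L^2(T)} = sqrt(2pi sum_k (|k|+1)^{2r} |psi_k|^2) (Parseval).\<close>
definition Hr_norm :: "real \<Rightarrow> (real \<Rightarrow> complex) \<Rightarrow> real" where
  "Hr_norm r f = sqrt (2 * pi *
     (\<Sum>\<^sub>\<infinity>k::int. (real_of_int \<bar>k\<bar> + 1) powr (2 * r) * (cmod (fcoef f k))\<^sup>2))"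

definition japanese :: "real \<Rightarrow> real" where
  "japanese t = sqrt (1 + t\<^sup>2)"

definition half_wave_solution_Hr ::
  "real \<Rightarrow> (real \<Rightarrow> real \<Rightarrow> real) \<Rightarrow> (real \<Rightarrow> real \<Rightarrow> complex) \<Rightarrow> bool" where
  "half_wave_solution_Hr r V \<psi> \<longleftrightarrow>
     (\<forall>t. in_Hr r (\<psi> t)) \<and>
     (\<forall>t. ((\<lambda>s. Hr_norm r (\<lambda>x. \<psi> s x - \<psi> t x)) \<longlongrightarrow> 0) (at t)) \<and>
     (\<forall>t k. ((\<lambda>s. fcoef (\<psi> s) k) has_vector_derivative
        (- \<i> * (of_int \<bar>k\<bar> * fcoef (\<psi> t) k + fcoef (\<lambda>x. complex_of_real (V t x) * \<psi> t x) k)))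
        (at t))"

end

theory Submission
  imports Defs
begin

text \<open>
  On positive frequencies $|D| = -\mathrm{i}\partial_x$, so the equation becomes a transport equation
  whose solutions acquire along characteristics the phase $\Theta(t,y) = \int_0^t \cos(js)\,v(y+s)\,ds
  = t\,\mathrm{Re}(v_j e^{\mathrm{i}jy}) + O(1)$. A packet $\varphi(y)\,e^{-\mathrm{i}\Theta(t,y)}$
  supported where $\mathrm{Re}(v_j e^{\mathrm{i}jy})$ is strictly decreasing therefore sits at
  frequencies at least $ct$; by non-stationary phase its mass at frequencies $k \le ct$ is $O(t^{-N})$.
  Hence it solves the half-wave equation up to an $L^2$ error that is integrable in time. The exact
  solution that agrees with a finite Fourier truncation of the packet at a large time $T_0$ stays
  $L^2$-close to the packet for all later times, because the flow is unitary on $L^2$. So it keeps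
  a fixed amount of $L^2$ mass at frequencies above $ct$, which gives the growth $t^r$ of the
  $H^r$ norm. The potential enters only through its Fourier coefficients, which decay rapidly.
\<close>

section \<open>Dominated series over arbitrary index sets\<close>

text \<open>With cos(js) read as the real part of e^{ijs}, mode l of v enters the phase through the
  integral of e^{i(l+j)s} over [0,t], which is bounded unless l = -j. This single resonance gives
  the linear growth, and v_j \<noteq> 0 keeps it alive because v_{-j} is the conjugate of v_j. The
  obstacle is the mismatch between |D| and -i d/dx: it acts only on negative frequencies, but there
  it multiplies by 2|k|, which is unbounded. Hence the non-stationary phase bound has to be uniform
  in t and k jointly, as a power of t + |k|. Four powers suffice: one absorbs |k|, two give the
  integrable rate t^{-2}, one makes the error square summable. So a polynomial bump with zeros of
  order 4 can serve as profile for every r. The packet then has limited smoothness, and membership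
  in H^r comes from elsewhere: the exact solution starts from finitely many modes and is constructed
  in spaces with arbitrary polynomial weights. Only L^2 information about its distance to the packet
  enters the growth.\<close>

lemma dominated_summable_on:
  fixes f :: "'a \<Rightarrow> 'b :: banach"
  assumes "M summable_on A" "\<And>x. x \<in> A \<Longrightarrow> norm (f x) \<le> M x"
  shows "f summable_on A"
  by (rule abs_summable_summable, rule Infinite_Sum.abs_summable_on_comparison_test'[OF assms])

lemma norm_infsum_le_dominated:
  fixes f :: "'a \<Rightarrow> 'b :: banach"
  assumes "M summable_on A" "\<And>x. x \<in> A \<Longrightarrow> norm (f x) \<le> M x"
  shows "norm (infsum f A) \<le> infsum M A"
  by (rule norm_infsum_le[where f = f and g = M and X = A])
     (simp_all only: has_sum_infsum dominated_summable_on[OF assms] assms)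

lemma continuous_on_infsum_dominated:
  fixes c :: "'a \<Rightarrow> 'b :: topological_space \<Rightarrow> 'c :: banach"
  assumes "\<And>l. continuous_on S (c l)" "\<And>l x. x \<in> S \<Longrightarrow> norm (c l x) \<le> M l" "M summable_on UNIV"
  shows "continuous_on S (\<lambda>x. \<Sum>\<^sub>\<infinity>l. c l x)"
proof (rule uniform_limit_theorem)
  show "uniform_limit S (\<lambda>X x. \<Sum>l\<in>X. c l x) (\<lambda>x. \<Sum>\<^sub>\<infinity>l. c l x) (finite_subsets_at_top UNIV)"
    by (rule Weierstrass_m_test_general[where M = M]) (use assms in auto)
qed (auto intro!: always_eventually continuous_on_sum assms(1))

lemma has_sum_integral_dominated:
  fixes c :: "'a \<Rightarrow> real \<Rightarrow> 'c :: banach"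
  assumes "\<And>l. continuous_on {a..b} (c l)" "\<And>l x. x \<in> {a..b} \<Longrightarrow> norm (c l x) \<le> M l"
    "M summable_on UNIV"
  shows "((\<lambda>l. integral {a..b} (c l)) has_sum integral {a..b} (\<lambda>x. \<Sum>\<^sub>\<infinity>l. c l x)) UNIV"
proof -
  have "uniform_limit {a..b} (\<lambda>X x. \<Sum>l\<in>X. c l x) (\<lambda>x. \<Sum>\<^sub>\<infinity>l. c l x) (finite_subsets_at_top UNIV)"
    by (rule Weierstrass_m_test_general[where M = M]) (use assms in auto)
  then obtain I J where I: "\<And>X. ((\<lambda>x. \<Sum>l\<in>X. c l x) has_integral I X) {a..b}"
    and J: "((\<lambda>x. \<Sum>\<^sub>\<infinity>l. c l x) has_integral J) {a..b}"
    and lim: "(I \<longlongrightarrow> J) (finite_subsets_at_top UNIV)"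
    by (rule uniform_limit_integral) (auto intro!: continuous_on_sum assms(1))
  have "I X = (\<Sum>l\<in>X. integral {a..b} (c l))" if "finite X" for X
    using I[of X] that assms(1)
    by (subst integral_sum[symmetric])
       (auto intro!: integrable_continuous_real simp: has_integral_integrable_integral)
  then have "\<forall>\<^sub>F X in finite_subsets_at_top UNIV. I X = (\<Sum>l\<in>X. integral {a..b} (c l))"
    by (auto intro: eventually_finite_subsets_at_top_weakI)
  with lim have "((\<lambda>X. \<Sum>l\<in>X. integral {a..b} (c l)) \<longlongrightarrow> J) (finite_subsets_at_top UNIV)"
    by (rule Lim_transform_eventually)
  then show ?thesis
    using J by (auto simp: has_sum_def has_integral_integrable_integral)
qed

text \<open>The dominated series of derivatives is integrated term by term, and its integral is
  recognised as the increment of the original series; the fundamental theorem of calculus then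
  differentiates it.\<close>

lemma has_vector_derivative_infsum_dominated:
  fixes c :: "'a \<Rightarrow> real \<Rightarrow> 'c :: banach"
  assumes der: "\<And>l x. x \<in> {a..b} \<Longrightarrow> (c l has_vector_derivative c' l x) (at x within {a..b})"
    and cont: "\<And>l. continuous_on {a..b} (c' l)"
    and M: "\<And>l x. x \<in> {a..b} \<Longrightarrow> norm (c' l x) \<le> M l" "M summable_on UNIV"
    and summable: "\<And>x. x \<in> {a..b} \<Longrightarrow> (\<lambda>l. c l x) summable_on UNIV"
    and x: "a < x" "x < b"
  shows "((\<lambda>x. \<Sum>\<^sub>\<infinity>l. c l x) has_vector_derivative (\<Sum>\<^sub>\<infinity>l. c' l x)) (at x)"
proof -
  let ?g = "\<lambda>x. \<Sum>\<^sub>\<infinity>l. c l x" and ?g' = "\<lambda>x. \<Sum>\<^sub>\<infinity>l. c' l x"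
  have eq: "?g a + integral {a..u} ?g' = ?g u" if u: "u \<in> {a..b}" for u
  proof -
    have sub: "{a..u} \<subseteq> {a..b}"
      using u by auto
    have "((\<lambda>l. integral {a..u} (c' l)) has_sum integral {a..u} ?g') UNIV"
      by (rule has_sum_integral_dominated[where M = M])
         (use M sub continuous_on_subset[OF cont sub] in auto)
    moreover have "integral {a..u} (c' l) = c l u - c l a" for l
    proof (rule integral_unique, rule fundamental_theorem_of_calculus)
      show "(c l has_vector_derivative c' l y) (at y within {a..u})" if "y \<in> {a..u}" for y
        by (rule has_vector_derivative_within_subset[OF der sub]) (use that u in auto)
    qed (use u in auto)
    moreover have "((\<lambda>l. c l u + - c l a) has_sum ?g u + - ?g a) UNIV"
      using summable[OF u] summable[of a] u
      by (intro has_sum_add) (auto simp: has_sum_uminus)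
    ultimately have "integral {a..u} ?g' = ?g u + - ?g a"
      by (intro has_sum_unique[of "\<lambda>l. c l u + - c l a"]) simp_all
    then show ?thesis
      by simp
  qed
  have "continuous_on {a..b} ?g'"
    by (rule continuous_on_infsum_dominated[where M = M]) (use cont M in auto)
  then have "((\<lambda>u. integral {a..u} ?g') has_vector_derivative ?g' x) (at x within {a..b})"
    by (rule integral_has_vector_derivative) (use x in auto)
  then have "((\<lambda>u. ?g a + integral {a..u} ?g') has_vector_derivative 0 + ?g' x) (at x within {a..b})"
    by (intro has_vector_derivative_add has_vector_derivative_const)
  then have "((\<lambda>u. ?g a + integral {a..u} ?g') has_vector_derivative ?g' x) (at x within {a..b})"
    by simp
  then have "(?g has_vector_derivative ?g' x) (at x within {a..b})"
    by (rule has_vector_derivative_transform[rotated 2]) (use x eq in auto)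
  then show ?thesis
    by (simp only: at_within_Icc_at[OF x])
qed

section \<open>Weights and rapidly decreasing sequences\<close>

definition wt :: "int \<Rightarrow> real" where
  "wt k = 1 + \<bar>real_of_int k\<bar>"

lemma wt_ge_1 [simp]: "1 \<le> wt k" and wt_pos [simp]: "0 < wt k" and wt_nonneg [simp]: "0 \<le> wt k"
  and wt_nonzero [simp]: "wt k \<noteq> 0"
  by (auto simp: wt_def)

lemma wt_submult: "wt (k + l) \<le> wt k * wt l"
proof -
  have "wt k * wt l = 1 + \<bar>real_of_int k\<bar> + \<bar>real_of_int l\<bar> + \<bar>real_of_int k\<bar> * \<bar>real_of_int l\<bar>"
    by (simp add: wt_def algebra_simps)
  moreover have "0 \<le> \<bar>real_of_int k\<bar> * \<bar>real_of_int l\<bar>"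
    by simp
  ultimately show ?thesis
    unfolding wt_def[of "k + l"] by linarith
qed

lemma wt_pow_submult: "wt k ^ m \<le> wt (k - l) ^ m * wt l ^ m"
  using power_mono[OF wt_submult[of "k - l" l], of m] by (simp add: power_mult_distrib)

text \<open>Peetre's inequality, in the form that moves a weight from the summation index of a
  convolution to its output index.\<close>

lemma wt_diff_bound: "inverse (wt l ^ m) \<le> wt (k - l) ^ m * inverse (wt k ^ m)"
  using wt_pow_submult[of k m l] by (simp add: field_simps)

lemma summable_on_inverse_wt_square: "(\<lambda>k. inverse (wt k ^ 2)) summable_on UNIV"
proof -
  have nat: "(\<lambda>n::nat. inverse ((1 + real n) ^ 2)) summable_on UNIV"
    using inverse_power_summable[of 2, where ?'a = real]
      summable_Suc_iff[of "\<lambda>n. inverse (real n ^ 2)"]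
    by (subst summable_on_UNIV_nonneg_real_iff) (simp_all add: add.commute)
  have "(\<lambda>k. inverse (wt k ^ 2)) summable_on range int"
    using nat by (subst summable_on_reindex) (auto simp: o_def wt_def)
  moreover have "(\<lambda>k. inverse (wt k ^ 2)) summable_on range (\<lambda>n. - int n)"
    using nat by (subst summable_on_reindex) (auto simp: o_def wt_def inj_on_def)
  ultimately have "(\<lambda>k. inverse (wt k ^ 2)) summable_on range int \<union> range (\<lambda>n. - int n)"
    by (rule summable_on_union)
  moreover have "range int \<union> range (\<lambda>n. - int n) = UNIV"
    by (auto simp: image_iff) (metis int_cases2)
  ultimately show ?thesis
    by simp
qed

lemma summable_on_inverse_wt_power: "2 \<le> m \<Longrightarrow> (\<lambda>k. inverse (wt k ^ m)) summable_on UNIV"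
  by (rule dominated_summable_on[OF summable_on_inverse_wt_square])
     (auto intro!: le_imp_inverse_le power_increasing)

definition rapid :: "(int \<Rightarrow> complex) \<Rightarrow> bool" where
  "rapid \<alpha> \<longleftrightarrow> (\<forall>m. \<exists>C. \<forall>k. cmod (\<alpha> k) * wt k ^ m \<le> C)"

lemma rapid_summable: 
  assumes "rapid \<alpha>"
  shows "(\<lambda>k. cmod (\<alpha> k) * wt k ^ m) summable_on UNIV"
proof -
  \<comment> \<open>Two powers beyond \<open>m\<close> are spent on the summable factor
    \<open>inverse (wt k ^ 2)\<close>.\<close>
  obtain C where C: "\<And>k. cmod (\<alpha> k) * wt k ^ (m + 2) \<le> C"
    using assms unfolding rapid_def by blast
  show ?thesis
  proof (rule dominated_summable_on)
    show "(\<lambda>k. C * inverse (wt k ^ 2)) summable_on UNIV"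
      by (intro summable_on_cmult_right summable_on_inverse_wt_square)
    show "norm (cmod (\<alpha> k) * wt k ^ m) \<le> C * inverse (wt k ^ 2)" for k
      using C[of k] by (simp add: power_add field_simps power2_eq_square)
  qed
qed

lemma rapid_summable_norm: "rapid \<alpha> \<Longrightarrow> (\<lambda>k. cmod (\<alpha> k)) summable_on UNIV"
  using rapid_summable[of \<alpha> 0] by simp

lemma rapid_dominated:
  assumes "rapid \<alpha>" "\<And>k. cmod (\<beta> k) \<le> C * cmod (\<alpha> k) * wt k ^ n" 
  shows "rapid \<beta>"
  unfolding rapid_def
proof
  fix m
  obtain D where D: "\<And>k. cmod (\<alpha> k) * wt k ^ (n + m) \<le> D"
    using assms(1) unfolding rapid_def by blast
  have "cmod (\<beta> k) * wt k ^ m \<le> \<bar>C\<bar> * D" for k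
  proof -
    have "cmod (\<beta> k) * wt k ^ m \<le> (C * cmod (\<alpha> k) * wt k ^ n) * wt k ^ m"
      by (intro mult_right_mono assms) auto
    also have "\<dots> = C * (cmod (\<alpha> k) * wt k ^ (n + m))"
      by (simp add: power_add)
    also have "\<dots> \<le> \<bar>C\<bar> * (cmod (\<alpha> k) * wt k ^ (n + m))"
      by (intro mult_right_mono) auto
    also have "\<dots> \<le> \<bar>C\<bar> * D"
      by (intro mult_left_mono D) auto
    finally show ?thesis .
  qed
  then show "\<exists>C. \<forall>k. cmod (\<beta> k) * wt k ^ m \<le> C"
    by blast
qed

section \<open>Reflection of the index and weighted convolution on the integers\<close>

lemma summable_on_diff_shift:
  fixes f :: "int \<Rightarrow> 'a :: {comm_monoid_add, t2_space}"
  shows "(\<lambda>l. f (k - l)) summable_on UNIV \<longleftrightarrow> f summable_on UNIV"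
  by (rule summable_on_reindex_bij_witness[of _ "\<lambda>l. k - l" "\<lambda>l. k - l"]) auto

lemma infsum_diff_shift:
  fixes f :: "int \<Rightarrow> 'a :: {comm_monoid_add, t2_space}"
  shows "(\<Sum>\<^sub>\<infinity>l. f (k - l)) = (\<Sum>\<^sub>\<infinity>l. f l)"
  by (rule infsum_reindex_bij_witness[of _ "\<lambda>l. k - l" "\<lambda>l. k - l"]) auto

text \<open>Submultiplicativity of the weight makes convolution with a weighted summable sequence
  bounded on the space of sequences that are $O(\mathrm{wt}^{-m})$.\<close>

lemma weighted_convolution:
  fixes \<alpha> :: "int \<Rightarrow> real"
  assumes "(\<lambda>l. \<alpha> l * wt l ^ m) summable_on UNIV" "\<And>l. 0 \<le> \<alpha> l"
    and "\<And>l. norm (x l :: 'a :: banach) \<le> \<alpha> (k - l) * (B * inverse (wt l ^ m))" "0 \<le> B"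
  shows "x summable_on UNIV"
    and "norm (\<Sum>\<^sub>\<infinity>l. x l) \<le> B * (\<Sum>\<^sub>\<infinity>l. \<alpha> l * wt l ^ m) * inverse (wt k ^ m)"
proof -
  let ?M = "\<lambda>l. B * inverse (wt k ^ m) * (\<alpha> (k - l) * wt (k - l) ^ m)"
  have le: "norm (x l) \<le> ?M l" for l
  proof -
    have "\<alpha> (k - l) * (B * inverse (wt l ^ m)) \<le> \<alpha> (k - l) * (B * (wt (k - l) ^ m * inverse (wt k ^ m)))"
      by (intro mult_left_mono wt_diff_bound assms)
    then show ?thesis
      using assms(3)[of l] by (simp add: mult_ac)
  qed
  have M: "?M summable_on UNIV"
    using assms(1) by (intro summable_on_cmult_right) (subst summable_on_diff_shift, simp)
  show "x summable_on UNIV"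
    by (rule dominated_summable_on[OF M]) (use le in auto)
  have "norm (\<Sum>\<^sub>\<infinity>l. x l) \<le> (\<Sum>\<^sub>\<infinity>l. ?M l)"
    by (rule norm_infsum_le_dominated[OF M]) (use le in auto)
  also have "\<dots> = B * inverse (wt k ^ m) * (\<Sum>\<^sub>\<infinity>l. \<alpha> (k - l) * wt (k - l) ^ m)"
    by (rule infsum_cmult_right')
  also have "(\<Sum>\<^sub>\<infinity>l. \<alpha> (k - l) * wt (k - l) ^ m) = (\<Sum>\<^sub>\<infinity>l. \<alpha> l * wt l ^ m)"
    by (rule infsum_diff_shift[where f = "\<lambda>l. \<alpha> l * wt l ^ m"])
  finally show "norm (\<Sum>\<^sub>\<infinity>l. x l) \<le> B * (\<Sum>\<^sub>\<infinity>l. \<alpha> l * wt l ^ m) * inverse (wt k ^ m)"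
    by (simp add: mult_ac)
qed

section \<open>Energy estimate for Hermitian infinite systems\<close>

lemma infsum_split_finite:
  fixes f :: "'a \<Rightarrow> 'b :: banach"
  assumes "f summable_on UNIV" "finite X"
  shows "(\<Sum>\<^sub>\<infinity>l. f l) = (\<Sum>l\<in>X. f l) + (\<Sum>\<^sub>\<infinity>l\<in>-X. f l)"
proof -
  have "(\<Sum>\<^sub>\<infinity>l\<in>X \<union> -X. f l) = (\<Sum>\<^sub>\<infinity>l\<in>X. f l) + (\<Sum>\<^sub>\<infinity>l\<in>-X. f l)"
    using assms by (intro infsum_Un_disjoint summable_on_subset_banach[OF assms(1)]) auto
  then show ?thesis
    using assms(2) by (simp only: Compl_partition infsum_finite)
qed

text \<open>The block of the quadratic form inside \<open>X\<close> is real, so only the coupling of \<open>X\<close> to its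
  complement contributes.\<close>

lemma hermitian_truncation_bound:
  fixes A :: "int \<Rightarrow> int \<Rightarrow> complex"
  assumes herm: "\<And>k l. A l k = cnj (A k l)" and bd: "\<And>k l. cmod (A k l) \<le> \<alpha>"
    and \<beta>: "\<And>k. cmod (w k) \<le> \<beta> k" "\<beta> summable_on UNIV" and X: "finite X"
  shows "\<bar>Re (\<Sum>k\<in>X. cnj (w k) * (- \<i> * (\<Sum>\<^sub>\<infinity>l. A k l * w l)))\<bar>
    \<le> \<alpha> * (\<Sum>\<^sub>\<infinity>l. \<beta> l) * ((\<Sum>\<^sub>\<infinity>l. \<beta> l) - sum \<beta> X)"
proof -
  have \<alpha>: "0 \<le> \<alpha>"
    using bd[of 0 0] norm_ge_zero order_trans by blast
  have \<beta>0: "0 \<le> \<beta> k" for k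
    using \<beta>(1)[of k] norm_ge_zero order_trans by blast
  define R where "R k = (\<Sum>\<^sub>\<infinity>l\<in>-X. A k l * w l)" for k
  have dom: "cmod (A k l * w l) \<le> \<alpha> * \<beta> l" for k l
    unfolding norm_mult by (intro mult_mono bd \<beta> \<alpha>) auto
  have \<alpha>\<beta>: "(\<lambda>l. \<alpha> * \<beta> l) summable_on B" for B
    by (intro summable_on_cmult_right summable_on_subset_banach[OF \<beta>(2)]) auto
  have split: "(\<Sum>\<^sub>\<infinity>l. A k l * w l) = (\<Sum>l\<in>X. A k l * w l) + R k" for k
    unfolding R_def by (intro infsum_split_finite X dominated_summable_on[OF \<alpha>\<beta>] dom)
  have tail: "(\<Sum>\<^sub>\<infinity>l\<in>-X. \<beta> l) = (\<Sum>\<^sub>\<infinity>l. \<beta> l) - sum \<beta> X"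
    using infsum_split_finite[OF \<beta>(2) X] by simp
  have R: "cmod (R k) \<le> \<alpha> * ((\<Sum>\<^sub>\<infinity>l. \<beta> l) - sum \<beta> X)" for k
  proof -
    have "cmod (R k) \<le> (\<Sum>\<^sub>\<infinity>l\<in>-X. \<alpha> * \<beta> l)"
      unfolding R_def by (rule norm_infsum_le_dominated[OF \<alpha>\<beta> dom])
    then show ?thesis
      by (simp only: infsum_cmult_right' tail)
  qed
  define S where "S = (\<Sum>k\<in>X. \<Sum>l\<in>X. cnj (w k) * A k l * w l)"
  have "cnj S = (\<Sum>k\<in>X. \<Sum>l\<in>X. w k * A l k * cnj (w l))"
    unfolding S_def by (simp add: herm[symmetric])
  also have "\<dots> = (\<Sum>l\<in>X. \<Sum>k\<in>X. w k * A l k * cnj (w l))"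
    by (rule sum.swap)
  also have "\<dots> = S"
    unfolding S_def by (simp add: mult_ac)
  finally have "Im S = 0"
    by (simp add: complex_eq_iff)
  moreover have "(\<Sum>k\<in>X. cnj (w k) * (- \<i> * (\<Sum>\<^sub>\<infinity>l. A k l * w l)))
      = - \<i> * S + (\<Sum>k\<in>X. cnj (w k) * (- \<i> * R k))"
  proof -
    have "cnj (w k) * (- \<i> * (\<Sum>\<^sub>\<infinity>l. A k l * w l))
        = - \<i> * (\<Sum>l\<in>X. cnj (w k) * A k l * w l) + cnj (w k) * (- \<i> * R k)" for k
      unfolding split by (simp add: ring_distribs sum_distrib_left mult_ac)
    then show ?thesis
      unfolding S_def by (simp only: sum.distrib sum_distrib_left)
  qed
  ultimately have "\<bar>Re (\<Sum>k\<in>X. cnj (w k) * (- \<i> * (\<Sum>\<^sub>\<infinity>l. A k l * w l)))\<bar>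
      = \<bar>Re (\<Sum>k\<in>X. cnj (w k) * (- \<i> * R k))\<bar>"
    by simp
  also have "\<dots> \<le> cmod (\<Sum>k\<in>X. cnj (w k) * (- \<i> * R k))"
    by (rule abs_Re_le_cmod)
  also have "\<dots> \<le> (\<Sum>k\<in>X. \<beta> k * (\<alpha> * ((\<Sum>\<^sub>\<infinity>l. \<beta> l) - sum \<beta> X)))"
    by (intro sum_norm_le) (auto simp: norm_mult intro!: mult_mono \<beta> R \<beta>0)
  also have "\<dots> = sum \<beta> X * (\<alpha> * ((\<Sum>\<^sub>\<infinity>l. \<beta> l) - sum \<beta> X))"
    by (simp add: sum_distrib_right)
  also have "\<dots> \<le> (\<Sum>\<^sub>\<infinity>l. \<beta> l) * (\<alpha> * ((\<Sum>\<^sub>\<infinity>l. \<beta> l) - sum \<beta> X))"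
    using \<alpha> \<beta>0 by (intro mult_right_mono finite_sum_le_infsum \<beta> X mult_nonneg_nonneg)
      (auto intro!: finite_sum_le_infsum \<beta> X)
  finally show ?thesis
    by (simp add: mult_ac)
qed

lemma has_real_derivative_cmod_square:
  assumes "(w has_vector_derivative w') (at t)"
  shows "((\<lambda>t. (cmod (w t))\<^sup>2) has_real_derivative 2 * Re (cnj (w t) * w')) (at t)"
proof -
  have "((\<lambda>t. w t \<bullet> w t) has_derivative (\<lambda>h. w t \<bullet> (h *\<^sub>R w') + (h *\<^sub>R w') \<bullet> w t)) (at t)"
    by (intro has_derivative_inner assms[unfolded has_vector_derivative_def])
  then show ?thesis
    unfolding has_field_derivative_def power2_norm_eq_inner
    by (rule has_derivative_eq_rhs) (auto simp: inner_complex_def algebra_simps)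
qed

text \<open>The infinite sum of squares is not known to be differentiable, so Gronwall's argument
  runs on finite blocks \<open>X\<close>. Hermitian symmetry cancels everything except the coupling
  of \<open>X\<close> to its complement, and this error tends to 0 as \<open>X\<close> exhausts the
  integers because \<open>\<beta>\<close> is a majorant for all times at once. With E the block
  energy, the forcing is absorbed by 2 * sqrt E * \<eta> \<le> (1 + E) * \<eta>; the added 1 avoids
  a division by sqrt E where E vanishes.\<close>

lemma energy_estimate:
  fixes w F :: "int \<Rightarrow> real \<Rightarrow> complex" and A :: "int \<Rightarrow> int \<Rightarrow> real \<Rightarrow> complex"
  assumes t: "t0 \<le> t1"
    and der: "\<And>k t. t \<in> {t0..t1} \<Longrightarrow>
      (w k has_vector_derivative (- \<i> * (\<Sum>\<^sub>\<infinity>l. A k l t * w l t) + F k t)) (at t)"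
    and herm: "\<And>k l t. A l k t = cnj (A k l t)" and bd: "\<And>k l t. cmod (A k l t) \<le> \<alpha>"
    and \<beta>: "\<And>k t. t \<in> {t0..t1} \<Longrightarrow> cmod (w k t) \<le> \<beta> k" "\<beta> summable_on UNIV"
    and F: "\<And>X t. t \<in> {t0..t1} \<Longrightarrow> finite X \<Longrightarrow> (\<Sum>k\<in>X. (cmod (F k t))\<^sup>2) \<le> (\<eta> t)\<^sup>2"
    and \<eta>: "\<And>t. t \<in> {t0..t1} \<Longrightarrow> 0 \<le> \<eta> t" 
    and H: "\<And>t. t \<in> {t0..t1} \<Longrightarrow> (H has_real_derivative \<eta> t) (at t)"
  shows "1 + (\<Sum>\<^sub>\<infinity>k. (cmod (w k t1))\<^sup>2) \<le> (1 + (\<Sum>\<^sub>\<infinity>k. (cmod (w k t0))\<^sup>2)) * exp (H t1 - H t0)"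
proof -
  define B where "B = (\<Sum>\<^sub>\<infinity>l. \<beta> l)"
  define E where "E X t = (\<Sum>k\<in>X. (cmod (w k t))\<^sup>2)" for X t
  define \<tau> where "\<tau> X = 2 * (\<alpha> * B * (B - sum \<beta> X)) * exp (- H t0)" for X
  have \<beta>0: "0 \<le> \<beta> k" for k
    using \<beta>(1)[of t0 k] t norm_ge_zero order_trans by (metis atLeastAtMost_iff order_refl)
  have \<alpha>: "0 \<le> \<alpha>"
    using bd[of 0 0 0] norm_ge_zero order_trans by blast
  have B: "sum \<beta> X \<le> B" if "finite X" for X
    unfolding B_def by (intro finite_sum_le_infsum \<beta> that) (use \<beta>0 in auto)
  have B0: "0 \<le> B"
    using B[of "{}"] by simp
  have Hmono: "H t0 \<le> H s" if "s \<in> {t0..t1}" for s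
    by (rule DERIV_nonneg_imp_nondecreasing) (use that H \<eta> in force)+
  have step: "(1 + E X t1) * exp (- H t1) \<le> (1 + E X t0) * exp (- H t0) + \<tau> X * (t1 - t0)"
    if X: "finite X" for X
  proof -
    \<comment> \<open>\<open>exp (- H t)\<close> is the integrating factor for the forcing. The
      linear term pays for the truncation error, which is at most \<open>\<tau> X\<close> per unit
      of time since \<open>H\<close> does not fall below \<open>H t0\<close>.\<close>
    define D where "D t = (1 + E X t) * exp (- H t) - \<tau> X * t" for t
    have "D t1 \<le> D t0"
    proof (rule DERIV_nonpos_imp_nonincreasing[OF t])
      fix s assume s: "t0 \<le> s" "s \<le> t1"
      then have s': "s \<in> {t0..t1}"
        by simp
      define E' where "E' = (\<Sum>k\<in>X. 2 * Re (cnj (w k s) * (- \<i> * (\<Sum>\<^sub>\<infinity>l. A k l s * w l s) + F k s)))"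
      have dE: "(E X has_real_derivative E') (at s)"
        unfolding E_def[abs_def] E'_def
        by (rule DERIV_sum, rule has_real_derivative_cmod_square, rule der[OF s'])
      have D: "(D has_real_derivative (E' * exp (- H s) + (exp (- H s) * - \<eta> s) * (1 + E X s)) - \<tau> X) (at s)"
        unfolding D_def[abs_def] by (auto intro!: derivative_eq_intros dE H[OF s'])
      have E0: "0 \<le> E X s"
        unfolding E_def by (intro sum_nonneg) auto
      have "E' = 2 * Re (\<Sum>k\<in>X. cnj (w k s) * (- \<i> * (\<Sum>\<^sub>\<infinity>l. A k l s * w l s)))
          + 2 * Re (\<Sum>k\<in>X. cnj (w k s) * F k s)"
        unfolding E'_def Re_sum sum_distrib_left sum.distrib[symmetric]
        by (intro sum.cong refl) (simp only: distrib_left plus_complex.sel)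
      moreover have "Re (\<Sum>k\<in>X. cnj (w k s) * (- \<i> * (\<Sum>\<^sub>\<infinity>l. A k l s * w l s))) \<le> \<alpha> * B * (B - sum \<beta> X)"
        using hermitian_truncation_bound[where A = "\<lambda>k l. A k l s" and w = "\<lambda>k. w k s", OF herm bd \<beta>(1)[OF s'] \<beta>(2) X]
        unfolding B_def by linarith
      moreover have "2 * Re (\<Sum>k\<in>X. cnj (w k s) * F k s) \<le> \<eta> s * (1 + E X s)"
      proof -
        have "Re (\<Sum>k\<in>X. cnj (w k s) * F k s) \<le> cmod (\<Sum>k\<in>X. cnj (w k s) * F k s)"
          by (rule complex_Re_le_cmod)
        also have "\<dots> \<le> (\<Sum>k\<in>X. \<bar>cmod (w k s)\<bar> * \<bar>cmod (F k s)\<bar>)"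
          by (rule sum_norm_le) (simp add: norm_mult)
        also have "\<dots> \<le> L2_set (\<lambda>k. cmod (w k s)) X * L2_set (\<lambda>k. cmod (F k s)) X"
          by (rule L2_set_mult_ineq)
        also have "\<dots> \<le> sqrt (E X s) * \<eta> s"
          unfolding L2_set_def E_def using F[OF s' X] \<eta>[OF s']
          by (intro mult_left_mono real_le_lsqrt) (auto intro: sum_nonneg)
        finally have "2 * Re (\<Sum>k\<in>X. cnj (w k s) * F k s) \<le> (2 * sqrt (E X s)) * \<eta> s"
          by simp
        also have "\<dots> \<le> (1 + E X s) * \<eta> s"
        proof (rule mult_right_mono[OF _ \<eta>[OF s']])
          have "0 \<le> (1 - sqrt (E X s))\<^sup>2"
            by simp
          then show "2 * sqrt (E X s) \<le> 1 + E X s"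
            using E0 by (simp add: power2_eq_square algebra_simps)
        qed
        finally show ?thesis
          by (simp add: mult.commute)
      qed
      ultimately have "E' - \<eta> s * (1 + E X s) \<le> 2 * (\<alpha> * B * (B - sum \<beta> X))"
        by linarith
      then have "(E' - \<eta> s * (1 + E X s)) * exp (- H s) \<le> 2 * (\<alpha> * B * (B - sum \<beta> X)) * exp (- H s)"
        by (rule mult_right_mono) simp
      also have "\<dots> \<le> \<tau> X"
        unfolding \<tau>_def using \<alpha> B0 B[OF X] Hmono[OF s'] by (intro mult_left_mono) auto
      finally have "(E' * exp (- H s) + (exp (- H s) * - \<eta> s) * (1 + E X s)) - \<tau> X \<le> 0"
        by (simp add: algebra_simps)
      with D show "\<exists>y. DERIV D s :> y \<and> y \<le> 0"
        by blast
    qed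
    then show ?thesis
      unfolding D_def by (simp add: algebra_simps)
  qed
  have sq: "(\<lambda>k. (cmod (w k t))\<^sup>2) summable_on UNIV" if "t \<in> {t0..t1}" for t
  proof (rule dominated_summable_on)
    show "(\<lambda>k. B * \<beta> k) summable_on UNIV"
      by (intro summable_on_cmult_right \<beta>)
    show "norm ((cmod (w k t))\<^sup>2) \<le> B * \<beta> k" for k
      using B0 B[of "{k}"] \<beta>(1)[OF that, of k] unfolding power2_eq_square
      by (auto intro!: mult_mono)
  qed
  have lim: "((\<lambda>X. E X t) \<longlongrightarrow> (\<Sum>\<^sub>\<infinity>k. (cmod (w k t))\<^sup>2)) (finite_subsets_at_top UNIV)"
    if "t \<in> {t0..t1}" for t
    unfolding E_def by (rule infsum_tendsto[OF sq[OF that]])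
  have "((\<lambda>X. sum \<beta> X) \<longlongrightarrow> B) (finite_subsets_at_top UNIV)"
    unfolding B_def by (rule infsum_tendsto[OF \<beta>(2)])
  then have "((\<lambda>X. \<tau> X) \<longlongrightarrow> 2 * (\<alpha> * B * (B - B)) * exp (- H t0)) (finite_subsets_at_top UNIV)"
    unfolding \<tau>_def by (intro tendsto_intros)
  then have lim\<tau>: "((\<lambda>X. \<tau> X) \<longlongrightarrow> 0) (finite_subsets_at_top UNIV)"
    by simp
  have "(1 + (\<Sum>\<^sub>\<infinity>k. (cmod (w k t1))\<^sup>2)) * exp (- H t1)
      \<le> (1 + (\<Sum>\<^sub>\<infinity>k. (cmod (w k t0))\<^sup>2)) * exp (- H t0) + 0 * (t1 - t0)"
    by (rule tendsto_le[OF _ tendsto_add[OF tendsto_mult_right[OF tendsto_add[OF tendsto_const lim[of t0]]]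
          tendsto_mult_right[OF lim\<tau>]] tendsto_mult_right[OF tendsto_add[OF tendsto_const lim[of t1]]]])
       (use step t in \<open>auto intro: eventually_finite_subsets_at_top_weakI\<close>)
  then have "(1 + (\<Sum>\<^sub>\<infinity>k. (cmod (w k t1))\<^sup>2)) * exp (- H t1) * exp (H t1)
      \<le> (1 + (\<Sum>\<^sub>\<infinity>k. (cmod (w k t0))\<^sup>2)) * exp (- H t0) * exp (H t1)"
    by simp
  moreover have "exp (- H t1) * exp (H t1) = 1" "exp (- H t0) * exp (H t1) = exp (H t1 - H t0)"
    by (simp_all add: exp_add[symmetric])
  ultimately show ?thesis
    by (simp only: mult.assoc mult_1_right)
qed

text \<open>Reversing time turns the matrix into \<open>- A\<close>, which is again Hermitian and
  bounded; the growth estimate without forcing, read backwards, is a lower bound for the later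
  energy.\<close>

lemma energy_nondecreasing:
  fixes w :: "int \<Rightarrow> real \<Rightarrow> complex" and A :: "int \<Rightarrow> int \<Rightarrow> real \<Rightarrow> complex"
  assumes t: "t0 \<le> t1"
    and der: "\<And>k t. t \<in> {t0..t1} \<Longrightarrow>
      (w k has_vector_derivative (- \<i> * (\<Sum>\<^sub>\<infinity>l. A k l t * w l t))) (at t)"
    and herm: "\<And>k l t. A l k t = cnj (A k l t)" and bd: "\<And>k l t. cmod (A k l t) \<le> \<alpha>"
    and \<beta>: "\<And>k t. t \<in> {t0..t1} \<Longrightarrow> cmod (w k t) \<le> \<beta> k" "\<beta> summable_on UNIV"
  shows "(\<Sum>\<^sub>\<infinity>k. (cmod (w k t0))\<^sup>2) \<le> (\<Sum>\<^sub>\<infinity>k. (cmod (w k t1))\<^sup>2)"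
proof -
  let ?r = "\<lambda>s. t0 + t1 - s"
  have "1 + (\<Sum>\<^sub>\<infinity>k. (cmod (w k (?r t1)))\<^sup>2) \<le> (1 + (\<Sum>\<^sub>\<infinity>k. (cmod (w k (?r t0)))\<^sup>2)) * exp (0 - 0)"
  proof (rule energy_estimate[where w = "\<lambda>k s. w k (?r s)" and A = "\<lambda>k l s. - A k l (?r s)"
        and F = "\<lambda>_ _. 0" and \<alpha> = \<alpha> and \<eta> = "\<lambda>_. 0" and \<beta> = \<beta>, OF t])
    fix k t assume "t \<in> {t0..t1}"
    then have "?r t \<in> {t0..t1}"
      by auto
    from der[OF this] have "(w k has_vector_derivative (- \<i> * (\<Sum>\<^sub>\<infinity>l. A k l (?r t) * w l (?r t)))) (at (?r t))"
      .
    moreover have "(?r has_vector_derivative -1) (at t)"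
      by (auto intro!: derivative_eq_intros)
    ultimately have "((w k \<circ> ?r) has_vector_derivative -1 *\<^sub>R (- \<i> * (\<Sum>\<^sub>\<infinity>l. A k l (?r t) * w l (?r t)))) (at t)"
      by (intro vector_diff_chain_at)
    then show "((\<lambda>s. w k (?r s)) has_vector_derivative - \<i> * (\<Sum>\<^sub>\<infinity>l. - A k l (?r t) * w l (?r t)) + 0) (at t)"
      by (simp add: o_def infsum_uminus)
  next
    show "- A l k (?r t) = cnj (- A k l (?r t))" for k l t
      by (subst herm) simp
  qed (use bd \<beta> in auto)
  then show ?thesis
    by simp
qed

section \<open>Global solutions of infinite linear systems\<close>

text \<open>A signed primitive based at 0: at least one of the two intervals is empty or a single
  point and contributes 0.\<close>

definition prim :: "(real \<Rightarrow> complex) \<Rightarrow> real \<Rightarrow> complex" where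
  "prim g t = integral {0..t} g - integral {t..0} g"

lemma prim_0 [simp]: "prim g 0 = 0"
  by (simp add: prim_def)

lemma has_vector_derivative_prim:
  assumes "continuous_on UNIV g"
  shows "(prim g has_vector_derivative g t) (at t)"
proof -
  \<comment> \<open>The interval \<open>{-N..N}\<close> has both \<open>0\<close> and
    \<open>t\<close> in its interior; the primitives based at \<open>-N\<close> and at
    \<open>0\<close> differ there by a constant.\<close>
  define N where "N = \<bar>t\<bar> + 1"
  have int: "g integrable_on {x..y}" for x y
    by (intro integrable_continuous_real continuous_on_subset[OF assms]) auto
  have eq: "integral {-N..s} g - integral {-N..0} g = prim g s" if "s \<in> {-N..N}" for s
  proof (cases "0 \<le> s")
    case True
    have "integral {-N..0} g + integral {0..s} g = integral {-N..s} g"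
      by (rule Henstock_Kurzweil_Integration.integral_combine) (use True that int in \<open>auto simp: N_def\<close>)
    moreover have "integral {s..0} g = 0"
      using True by (cases "s = 0") auto
    ultimately show ?thesis
      unfolding prim_def by (simp add: algebra_simps)
  next
    case False
    have "integral {-N..s} g + integral {s..0} g = integral {-N..0} g"
      by (rule Henstock_Kurzweil_Integration.integral_combine) (use False that int in \<open>auto simp: N_def\<close>)
    then show ?thesis
      using False unfolding prim_def by (simp add: algebra_simps)
  qed
  have "((\<lambda>s. integral {-N..s} g) has_vector_derivative g t) (at t within {-N..N})"
    by (rule integral_has_vector_derivative[OF continuous_on_subset[OF assms]]) (auto simp: N_def)
  then have "((\<lambda>s. integral {-N..s} g - integral {-N..0} g) has_vector_derivative g t - 0) (at t within {-N..N})"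
    by (intro has_vector_derivative_diff has_vector_derivative_const)
  then have "((\<lambda>s. integral {-N..s} g - integral {-N..0} g) has_vector_derivative g t) (at t within {-N..N})"
    by simp
  then have "(prim g has_vector_derivative g t) (at t within {-N..N})"
    by (rule has_vector_derivative_transform[rotated 2]) (use eq in \<open>auto simp: N_def\<close>)
  moreover have "- N < t" "t < N"
    by (auto simp: N_def)
  ultimately show ?thesis
    by (simp only: at_within_Icc_at)
qed

lemma prim_diff:
  assumes "continuous_on UNIV g" "continuous_on UNIV h"
  shows "prim (\<lambda>s. g s - h s) t = prim g t - prim h t"
proof -
  have "integral {x..y} (\<lambda>s. g s - h s) = integral {x..y} g - integral {x..y} h" for x y
    by (intro integral_diff integrable_continuous_real continuous_on_subset[OF assms(1)]
        continuous_on_subset[OF assms(2)]) auto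
  then show ?thesis
    unfolding prim_def by simp
qed

text \<open>\<open>Z / L * exp (L * s)\<close> is an antiderivative of the bound on
  \<open>g\<close>, so the mean value inequality applies. The gain \<open>1 / L\<close> is what
  later turns integration in time into a contraction for large \<open>L\<close>.\<close>

lemma exp_bound_forward:
  assumes G: "\<And>s. (G has_vector_derivative g s) (at s)" and "G 0 = (0 :: complex)"
    and g: "\<And>s. 0 \<le> s \<Longrightarrow> norm (g s) \<le> Z * exp (L * s)" and "0 < L" "0 \<le> Z" "0 \<le> t"
  shows "norm (G t) \<le> Z / L * exp (L * t)"
proof (cases "t = 0")
  case False
  have "norm (G t - G 0) \<le> Z / L * exp (L * t) - Z / L * exp (L * 0)"
  proof (rule differentiable_bound_general)
    show "continuous_on {0..t} G"
      using G by (meson continuous_at_imp_continuous_on has_vector_derivative_continuous)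
    show "((\<lambda>s. Z / L * exp (L * s)) has_vector_derivative Z * exp (L * s)) (at s)" for s
      using \<open>0 < L\<close> by (auto intro!: derivative_eq_intros simp: has_real_derivative_iff_has_vector_derivative[symmetric])
  qed (use assms False in \<open>auto intro!: continuous_intros\<close>)
  then show ?thesis
    using assms by (simp add: field_simps)
qed (use assms in auto)

lemma norm_prim_le:
  assumes cont: "continuous_on UNIV g" and g: "\<And>s. norm (g s) \<le> Z * exp (L * \<bar>s\<bar>)" and "0 < L" "0 \<le> Z"
  shows "norm (prim g t) \<le> Z / L * exp (L * \<bar>t\<bar>)"
proof (cases "0 \<le> t")
  case True
  show ?thesis
    using exp_bound_forward[OF has_vector_derivative_prim[OF cont] prim_0, of Z L t] True g assms
    by (metis abs_of_nonneg)
next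
  case False
  \<comment> \<open>Negative times reduce to positive ones by reflection.\<close>
  have "((prim g \<circ> uminus) has_vector_derivative - 1 *\<^sub>R g (- s)) (at s)" for s
    by (intro vector_diff_chain_at has_vector_derivative_prim cont) (auto intro!: derivative_eq_intros)
  then have "norm ((prim g \<circ> uminus) (- t)) \<le> Z / L * exp (L * (- t))"
  proof (rule exp_bound_forward)
    show "norm (- 1 *\<^sub>R g (- s)) \<le> Z * exp (L * s)" if "0 \<le> s" for s
      using g[of "- s"] that by simp
  qed (use assms False in auto)
  then show ?thesis
    using False by simp
qed

text \<open>The topology of \<open>int\<close> is discrete, so the second coordinate is constant
  near any point. This places a whole family of coefficients in one space of bounded continuous
  functions on a product.\<close>

lemma continuous_on_real_times_int:
  fixes F :: "real \<Rightarrow> int \<Rightarrow> 'a :: topological_space"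
  assumes "\<And>k. continuous_on UNIV (\<lambda>t. F t k)"
  shows "continuous_on UNIV (\<lambda>(t, k). F t k)"
proof -
  have "((\<lambda>p. F (fst p) (snd p)) \<longlongrightarrow> F t k) (nhds (t, k))" for t k
  proof (rule Lim_transform_eventually)
    have "((\<lambda>s. F s k) \<longlongrightarrow> F t k) (nhds t)"
      using assms[of k] tendsto_at_iff_tendsto_nhds[of "\<lambda>s. F s k" t]
      by (simp add: continuous_on_eq_continuous_at isCont_def)
    then show "((\<lambda>p. F (fst p) k) \<longlongrightarrow> F t k) (nhds (t, k))"
      by (rule filterlim_compose) (auto simp: nhds_prod intro: filterlim_fst)
    have "\<forall>\<^sub>F p in nhds t \<times>\<^sub>F principal {k}. snd p = k"
      by (auto simp: eventually_prod_filter eventually_principal intro!: exI[of _ "\<lambda>_. True"] exI[of _ "\<lambda>l. l = k"])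
    then show "\<forall>\<^sub>F p in nhds (t, k). F (fst p) k = F (fst p) (snd p)"
      unfolding nhds_prod nhds_discrete by eventually_elim simp
  qed
  then have "isCont (\<lambda>p. F (fst p) (snd p)) p" for p
    unfolding isCont_def by (cases p) (auto intro: tendsto_mono[OF at_within_le_nhds])
  then show ?thesis
    by (simp add: continuous_at_imp_continuous_on case_prod_beta)
qed

lemma continuous_on_UNIV_symmetric_intervals:
  fixes f :: "real \<Rightarrow> 'a :: topological_space"
  assumes "\<And>T. continuous_on {-T..T} f"
  shows "continuous_on UNIV f"
proof (rule continuous_at_imp_continuous_on, rule ballI)
  fix t :: real
  have "continuous (at t within {-(\<bar>t\<bar> + 1)..\<bar>t\<bar> + 1}) f"
    using assms[of "\<bar>t\<bar> + 1"] unfolding continuous_on_eq_continuous_within by (rule bspec) auto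
  moreover have "- (\<bar>t\<bar> + 1) < t" "t < \<bar>t\<bar> + 1"
    by auto
  ultimately show "isCont f t"
    by (simp only: at_within_Icc_at)
qed

lemma infsum_diff:
  fixes f g :: "'a \<Rightarrow> 'b :: banach"
  assumes "f summable_on A" "g summable_on A"
  shows "(\<Sum>\<^sub>\<infinity>x\<in>A. f x - g x) = infsum f A - infsum g A"
  using infsum_add[of f A "\<lambda>x. - g x"] assms by (simp add: infsum_uminus summable_on_uminus)


text \<open>The library instance requires a metric domain, which \<open>int\<close> is not.\<close>

lemma complete_UNIV_bcontfun:
  "complete (UNIV :: ('a :: topological_space \<Rightarrow>\<^sub>C 'b :: complete_space) set)"
  unfolding complete_def
proof (intro allI impI)
  fix f :: "nat \<Rightarrow> 'a \<Rightarrow>\<^sub>C 'b"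
  assume "(\<forall>n. f n \<in> UNIV) \<and> Cauchy f"
  then have "uniformly_Cauchy_on UNIV (\<lambda>n. apply_bcontfun (f n))"
    unfolding Cauchy_def uniformly_Cauchy_on_def by (metis dist_fun_lt_imp_dist_val_lt)
  then obtain g where "uniform_limit UNIV (\<lambda>n. apply_bcontfun (f n)) g sequentially"
    using Cauchy_uniformly_convergent uniformly_convergent_on_def by blast
  then show "\<exists>l\<in>UNIV. f \<longlonglongrightarrow> l"
    by (rule uniform_limit_bcontfunE) auto
qed

text \<open>Picard iteration in a weighted (Bielecki) norm. Writing \<open>a k t\<close> as
  \<open>exp (L * \<bar>t\<bar>) * inverse (wt k ^ m) * b (t, k)\<close> makes the unknown
  \<open>b\<close> bounded on the whole time line, so a single fixed point gives the global solution
  together with its decay in \<open>k\<close>.\<close>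

lemma linear_system_solvable_0:
  fixes K :: "int \<Rightarrow> int \<Rightarrow> real \<Rightarrow> complex" and \<alpha> :: "int \<Rightarrow> real" and a0 :: "int \<Rightarrow> complex"
  assumes cont: "\<And>k l. continuous_on UNIV (K k l)"
    and bd: "\<And>k l s. cmod (K k l s) \<le> \<alpha> (k - l)"
    and \<alpha>: "(\<lambda>l. \<alpha> l * wt l ^ m) summable_on UNIV"
    and a0: "\<And>k. cmod (a0 k) * wt k ^ m \<le> C0"
  obtains a :: "int \<Rightarrow> real \<Rightarrow> complex" where "\<And>k. a k 0 = a0 k"
    "\<And>k t. (a k has_vector_derivative (\<Sum>\<^sub>\<infinity>l. K k l t * a l t)) (at t)"
    "\<And>T. \<exists>C\<ge>0. \<forall>k. \<forall>t\<in>{-T..T}. cmod (a k t) \<le> C * inverse (wt k ^ m)"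
proof -
  define M where "M = (\<Sum>\<^sub>\<infinity>l. \<alpha> l * wt l ^ m)"
  have \<alpha>0: "0 \<le> \<alpha> l" for l
    using bd[of l 0 0] norm_ge_zero order_trans by (metis diff_0_right)
  have M0: "0 \<le> M"
    unfolding M_def using \<alpha>0 by (intro infsum_nonneg) auto
  \<comment> \<open>Convolution with the kernel costs \<open>M\<close> and integration in time gains
    \<open>1 / L\<close>; this choice leaves a Lipschitz constant of at most 1/2. The summand 1
    keeps \<open>L\<close> positive when \<open>M\<close> is 0.\<close>
  define L where "L = 2 * M + 1"
  have L: "0 < L" "M / L \<le> 1 / 2"
    using M0 by (auto simp: L_def field_simps)
  define g where "g b k s = (\<Sum>\<^sub>\<infinity>l. K k l s * (exp (L * \<bar>s\<bar>) * inverse (wt l ^ m) * b (s, l)))"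
    for b :: "real \<times> int \<Rightarrow> complex" and k s
  have term_bd: "cmod (K k l s * (exp (L * \<bar>s\<bar>) * inverse (wt l ^ m) * b (s, l)))
      \<le> \<alpha> (k - l) * ((Z * exp (L * \<bar>s\<bar>)) * inverse (wt l ^ m))"
    if "\<And>p. cmod (b p) \<le> Z" for b :: "real \<times> int \<Rightarrow> complex" and Z k l s
  proof -
    have "cmod (K k l s) * (exp (L * \<bar>s\<bar>) * inverse (wt l ^ m) * cmod (b (s, l)))
        \<le> \<alpha> (k - l) * (exp (L * \<bar>s\<bar>) * inverse (wt l ^ m) * Z)"
      by (intro mult_mono bd that \<alpha>0 order_refl) auto
    then show ?thesis
      by (simp add: norm_mult norm_inverse norm_power mult_ac)
  qed
  have summ: "(\<lambda>l. K k l s * (exp (L * \<bar>s\<bar>) * inverse (wt l ^ m) * b (s, l))) summable_on UNIV"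
    if b: "\<And>p. cmod (b p) \<le> Z" for b :: "real \<times> int \<Rightarrow> complex" and Z k s
  proof (rule weighted_convolution(1)[where B = "Z * exp (L * \<bar>s\<bar>)", OF \<alpha> \<alpha>0 term_bd[OF b]])
    have "0 \<le> Z"
      using b norm_ge_zero order_trans by blast
    then show "0 \<le> Z * exp (L * \<bar>s\<bar>)"
      by simp
  qed
  have g_bd: "cmod (g b k s) \<le> (Z * M * inverse (wt k ^ m)) * exp (L * \<bar>s\<bar>)"
    if b: "\<And>p. cmod (b p) \<le> Z" for b Z k s
  proof -
    have "0 \<le> Z"
      using b norm_ge_zero order_trans by blast
    then have "cmod (g b k s) \<le> (Z * exp (L * \<bar>s\<bar>)) * M * inverse (wt k ^ m)"
      unfolding g_def M_def
      by (intro weighted_convolution(2)[OF \<alpha> \<alpha>0]) (rule term_bd, rule b, simp)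
    then show ?thesis
      by (simp add: mult_ac)
  qed
  have g_cont: "continuous_on UNIV (g b k)"
    if b: "\<And>p. cmod (b p) \<le> Z" and bc: "\<And>l. continuous_on UNIV (\<lambda>s. b (s, l))" for b Z k
  proof (rule continuous_on_UNIV_symmetric_intervals)
    fix T :: real
    have Z: "0 \<le> Z"
      using b norm_ge_zero order_trans by blast
    show "continuous_on {-T..T} (g b k)"
      unfolding g_def
    proof (rule continuous_on_infsum_dominated)
      show "continuous_on {-T..T} (\<lambda>s. K k l s * (exp (L * \<bar>s\<bar>) * inverse (wt l ^ m) * b (s, l)))" for l
        by (intro continuous_intros continuous_on_subset[OF cont] continuous_on_subset[OF bc]) auto
      show "cmod (K k l s * (exp (L * \<bar>s\<bar>) * inverse (wt l ^ m) * b (s, l)))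
          \<le> \<alpha> (k - l) * ((Z * exp (L * \<bar>T\<bar>)) * inverse (wt l ^ m))" if "s \<in> {-T..T}" for l s
      proof (rule order_trans[OF term_bd[OF b]])
        show "\<alpha> (k - l) * ((Z * exp (L * \<bar>s\<bar>)) * inverse (wt l ^ m))
            \<le> \<alpha> (k - l) * ((Z * exp (L * \<bar>T\<bar>)) * inverse (wt l ^ m))"
          using that L Z \<alpha>0 by (intro mult_left_mono mult_right_mono) auto
      qed
      show "(\<lambda>l. \<alpha> (k - l) * ((Z * exp (L * \<bar>T\<bar>)) * inverse (wt l ^ m))) summable_on UNIV"
        by (rule weighted_convolution(1)[OF \<alpha> \<alpha>0, where k = k and B = "Z * exp (L * \<bar>T\<bar>)"])
          (use \<alpha>0 Z in auto)
    qed
  qed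
  \<comment> \<open>The integral equation for \<open>a\<close>, rewritten for the rescaled unknown
    \<open>b\<close>.\<close>
  define \<Phi> where "\<Phi> b = (\<lambda>(t, k). exp (- L * \<bar>t\<bar>) * wt k ^ m * (a0 k + prim (g b k) t))"
    for b :: "real \<times> int \<Rightarrow> complex"
  have prim_bd: "cmod (exp (- L * \<bar>t\<bar>) * wt k ^ m * prim h t) \<le> Z * (M / L)"
    if "continuous_on UNIV h" "\<And>s. cmod (h s) \<le> (Z * M * inverse (wt k ^ m)) * exp (L * \<bar>s\<bar>)" "0 \<le> Z"
    for h Z k t
  proof -
    have "cmod (prim h t) \<le> (Z * M * inverse (wt k ^ m)) / L * exp (L * \<bar>t\<bar>)"
      by (rule norm_prim_le) (use that L M0 in auto)
    then have "exp (- L * \<bar>t\<bar>) * wt k ^ m * cmod (prim h t)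
        \<le> exp (- L * \<bar>t\<bar>) * wt k ^ m * ((Z * M * inverse (wt k ^ m)) / L * exp (L * \<bar>t\<bar>))"
      by (intro mult_left_mono) auto
    also have "\<dots> = Z * (M / L)"
      by (simp add: exp_minus field_simps)
    finally show ?thesis
      by (simp add: norm_mult norm_power)
  qed
  have bc: "continuous_on UNIV (\<lambda>s. apply_bcontfun b (s, l))" for b :: "(real \<times> int) \<Rightarrow>\<^sub>C complex" and l
    by (rule continuous_on_compose2[OF continuous_on_apply_bcontfun[of UNIV b]]) (auto intro!: continuous_intros)
  note gc = g_cont[OF norm_bounded bc]
  \<comment> \<open>This membership allows \<open>Bcontfun\<close> to be undone, so that a fixed
    point in the function space is a genuine fixed point of \<open>\<Phi>\<close>.\<close>
  have \<Phi>: "\<Phi> (apply_bcontfun b) \<in> bcontfun" for b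
  proof (rule bcontfun_normI)
    have "continuous_on UNIV (prim (g (apply_bcontfun b) k))" for k
      using has_vector_derivative_prim[OF gc] 
      by (meson continuous_at_imp_continuous_on has_vector_derivative_continuous)
    then show "continuous_on UNIV (\<Phi> (apply_bcontfun b))"
      unfolding \<Phi>_def by (intro continuous_on_real_times_int continuous_intros)
    show "cmod (\<Phi> (apply_bcontfun b) p) \<le> C0 + norm b * (M / L)" for p
    proof (cases p)
      case (Pair t k)
      have "cmod (\<Phi> (apply_bcontfun b) p) \<le> cmod (exp (- L * \<bar>t\<bar>) * wt k ^ m * a0 k)
          + cmod (exp (- L * \<bar>t\<bar>) * wt k ^ m * prim (g (apply_bcontfun b) k) t)"
        unfolding \<Phi>_def Pair prod.case ring_distribs by (rule norm_triangle_ineq)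
      moreover have "cmod (exp (- L * \<bar>t\<bar>) * wt k ^ m * prim (g (apply_bcontfun b) k) t) \<le> norm b * (M / L)"
        by (rule prim_bd[OF gc g_bd]) (auto intro: norm_bounded)
      moreover have "cmod (exp (- L * \<bar>t\<bar>) * wt k ^ m * a0 k) \<le> 1 * (cmod (a0 k) * wt k ^ m)"
      proof -
        have "exp (- L * \<bar>t\<bar>) * (cmod (a0 k) * wt k ^ m) \<le> 1 * (cmod (a0 k) * wt k ^ m)"
          using L by (intro mult_right_mono) auto
        then show ?thesis
          by (simp add: norm_mult norm_power mult_ac)
      qed
      ultimately show ?thesis
        using a0[of k] by linarith
    qed
  qed
  have "\<exists>!b\<in>UNIV. Bcontfun (\<Phi> (apply_bcontfun b)) = b"
  proof (rule Banach_fix[where c = "1 / 2", OF complete_UNIV_bcontfun])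
    fix b b' :: "(real \<times> int) \<Rightarrow>\<^sub>C complex"
    show "dist (Bcontfun (\<Phi> (apply_bcontfun b))) (Bcontfun (\<Phi> (apply_bcontfun b'))) \<le> 1 / 2 * dist b b'"
    proof (rule dist_bound)
      fix p :: "real \<times> int"
      obtain t k where p: "p = (t, k)"
        by (cases p)
      \<comment> \<open>\<open>g\<close> is linear in \<open>b\<close>, so the contraction estimate
        is the bound on \<open>g\<close> at the difference \<open>b - b'\<close>.\<close>
      have gd: "g (apply_bcontfun b) k s - g (apply_bcontfun b') k s = g (apply_bcontfun (b - b')) k s" for s
        unfolding g_def
        by (subst infsum_diff[symmetric], (rule summ, rule norm_bounded)+) (simp add: algebra_simps)
      have "dist (\<Phi> (apply_bcontfun b) p) (\<Phi> (apply_bcontfun b') p)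
          = cmod (exp (- L * \<bar>t\<bar>) * wt k ^ m * prim (\<lambda>s. g (apply_bcontfun b) k s - g (apply_bcontfun b') k s) t)"
        unfolding \<Phi>_def p dist_norm prim_diff[OF gc gc] by (simp add: algebra_simps)
      also have "\<dots> \<le> norm (b - b') * (M / L)"
        unfolding gd by (rule prim_bd[OF gc g_bd]) (rule norm_bounded, simp)
      also have "\<dots> \<le> norm (b - b') * (1 / 2)"
        by (intro mult_left_mono L) auto
      finally show "dist (Bcontfun (\<Phi> (apply_bcontfun b)) p) (Bcontfun (\<Phi> (apply_bcontfun b')) p) \<le> 1 / 2 * dist b b'"
        by (simp add: Bcontfun_inverse \<Phi> dist_norm)
    qed
  qed auto
  then obtain b where "Bcontfun (\<Phi> (apply_bcontfun b)) = b"
    by blast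
  then have fp: "apply_bcontfun b = \<Phi> (apply_bcontfun b)"
    using Bcontfun_inverse[OF \<Phi>[of b]] by simp
  define a where "a k t = exp (L * \<bar>t\<bar>) * inverse (wt k ^ m) * apply_bcontfun b (t, k)" for k t
  have g_eq: "g (apply_bcontfun b) k s = (\<Sum>\<^sub>\<infinity>l. K k l s * a l s)" for k s
    unfolding g_def a_def ..
  have a_eq: "a k t = a0 k + prim (\<lambda>s. \<Sum>\<^sub>\<infinity>l. K k l s * a l s) t" for k t
  proof -
    have "a k t = (exp (L * \<bar>t\<bar>) * exp (- L * \<bar>t\<bar>)) * (inverse (wt k ^ m) * wt k ^ m)
        * (a0 k + prim (g (apply_bcontfun b) k) t)"
      unfolding a_def by (subst fp) (simp add: \<Phi>_def mult_ac)
    also have "exp (L * \<bar>t\<bar>) * exp (- L * \<bar>t\<bar>) = 1"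
      by (simp add: exp_minus)
    finally show ?thesis
      by (simp add: g_eq[abs_def])
  qed
  show ?thesis
  proof
    show "a k 0 = a0 k" for k
      by (subst a_eq) simp
    have "continuous_on UNIV (\<lambda>s. \<Sum>\<^sub>\<infinity>l. K k l s * a l s)" for k
      using gc[of b k] by (simp add: g_eq[abs_def])
    from has_vector_derivative_prim[OF this]
    have "((\<lambda>t. a0 k + prim (\<lambda>s. \<Sum>\<^sub>\<infinity>l. K k l s * a l s) t) has_vector_derivative 0 + (\<Sum>\<^sub>\<infinity>l. K k l t * a l t)) (at t)" for k t
      by (intro has_vector_derivative_add has_vector_derivative_const)
    then show "(a k has_vector_derivative (\<Sum>\<^sub>\<infinity>l. K k l t * a l t)) (at t)" for k t
      by (simp only: a_eq[symmetric] add_0)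
    show "\<exists>C\<ge>0. \<forall>k. \<forall>t\<in>{-T..T}. cmod (a k t) \<le> C * inverse (wt k ^ m)" for T
    proof (intro exI conjI allI ballI)
      show "0 \<le> exp (L * \<bar>T\<bar>) * norm b"
        by simp
      fix k t assume t: "t \<in> {-T..T}"
      have "cmod (a k t) = exp (L * \<bar>t\<bar>) * cmod (apply_bcontfun b (t, k)) * inverse (wt k ^ m)"
        by (simp add: a_def norm_mult norm_inverse norm_power)
      also have "\<dots> \<le> exp (L * \<bar>T\<bar>) * norm b * inverse (wt k ^ m)"
        using t L by (intro mult_right_mono mult_mono norm_bounded) auto
      finally show "cmod (a k t) \<le> exp (L * \<bar>T\<bar>) * norm b * inverse (wt k ^ m)" .
    qed
  qed
qed

lemma linear_system_solvable:
  fixes K :: "int \<Rightarrow> int \<Rightarrow> real \<Rightarrow> complex" and \<alpha> :: "int \<Rightarrow> real" and a0 :: "int \<Rightarrow> complex"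
  assumes cont: "\<And>k l. continuous_on UNIV (K k l)"
    and bd: "\<And>k l s. cmod (K k l s) \<le> \<alpha> (k - l)"
    and \<alpha>: "(\<lambda>l. \<alpha> l * wt l ^ m) summable_on UNIV"
    and a0: "\<And>k. cmod (a0 k) * wt k ^ m \<le> C0"
  obtains a :: "int \<Rightarrow> real \<Rightarrow> complex" where "\<And>k. a k t0 = a0 k"
    "\<And>k t. (a k has_vector_derivative (\<Sum>\<^sub>\<infinity>l. K k l t * a l t)) (at t)"
    "\<And>T. \<exists>C\<ge>0. \<forall>k. \<forall>t\<in>{-T..T}. cmod (a k t) \<le> C * inverse (wt k ^ m)"
proof -
  have "continuous_on UNIV (\<lambda>s. K k l (s + t0))" for k l
    by (rule continuous_on_compose2[OF cont]) (auto intro!: continuous_intros)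
  then obtain a where a: "\<And>k. a k 0 = a0 k"
    "\<And>k t. (a k has_vector_derivative (\<Sum>\<^sub>\<infinity>l. K k l (t + t0) * a l t)) (at t)"
    "\<And>T. \<exists>C\<ge>0. \<forall>k. \<forall>t\<in>{-T..T}. cmod (a k t) \<le> C * inverse (wt k ^ m)"
    using bd \<alpha> a0 by (rule linear_system_solvable_0[where K = "\<lambda>k l s. K k l (s + t0)"]) blast
  show ?thesis
  proof (rule that[of "\<lambda>k t. a k (t - t0)"])
    show "a k (t0 - t0) = a0 k" for k
      by (simp add: a)
    fix k t
    have "((\<lambda>t. t - t0) has_vector_derivative 1) (at t)"
      by (auto intro!: derivative_eq_intros)
    from vector_diff_chain_at[OF this a(2)[of k "t - t0"]]
    show "((\<lambda>t. a k (t - t0)) has_vector_derivative (\<Sum>\<^sub>\<infinity>l. K k l t * a l (t - t0))) (at t)"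
      by (simp add: o_def)
  next
    fix T
    \<comment> \<open>The window is enlarged by \<open>\<bar>t0\<bar>\<close> so that it contains
      the shifted times \<open>t - t0\<close>.\<close>
    obtain C where C: "0 \<le> C"
      "\<And>k t. t \<in> {-(T + \<bar>t0\<bar>)..T + \<bar>t0\<bar>} \<Longrightarrow> cmod (a k t) \<le> C * inverse (wt k ^ m)"
      using a(3)[of "T + \<bar>t0\<bar>"] by blast
    show "\<exists>C\<ge>0. \<forall>k. \<forall>t\<in>{-T..T}. cmod (a k (t - t0)) \<le> C * inverse (wt k ^ m)"
      by (intro exI[of _ C] conjI allI ballI C) auto
  qed
qed

section \<open>Non-stationary phase, uniformly in a parameter\<close>

text \<open>\<open>ubd Z a b P n g\<close>: the derivatives of \<open>g p\<close> on \<open>{a..b}\<close> up to order \<open>n\<close> exist and are bounded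
  uniformly in \<open>p \<in> P\<close>, and those of order less than \<open>n\<close> vanish on \<open>Z\<close>.\<close>

fun ubd :: "real set \<Rightarrow> real \<Rightarrow> real \<Rightarrow> 'p set \<Rightarrow> nat \<Rightarrow> ('p \<Rightarrow> real \<Rightarrow> real) \<Rightarrow> bool" where
  "ubd Z a b P 0 g \<longleftrightarrow> (\<exists>C. \<forall>p\<in>P. \<forall>x\<in>{a..b}. \<bar>g p x\<bar> \<le> C)"
| "ubd Z a b P (Suc n) g \<longleftrightarrow> (\<exists>C. \<forall>p\<in>P. \<forall>x\<in>{a..b}. \<bar>g p x\<bar> \<le> C) \<and> (\<forall>p\<in>P. \<forall>x\<in>Z. g p x = 0) \<and>
    (\<exists>g'. (\<forall>p\<in>P. \<forall>x\<in>{a..b}. (g p has_real_derivative g' p x) (at x within {a..b})) \<and> ubd Z a b P n g')"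

section \<open>Calculus of families with uniformly bounded derivatives\<close>

lemma ubd_SucI:
  assumes "ubd Z a b P 0 g" "\<And>p x. p \<in> P \<Longrightarrow> x \<in> Z \<Longrightarrow> g p x = 0"
    "\<And>p x. p \<in> P \<Longrightarrow> x \<in> {a..b} \<Longrightarrow> (g p has_real_derivative g' p x) (at x within {a..b})"
    "ubd Z a b P n g'"
  shows "ubd Z a b P (Suc n) g"
  using assms unfolding ubd.simps by blast

lemma ubd_SucE:
  assumes "ubd Z a b P (Suc n) g"
  obtains g' where "\<And>p x. p \<in> P \<Longrightarrow> x \<in> Z \<Longrightarrow> g p x = 0"
    "\<And>p x. p \<in> P \<Longrightarrow> x \<in> {a..b} \<Longrightarrow> (g p has_real_derivative g' p x) (at x within {a..b})"
    "ubd Z a b P n g'"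
  using assms unfolding ubd.simps by blast

lemma ubd_0_D: "ubd Z a b P n g \<Longrightarrow> ubd Z' a b P 0 g"
  by (cases n) auto

declare ubd.simps(2) [simp del]

lemma ubd_Suc_D: "ubd Z a b P (Suc n) g \<Longrightarrow> ubd Z a b P n g"
proof (induction n arbitrary: g)
  case 0
  then show ?case
    by (rule ubd_0_D)
next
  case (Suc n)
  from Suc.prems obtain g' where g': "\<And>p x. p \<in> P \<Longrightarrow> x \<in> Z \<Longrightarrow> g p x = 0"
    "\<And>p x. p \<in> P \<Longrightarrow> x \<in> {a..b} \<Longrightarrow> (g p has_real_derivative g' p x) (at x within {a..b})"
    "ubd Z a b P (Suc n) g'"
    by (rule ubd_SucE) blast
  show ?case
    by (rule ubd_SucI[OF ubd_0_D[OF Suc.prems] g'(1,2) Suc.IH[OF g'(3)]])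
qed

lemma ubd_add: "ubd Z a b P n f \<Longrightarrow> ubd Z a b P n g \<Longrightarrow> ubd Z a b P n (\<lambda>p x. f p x + g p x)"
proof (induction n arbitrary: f g)
  case 0
  then obtain C D where CD: "\<And>p x. p \<in> P \<Longrightarrow> x \<in> {a..b} \<Longrightarrow> \<bar>f p x\<bar> \<le> C"
    "\<And>p x. p \<in> P \<Longrightarrow> x \<in> {a..b} \<Longrightarrow> \<bar>g p x\<bar> \<le> D"
    unfolding ubd.simps by blast
  have "\<bar>f p x + g p x\<bar> \<le> C + D" if "p \<in> P" "x \<in> {a..b}" for p x
    using CD[OF that] by linarith
  then show ?case
    unfolding ubd.simps by blast
next
  case (Suc n)
  from Suc.prems(1) obtain f' where f': "\<And>p x. p \<in> P \<Longrightarrow> x \<in> Z \<Longrightarrow> f p x = 0"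
    "\<And>p x. p \<in> P \<Longrightarrow> x \<in> {a..b} \<Longrightarrow> (f p has_real_derivative f' p x) (at x within {a..b})"
    "ubd Z a b P n f'"
    by (rule ubd_SucE) blast
  from Suc.prems(2) obtain g' where g': "\<And>p x. p \<in> P \<Longrightarrow> x \<in> Z \<Longrightarrow> g p x = 0"
    "\<And>p x. p \<in> P \<Longrightarrow> x \<in> {a..b} \<Longrightarrow> (g p has_real_derivative g' p x) (at x within {a..b})"
    "ubd Z a b P n g'"
    by (rule ubd_SucE) blast
  show ?case
  proof (rule ubd_SucI)
    show "ubd Z a b P 0 (\<lambda>p x. f p x + g p x)"
      by (rule ubd_0_D[OF Suc.IH[OF ubd_Suc_D ubd_Suc_D]]) (rule Suc.prems)+
    show "((\<lambda>x. f p x + g p x) has_real_derivative f' p x + g' p x) (at x within {a..b})"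
      if "p \<in> P" "x \<in> {a..b}" for p x
      by (intro DERIV_add f' g' that)
  qed (use f' g' Suc.IH in auto)
qed

text \<open>In the Leibniz formula each term of a derivative of order below \<open>n\<close>
  contains a derivative of \<open>f\<close> of order below \<open>n\<close>, so the zeros on
  \<open>Z\<close> are inherited from \<open>f\<close> alone.\<close>

lemma ubd_mult: "ubd Z a b P n f \<Longrightarrow> ubd {} a b P n g \<Longrightarrow> ubd Z a b P n (\<lambda>p x. f p x * g p x)"
proof (induction n arbitrary: f g)
  case 0
  then obtain C D where CD: "\<And>p x. p \<in> P \<Longrightarrow> x \<in> {a..b} \<Longrightarrow> \<bar>f p x\<bar> \<le> C"
    "\<And>p x. p \<in> P \<Longrightarrow> x \<in> {a..b} \<Longrightarrow> \<bar>g p x\<bar> \<le> D"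
    unfolding ubd.simps by blast
  have "\<bar>f p x * g p x\<bar> \<le> C * D" if "p \<in> P" "x \<in> {a..b}" for p x
    using CD(1)[OF that] CD(2)[OF that] unfolding abs_mult by (intro mult_mono) auto
  then show ?case
    unfolding ubd.simps by blast
next
  case (Suc n)
  from Suc.prems(1) obtain f' where f': "\<And>p x. p \<in> P \<Longrightarrow> x \<in> Z \<Longrightarrow> f p x = 0"
    "\<And>p x. p \<in> P \<Longrightarrow> x \<in> {a..b} \<Longrightarrow> (f p has_real_derivative f' p x) (at x within {a..b})"
    "ubd Z a b P n f'"
    by (rule ubd_SucE) blast
  from Suc.prems(2) obtain g' where g':
    "\<And>p x. p \<in> P \<Longrightarrow> x \<in> {a..b} \<Longrightarrow> (g p has_real_derivative g' p x) (at x within {a..b})"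
    "ubd {} a b P n g'"
    by (rule ubd_SucE) blast
  note low = ubd_Suc_D[OF Suc.prems(1)] ubd_Suc_D[OF Suc.prems(2)]
  show ?case
  proof (rule ubd_SucI)
    show "ubd Z a b P 0 (\<lambda>p x. f p x * g p x)"
      by (rule ubd_0_D[OF Suc.IH[OF low]])
    show "((\<lambda>x. f p x * g p x) has_real_derivative f' p x * g p x + f p x * g' p x) (at x within {a..b})"
      if "p \<in> P" "x \<in> {a..b}" for p x
      using DERIV_mult[OF f'(2)[OF that] g'(1)[OF that]] by (simp add: mult.commute)
    show "ubd Z a b P n (\<lambda>p x. f' p x * g p x + f p x * g' p x)"
      by (intro ubd_add Suc.IH f' g' low)
  qed (use f' in auto)
qed

lemma ubd_const: "(\<And>p. p \<in> P \<Longrightarrow> \<bar>c p\<bar> \<le> C) \<Longrightarrow> ubd {} a b P n (\<lambda>p x. c p)"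
proof (induction n arbitrary: c C)
  case 0
  then show ?case
    by auto
next
  case (Suc n)
  show ?case
    by (rule ubd_SucI[where g' = "\<lambda>p x. 0"]) (use Suc.IH[of "\<lambda>_. 0" 0] Suc.prems in auto)
qed

lemma ubd_real_const: "ubd {} a b P n (\<lambda>p x. c)"
  by (rule ubd_const[where C = "\<bar>c\<bar>"]) simp

lemma ubd_ident: "ubd {} a b P n (\<lambda>p x. x)"
proof -
  have "\<bar>x\<bar> \<le> \<bar>a\<bar> + \<bar>b\<bar>" if "x \<in> {a..b}" for x
    using that by auto
  then have 0: "ubd {} a b P 0 (\<lambda>p x. x)"
    unfolding ubd.simps by blast
  show ?thesis
  proof (cases n)
    case (Suc m)
    then show ?thesis
      by (auto intro!: ubd_SucI[where g' = "\<lambda>p x. 1"] ubd_real_const 0[simplified])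
  qed (use 0 in simp)
qed

text \<open>The derivative of the inverse is minus \<open>f'\<close> times two copies of the
  inverse, all of them controlled to the lower order, which closes the induction; the uniform
  distance \<open>c\<close> from 0 starts it.\<close>

lemma ubd_inverse:
  assumes "ubd {} a b P n f" "0 < c" "\<And>p x. p \<in> P \<Longrightarrow> x \<in> {a..b} \<Longrightarrow> c \<le> \<bar>f p x\<bar>"
  shows "ubd {} a b P n (\<lambda>p x. inverse (f p x))"
  using assms(1)
proof (induction n)
  case 0
  then show ?case
    using assms(2,3) by (auto intro!: exI[of _ "inverse c"] le_imp_inverse_le)
next
  case (Suc n)
  from Suc.prems obtain f' where f':
    "\<And>p x. p \<in> P \<Longrightarrow> x \<in> {a..b} \<Longrightarrow> (f p has_real_derivative f' p x) (at x within {a..b})"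
    "ubd {} a b P n f'"
    by (rule ubd_SucE) blast
  have inv: "ubd {} a b P n (\<lambda>p x. inverse (f p x))"
    by (rule Suc.IH[OF ubd_Suc_D[OF Suc.prems]])
  show ?case
  proof (rule ubd_SucI[OF ubd_0_D[OF inv]])
    show "((\<lambda>x. inverse (f p x)) has_real_derivative (- 1) * ((inverse (f p x) * f' p x) * inverse (f p x)))
        (at x within {a..b})" if "p \<in> P" "x \<in> {a..b}" for p x
    proof -
      have "f p x \<noteq> 0"
        using assms(2) assms(3)[OF that] by auto
      from DERIV_inverse'[OF f'(1)[OF that] this] show ?thesis
        by simp
    qed
    show "ubd {} a b P n (\<lambda>p x. (- 1) * ((inverse (f p x) * f' p x) * inverse (f p x)))"
      by (intro ubd_mult inv f' ubd_real_const)
  qed auto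
qed

lemma ubd_power: "ubd {} a b P n g \<Longrightarrow> ubd {} a b P n (\<lambda>p x. g p x ^ m)"
  by (induction m) (auto intro!: ubd_mult ubd_real_const)

text \<open>With Q = (x - a) * (b - x), the derivative of Q^{n+1} g is Q^n ((n+1) Q' g + Q g'),
  which has the same form with one power of Q and one derivative fewer. Each differentiation costs
  one order of vanishing at the endpoints.\<close>

lemma ubd_bump:
  "ubd {} a b P n g \<Longrightarrow> ubd {a, b} a b P n (\<lambda>p x. ((x - a) * (b - x)) ^ n * g p x)"
proof (induction n arbitrary: g)
  case (Suc n)
  have q: "ubd {} a b P m (\<lambda>p x. (x + (- a)) * (b + (-1) * x))" for m
    by (intro ubd_mult ubd_add ubd_ident ubd_real_const)
  from Suc.prems obtain g' where g':
    "\<And>p x. p \<in> P \<Longrightarrow> x \<in> {a..b} \<Longrightarrow> (g p has_real_derivative g' p x) (at x within {a..b})"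
    "ubd {} a b P n g'"
    by (rule ubd_SucE) blast
  have "ubd {} a b P n (\<lambda>p x. (real (Suc n) * (a + b + (-2) * x)) * g p x + ((x + (- a)) * (b + (-1) * x)) * g' p x)"
    by (intro ubd_add ubd_mult g' ubd_Suc_D[OF Suc.prems] ubd_ident ubd_real_const)
  from Suc.IH[OF this] show ?case
  proof (rule ubd_SucI[rotated 3])
    show "ubd {a, b} a b P 0 (\<lambda>p x. ((x - a) * (b - x)) ^ Suc n * g p x)"
      using ubd_0_D[OF ubd_mult[OF ubd_power[OF q] Suc.prems, of "Suc n"]] by simp
    fix p x assume "p \<in> P" "x \<in> {a..b}"
    then have "(g p has_real_derivative g' p x) (at x within {a..b})"
      by (rule g')
    moreover have "((\<lambda>x. (x - a) * (b - x)) has_real_derivative a + b + (-2) * x) (at x within {a..b})"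
      by (auto intro!: derivative_eq_intros)
    moreover define Q where "Q = (x - a) * (b - x)"
    ultimately have "((\<lambda>x. ((x - a) * (b - x)) ^ Suc n * g p x) has_real_derivative
        (1 + real n) * ((a + b + (-2) * x) * Q ^ n) * g p x + g' p x * Q ^ Suc n) (at x within {a..b})"
      unfolding Q_def by (intro DERIV_mult DERIV_power_Suc)
    moreover have "(1 + real n) * ((a + b + (-2) * x) * Q ^ n) * g p x + g' p x * Q ^ Suc n
        = Q ^ n * ((real (Suc n) * (a + b + (-2) * x)) * g p x + Q * g' p x)"
      by (simp add: algebra_simps)
    moreover have "Q = (x + (- a)) * (b + (-1) * x)"
      by (simp add: Q_def)
    ultimately show "((\<lambda>x. ((x - a) * (b - x)) ^ Suc n * g p x) has_real_derivative
        ((x - a) * (b - x)) ^ n *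
        ((real (Suc n) * (a + b + (-2) * x)) * g p x + ((x + (- a)) * (b + (-1) * x)) * g' p x)) (at x within {a..b})"
      by (metis Q_def)
  qed auto
qed auto

text \<open>Each integration by parts replaces \<open>g\<close> by the derivative of
  \<open>g * lam / S'\<close> and gains \<open>1 / lam\<close>; boundary terms vanish because
  \<open>g\<close> is zero at \<open>a\<close> and \<open>b\<close>. Bounding
  \<open>lam / S'\<close> with all its derivatives keeps the constant independent of
  \<open>p\<close> through the iteration.\<close>

lemma non_stationary_phase:
  fixes S S' :: "'p \<Rightarrow> real \<Rightarrow> real"
  assumes ab: "a \<le> b"
    and S: "\<And>p x. p \<in> P \<Longrightarrow> x \<in> {a..b} \<Longrightarrow> (S p has_real_derivative S' p x) (at x within {a..b})"
    and nz: "\<And>p x. p \<in> P \<Longrightarrow> x \<in> {a..b} \<Longrightarrow> S' p x \<noteq> 0"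
    and lam: "\<And>p. p \<in> P \<Longrightarrow> 0 < lam p"
    and h: "\<And>n. ubd {} a b P n (\<lambda>p x. lam p * inverse (S' p x))"
    and g: "ubd {a, b} a b P n g"
  shows "\<exists>C. \<forall>p\<in>P. cmod (integral {a..b} (\<lambda>x. of_real (g p x) * cis (S p x))) \<le> C / lam p ^ n"
  using g
proof (induction n arbitrary: g)
  case 0
  then obtain C where C: "\<And>p x. p \<in> P \<Longrightarrow> x \<in> {a..b} \<Longrightarrow> \<bar>g p x\<bar> \<le> C"
    unfolding ubd.simps by blast
  have "cmod (integral {a..b} (\<lambda>x. of_real (g p x) * cis (S p x))) \<le> \<bar>C\<bar> * (b - a)" if p: "p \<in> P" for p
  \<comment> \<open>Order 0 of \<open>ubd\<close> gives boundedness but no continuity. A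
    non-integrable integrand has integral 0 by convention, so the bound holds in both cases.\<close>
  proof (cases "(\<lambda>x. of_real (g p x) * cis (S p x)) integrable_on {a..b}")
    case True
    have "cmod (integral {a..b} (\<lambda>x. of_real (g p x) * cis (S p x))) \<le> integral {a..b} (\<lambda>x. \<bar>C\<bar>)"
      by (rule integral_norm_bound_integral[OF True]) (use C[OF p] in \<open>auto simp: norm_mult intro!: order_trans[OF _ abs_ge_self]\<close>)
    then show ?thesis
      using ab by (simp add: mult.commute)
  qed (use ab in \<open>simp add: not_integrable_integral\<close>)
  then show ?case
    by auto
next
  case (Suc n)
  have "ubd {a, b} a b P (Suc n) (\<lambda>p x. g p x * (lam p * inverse (S' p x)))"
    by (intro ubd_mult Suc.prems h)
  then obtain G' where G': "\<And>p x. p \<in> P \<Longrightarrow> x \<in> {a..b} \<Longrightarrow>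
      ((\<lambda>x. g p x * (lam p * inverse (S' p x))) has_real_derivative G' p x) (at x within {a..b})"
    and "ubd {a, b} a b P n G'"
    by (rule ubd_SucE) blast
  from Suc.prems obtain g' where g': "\<And>p x. p \<in> P \<Longrightarrow> x \<in> {a, b} \<Longrightarrow> g p x = 0"
    "\<And>p x. p \<in> P \<Longrightarrow> x \<in> {a..b} \<Longrightarrow> (g p has_real_derivative g' p x) (at x within {a..b})"
    by (rule ubd_SucE) blast
  from Suc.IH[OF \<open>ubd {a, b} a b P n G'\<close>] obtain C where
    C: "\<And>p. p \<in> P \<Longrightarrow> cmod (integral {a..b} (\<lambda>x. of_real (G' p x) * cis (S p x))) \<le> C / lam p ^ n"
    by blast
  have "cmod (integral {a..b} (\<lambda>x. of_real (g p x) * cis (S p x))) \<le> C / lam p ^ Suc n" if p: "p \<in> P" for p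
  proof -
    \<comment> \<open>Since \<open>S'\<close> cancels, the derivative of \<open>H\<close> contains
      the original integrand times \<open>\<i> * lam p\<close>. As \<open>H\<close> vanishes at both
      ends, the integral of that part is minus the integral of the \<open>G'\<close> part.\<close>
    define H where "H x = of_real (g p x * (lam p * inverse (S' p x))) * cis (S p x)" for x
    have "(H has_vector_derivative (of_real (G' p x) * cis (S p x) + \<i> * lam p * (of_real (g p x) * cis (S p x))))
        (at x within {a..b})" if x: "x \<in> {a..b}" for x
    proof -
      have "((\<lambda>x. complex_of_real (g p x * (lam p * inverse (S' p x)))) has_vector_derivative of_real (G' p x))
          (at x within {a..b})"
        using G'[OF p x] by (intro has_vector_derivative_of_real) (simp add: has_real_derivative_iff_has_vector_derivative)
      moreover have "((\<lambda>x. cis (S p x)) has_vector_derivative (S' p x *\<^sub>R (\<i> * cis (S p x)))) (at x within {a..b})"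
        using S[OF p x] unfolding has_real_derivative_iff_has_vector_derivative
        by (auto simp: has_vector_derivative_def intro!: derivative_eq_intros)
      ultimately have "(H has_vector_derivative (of_real (g p x * (lam p * inverse (S' p x))) * (S' p x *\<^sub>R (\<i> * cis (S p x)))
          + of_real (G' p x) * cis (S p x))) (at x within {a..b})"
        unfolding H_def by (rule has_vector_derivative_mult)
      then show ?thesis
        using nz[OF p x] by (simp add: scaleR_conv_of_real field_simps)
    qed
    from fundamental_theorem_of_calculus[OF ab this]
    have 1: "((\<lambda>x. of_real (G' p x) * cis (S p x) + \<i> * lam p * (of_real (g p x) * cis (S p x))) has_integral 0) {a..b}"
      using g'(1)[OF p] by (simp add: H_def)
    have "continuous_on {a..b} (g p)" "continuous_on {a..b} (S p)"
      using g'(2)[OF p] S[OF p] DERIV_continuous unfolding continuous_on_eq_continuous_within by blast+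
    then have 2: "((\<lambda>x. of_real (g p x) * cis (S p x)) has_integral
        integral {a..b} (\<lambda>x. of_real (g p x) * cis (S p x))) {a..b}"
      by (intro integrable_integral integrable_continuous_real continuous_intros)
    have "((\<lambda>x. of_real (G' p x) * cis (S p x)) has_integral
        0 - \<i> * lam p * integral {a..b} (\<lambda>x. of_real (g p x) * cis (S p x))) {a..b}"
      using has_integral_diff[OF 1 has_integral_mult_right[OF 2, of "\<i> * lam p"]] by simp
    then have "integral {a..b} (\<lambda>x. of_real (G' p x) * cis (S p x))
        = - \<i> * lam p * integral {a..b} (\<lambda>x. of_real (g p x) * cis (S p x))"
      by (simp add: integral_unique)
    then have "lam p * cmod (integral {a..b} (\<lambda>x. of_real (g p x) * cis (S p x))) \<le> C / lam p ^ n"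
      using C[OF p] lam[OF p] by (simp add: norm_mult)
    then show ?thesis
      using lam[OF p] by (simp add: field_simps)
  qed
  then show ?case
    by blast
qed

section \<open>Rapidly convergent trigonometric series\<close>

definition tsum :: "(int \<Rightarrow> complex) \<Rightarrow> real \<Rightarrow> complex" where
  "tsum \<alpha> x = (\<Sum>\<^sub>\<infinity>l. \<alpha> l * cis (of_int l * x))"

lemma norm_tsum_le:
  assumes "M summable_on UNIV" "\<And>l. cmod (\<alpha> l) \<le> M l"
  shows "cmod (tsum \<alpha> x) \<le> infsum M UNIV"
  unfolding tsum_def by (rule norm_infsum_le_dominated[OF assms(1)]) (simp add: norm_mult assms)

lemma continuous_on_tsum:
  assumes "(\<lambda>l. cmod (\<alpha> l)) summable_on UNIV"
  shows "continuous_on S (tsum \<alpha>)"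
  unfolding tsum_def
  by (rule continuous_on_infsum_dominated[where M = "\<lambda>l. cmod (\<alpha> l)"])
     (auto intro!: continuous_intros simp: norm_mult assms)

lemma has_vector_derivative_tsum:
  assumes M: "(\<lambda>l. M l * wt l) summable_on UNIV" and \<alpha>: "\<And>l. cmod (\<alpha> l) \<le> M l"
  shows "(tsum \<alpha> has_vector_derivative tsum (\<lambda>l. \<i> * of_int l * \<alpha> l) x) (at x)"
proof -
  have M0: "0 \<le> M l" for l
    using \<alpha>[of l] norm_ge_zero order_trans by blast
  have "((\<lambda>x. \<Sum>\<^sub>\<infinity>l. \<alpha> l * cis (of_int l * x)) has_vector_derivative
      (\<Sum>\<^sub>\<infinity>l. \<i> * of_int l * \<alpha> l * cis (of_int l * x))) (at x)"
  proof (rule has_vector_derivative_infsum_dominated[where a = "x - 1" and b = "x + 1"])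
    show "((\<lambda>x. \<alpha> l * cis (of_int l * x)) has_vector_derivative \<i> * of_int l * \<alpha> l * cis (of_int l * y))
        (at y within {x - 1..x + 1})" for l y
      by (auto simp: has_vector_derivative_def scaleR_conv_of_real intro!: derivative_eq_intros)
    have "cmod (\<alpha> l) * \<bar>real_of_int l\<bar> \<le> M l * wt l" for l
      by (intro mult_mono \<alpha> M0) (auto simp: wt_def)
    then show "cmod (\<i> * of_int l * \<alpha> l * cis (of_int l * y)) \<le> M l * wt l" for l y
      by (simp add: norm_mult mult.commute)
    have "cmod (\<alpha> l) * 1 \<le> M l * wt l" for l
      by (intro mult_mono \<alpha> M0) auto
    then show "(\<lambda>l. \<alpha> l * cis (of_int l * y)) summable_on UNIV" for y
      by (intro dominated_summable_on[OF M]) (simp add: norm_mult)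
  qed (use M in \<open>auto intro!: continuous_intros\<close>)
  then show ?thesis
    unfolding tsum_def .
qed

lemma ubd_0_Re_tsum:
  fixes \<alpha> :: "'p \<Rightarrow> int \<Rightarrow> complex"
  assumes "rapid A" "\<And>p l. p \<in> P \<Longrightarrow> cmod (\<alpha> p l) \<le> cmod (A l)"
  shows "ubd Z a b P 0 (\<lambda>p x. Re (tsum (\<alpha> p) x))"
  unfolding ubd.simps
  by (intro exI[of _ "\<Sum>\<^sub>\<infinity>l. cmod (A l)"] ballI order_trans[OF abs_Re_le_cmod]
      norm_tsum_le rapid_summable_norm assms)

text \<open>Differentiation multiplies the coefficients by \<open>\<i> * of_int l\<close>, and a
  rapidly decreasing majorant remains one after multiplication by \<open>l\<close>. The common
  majorant \<open>A\<close> makes the bounds uniform in \<open>p\<close>.\<close>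

lemma ubd_Re_tsum:
  fixes \<alpha> :: "'p \<Rightarrow> int \<Rightarrow> complex"
  assumes "rapid A" "\<And>p l. p \<in> P \<Longrightarrow> cmod (\<alpha> p l) \<le> cmod (A l)"
  shows "ubd {} a b P n (\<lambda>p x. Re (tsum (\<alpha> p) x))"
  using assms
proof (induction n arbitrary: A \<alpha>)
  case 0
  then show ?case
    by (rule ubd_0_Re_tsum)
next
  case (Suc n)
  let ?\<alpha>' = "\<lambda>p l. \<i> * of_int l * \<alpha> p l" and ?A' = "\<lambda>l. of_int l * A l"
  have A': "rapid ?A'"
  proof (rule rapid_dominated[OF Suc.prems(1)])
    have "\<bar>real_of_int k\<bar> * cmod (A k) \<le> wt k * cmod (A k)" for k
      by (intro mult_right_mono) (auto simp: wt_def)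
    then show "cmod (?A' k) \<le> 1 * cmod (A k) * wt k ^ 1" for k
      by (simp add: norm_mult mult.commute)
  qed
  have "ubd {} a b P n (\<lambda>p x. Re (tsum (?\<alpha>' p) x))"
  proof (rule Suc.IH[OF A'])
    show "cmod (?\<alpha>' p l) \<le> cmod (?A' l)" if "p \<in> P" for p l
      using Suc.prems(2)[OF that, of l] by (simp add: norm_mult mult_left_mono)
  qed
  moreover have "((\<lambda>x. Re (tsum (\<alpha> p) x)) has_real_derivative Re (tsum (?\<alpha>' p) x)) (at x within {a..b})"
    if "p \<in> P" for p x
  proof -
    have "(tsum (\<alpha> p) has_vector_derivative tsum (?\<alpha>' p) x) (at x within {a..b})"
      by (rule has_vector_derivative_at_within, rule has_vector_derivative_tsum[OF _ Suc.prems(2)[OF that]])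
         (use rapid_summable[OF Suc.prems(1), of 1] in simp)
    then show ?thesis
      unfolding has_real_derivative_iff_has_vector_derivative
      by (rule bounded_linear.has_vector_derivative[OF bounded_linear_Re])
  qed
  ultimately show ?case
    by (intro ubd_SucI[OF ubd_0_Re_tsum[OF Suc.prems]]) auto
qed

section \<open>A wave packet that moves to high positive frequencies\<close>

lemma cmod_cis_minus_1_le: "cmod (cis x - 1) \<le> \<bar>x\<bar>"
proof -
  have "cmod (cis x - 1) = 2 * \<bar>sin (x / 2)\<bar>"
    using dist_exp_i_1[of x] by (simp add: cis_conv_exp)
  also have "\<dots> \<le> 2 * \<bar>x / 2\<bar>"
    by (intro mult_left_mono abs_sin_x_le_abs_x) auto
  finally show ?thesis
    by simp
qed

text \<open>The integral of \<open>cis (of_int m * s)\<close> for s from 0 to \<open>t\<close>. Only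
  \<open>m = 0\<close> grows with \<open>t\<close>; every other frequency oscillates and stays
  bounded.\<close>

definition chi :: "int \<Rightarrow> real \<Rightarrow> complex" where
  "chi m t = (if m = 0 then of_real t else (cis (of_int m * t) - 1) / (\<i> * of_int m))"

lemma chi_0 [simp]: "chi m 0 = 0"
  by (simp add: chi_def)

lemma has_vector_derivative_chi: "(chi m has_vector_derivative cis (of_int m * t)) (at t within S)"
proof (cases "m = 0")
  case True
  then show ?thesis
    by (auto simp: chi_def[abs_def] has_vector_derivative_def scaleR_conv_of_real intro!: derivative_eq_intros)
next
  case False
  have "((\<lambda>t. (cis (of_int m * t) - 1) * inverse (\<i> * of_int m)) has_vector_derivative cis (of_int m * t)) (at t within S)"
    using False
    by (auto simp: has_vector_derivative_def scaleR_conv_of_real fun_eq_iff field_simps intro!: derivative_eq_intros)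
  then show ?thesis
    using False by (simp add: chi_def[abs_def] divide_inverse)
qed

lemma cmod_chi_le: "cmod (chi m t) \<le> \<bar>t\<bar>"
proof (cases "m = 0")
  case False
  then show ?thesis
    using cmod_cis_minus_1_le[of "of_int m * t"]
    by (simp add: chi_def norm_divide norm_mult abs_mult field_simps)
qed (simp add: chi_def)

lemma cmod_chi_le_2:
  assumes "m \<noteq> 0"
  shows "cmod (chi m t) \<le> 2"
proof -
  have "cmod (cis (of_int m * t) - 1) \<le> 2"
    using norm_triangle_ineq4[of "cis (of_int m * t)" 1] by simp
  moreover have "1 \<le> \<bar>real_of_int m\<bar>"
    using assms by simp
  ultimately have "cmod (cis (of_int m * t) - 1) \<le> 2 * \<bar>real_of_int m\<bar>"
    by linarith
  then show ?thesis
    using assms by (simp add: chi_def norm_divide norm_mult field_simps)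
qed

lemma exists_interval_Re_negative:
  fixes w :: complex and j :: int
  assumes "w \<noteq> 0" "j \<noteq> 0"
  obtains a b \<kappa> where "a < b" "0 < \<kappa>" "\<And>y. y \<in> {a..b} \<Longrightarrow> Re (w * cis (- (of_int j * y))) \<le> - 2 * \<kappa>"
proof -
  \<comment> \<open>Rotation by the angle \<open>- (of_int j * y0)\<close> takes \<open>w\<close> to
    the negative real axis, where the real part is \<open>- cmod w\<close>. By continuity more than
    half of this survives nearby, and half of it is \<open>2 * \<kappa>\<close> for
    \<open>\<kappa>\<close> equal to \<open>cmod w / 4\<close>.\<close>
  define y0 where "y0 = (Arg w - pi) / of_int j"
  define h where "h y = Re (w * cis (- (of_int j * y)))" for y
  have "w * cis (- (of_int j * y0)) = rcis (cmod w) (Arg w) * cis (pi - Arg w)"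
    using assms by (simp add: y0_def rcis_cmod_Arg)
  also have "\<dots> = - of_real (cmod w)"
    by (simp add: rcis_def cis_mult mult.assoc)
  finally have h0: "h y0 = - cmod w"
    by (simp add: h_def)
  have "continuous_on UNIV h"
    unfolding h_def by (intro continuous_intros)
  then have "isCont h y0"
    by (simp add: continuous_on_eq_continuous_at)
  then obtain d where d: "d > 0" "\<And>y. \<bar>y - y0\<bar> < d \<Longrightarrow> \<bar>h y - h y0\<bar> < cmod w / 2"
    using assms unfolding continuous_at_eps_delta dist_real_def by (metis half_gt_zero zero_less_norm_iff)
  show ?thesis
  proof
    show "y0 < y0 + d / 2" "0 < cmod w / 4"
      using d assms by auto
    fix y assume "y \<in> {y0..y0 + d / 2}"
    then have "\<bar>h y - h y0\<bar> < cmod w / 2"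
      using d(1) by (intro d(2)) auto
    then show "Re (w * cis (- (of_int j * y))) \<le> - 2 * (cmod w / 4)"
      using h0 unfolding h_def by linarith
  qed
qed

text \<open>The expression in \<open>resonance\<close> is the coefficient of t in the mode l = -j of
  the y-derivative of the phase. The factor 2 is a safety margin: local frequencies reach about 2
  \<kappa> t or more, while the cutoff used later is \<kappa> t.\<close>

locale wave_packet =
  fixes vv :: "int \<Rightarrow> complex" and j :: int and a b \<kappa> :: real
  assumes rapid_vv: "rapid vv" and vv_uminus: "\<And>l. vv (- l) = cnj (vv l)"
    and ab: "a < b" and \<kappa>: "0 < \<kappa>"
    and resonance: "\<And>y. y \<in> {a..b} \<Longrightarrow> Re (- \<i> * of_int j * vv (- j) * cis (- (of_int j * y))) \<le> - 2 * \<kappa>"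
begin

text \<open>In the Fourier expansion of e^{ijs} v(y+s), mode \<open>l\<close> is \<open>vv l\<close>
  times e^{i(l+j)s} e^{ily}; integration in s produces \<open>chi (l + j)\<close>. The real part
  taken in \<open>Theta\<close> restores the cosine because v is real.\<close>

definition theta :: "real \<Rightarrow> int \<Rightarrow> complex" where
  "theta t l = vv l * chi (l + j) t"

text \<open>\<open>Theta t y\<close> is $\int_0^t \cos(js)\, v(y+s)\, ds$ for the real function $v$ with Fourier
  coefficients \<open>vv\<close>: the phase accumulated along the characteristic that starts at \<open>y\<close>.\<close>

definition Theta :: "real \<Rightarrow> real \<Rightarrow> real" where
  "Theta t y = Re (tsum (theta t) y)"

definition Theta_y :: "real \<Rightarrow> real \<Rightarrow> real" where
  "Theta_y t y = Re (tsum (\<lambda>l. \<i> * of_int l * theta t l) y)"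

text \<open>The exponent equals the number of integrations by parts performed later: zeros of order
  4 at the endpoints remove the boundary terms of all of them.\<close>

definition bump :: "real \<Rightarrow> real" where
  "bump y = ((y - a) * (b - y)) ^ 4"

text \<open>2 pi times the Fourier coefficients of the packet in the coordinate y = x - t along
  characteristics; the phase e^{-ikt} of free transport is thereby removed.\<close>

definition packet :: "int \<Rightarrow> real \<Rightarrow> complex" where
  "packet k t = integral {a..b} (\<lambda>y. of_real (bump y) * cis (- (Theta t y + of_int k * y)))"

definition D1 :: real where
  "D1 = (\<Sum>\<^sub>\<infinity>l. cmod (vv l) * wt l)"

section \<open>Bounds and derivatives of the accumulated phase\<close>

lemma summable_vv: "(\<lambda>l. cmod (vv l)) summable_on UNIV"
  using rapid_vv by (rule rapid_summable_norm)

lemma summable_vv_wt: "(\<lambda>l. cmod (vv l) * wt l) summable_on UNIV"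
  using rapid_summable[OF rapid_vv, of 1] by simp

lemma D1_nonneg: "0 \<le> D1"
  unfolding D1_def by (intro infsum_nonneg) auto

lemma cmod_theta_le: "cmod (theta t l) \<le> \<bar>t\<bar> * cmod (vv l)"
  using mult_left_mono[OF cmod_chi_le norm_ge_zero, of "vv l" "l + j" t]
  by (simp add: theta_def norm_mult mult.commute)

lemma cmod_l_theta_le: "cmod (\<i> * of_int l * theta t l) \<le> \<bar>t\<bar> * (cmod (vv l) * wt l)"
proof -
  have "\<bar>real_of_int l\<bar> * cmod (theta t l) \<le> wt l * (\<bar>t\<bar> * cmod (vv l))"
    by (intro mult_mono cmod_theta_le) (auto simp: wt_def)
  then show ?thesis
    by (simp add: norm_mult mult_ac)
qed

lemma Theta_0 [simp]: "Theta 0 y = 0"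
  by (simp add: Theta_def theta_def tsum_def)

lemma has_real_derivative_Theta_y: "((\<lambda>y. Theta t y) has_real_derivative Theta_y t y) (at y within S)"
proof -
  have "(tsum (theta t) has_vector_derivative tsum (\<lambda>l. \<i> * of_int l * theta t l) y) (at y within S)"
  proof (rule has_vector_derivative_at_within, rule has_vector_derivative_tsum)
    show "(\<lambda>l. \<bar>t\<bar> * cmod (vv l) * wt l) summable_on UNIV"
      using summable_on_cmult_right[OF summable_vv_wt, of "\<bar>t\<bar>"] by (simp add: mult.assoc)
  qed (rule cmod_theta_le)
  then show ?thesis
    unfolding has_real_derivative_iff_has_vector_derivative Theta_def[abs_def] Theta_y_def
    by (rule bounded_linear.has_vector_derivative[OF bounded_linear_Re])
qed

lemma abs_Theta_y_le: "\<bar>Theta_y t y\<bar> \<le> D1 * \<bar>t\<bar>"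
proof -
  have "cmod (tsum (\<lambda>l. \<i> * of_int l * theta t l) y) \<le> (\<Sum>\<^sub>\<infinity>l. \<bar>t\<bar> * (cmod (vv l) * wt l))"
    by (rule norm_tsum_le[OF summable_on_cmult_right[OF summable_vv_wt] cmod_l_theta_le])
  also have "\<dots> = D1 * \<bar>t\<bar>"
    by (simp add: infsum_cmult_right' D1_def)
  finally show ?thesis
    unfolding Theta_y_def using abs_Re_le_cmod order_trans by blast
qed

text \<open>In the mode l = -j the factor \<open>chi 0 t\<close> is t, with slope given by
  \<open>resonance\<close>; in all other modes \<open>chi\<close> is at most 2, so together they add
  at most \<open>2 * D1\<close>. Hence the local frequency \<open>- Theta_y\<close> grows linearly
  on the support of the packet.\<close>

lemma Theta_y_le:
  assumes y: "y \<in> {a..b}" and t: "0 \<le> t"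
  shows "Theta_y t y \<le> - 2 * \<kappa> * t + 2 * D1"
proof -
  let ?f = "\<lambda>l. \<i> * of_int l * theta t l * cis (of_int l * y)"
  have sum: "?f summable_on UNIV"
    by (rule dominated_summable_on[OF summable_on_cmult_right[OF summable_vv_wt, of "\<bar>t\<bar>"]])
       (use cmod_l_theta_le in \<open>simp add: norm_mult\<close>)
  have "tsum (\<lambda>l. \<i> * of_int l * theta t l) y = ?f (- j) + (\<Sum>\<^sub>\<infinity>l\<in>-{-j}. ?f l)"
    unfolding tsum_def using infsum_split_finite[OF sum, of "{- j}"] by simp
  moreover have "?f (- j) = of_real t * (- \<i> * of_int j * vv (- j) * cis (- (of_int j * y)))"
    by (simp add: theta_def chi_def)
  ultimately have "Theta_y t y = t * Re (- \<i> * of_int j * vv (- j) * cis (- (of_int j * y))) + Re (\<Sum>\<^sub>\<infinity>l\<in>-{-j}. ?f l)"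
    unfolding Theta_y_def by (simp only: plus_complex.sel Re_complex_of_real mult_zero_left diff_0_right
        times_complex.sel Im_complex_of_real)
  moreover have "t * Re (- \<i> * of_int j * vv (- j) * cis (- (of_int j * y))) \<le> t * (- 2 * \<kappa>)"
    by (intro mult_left_mono resonance y t)
  moreover have "Re (\<Sum>\<^sub>\<infinity>l\<in>-{-j}. ?f l) \<le> 2 * D1"
  proof -
    have s: "(\<lambda>l. 2 * (cmod (vv l) * wt l)) summable_on A" for A
      by (rule summable_on_subset_banach[OF summable_on_cmult_right[OF summable_vv_wt]]) auto
    have "cmod (\<Sum>\<^sub>\<infinity>l\<in>-{-j}. ?f l) \<le> (\<Sum>\<^sub>\<infinity>l\<in>-{-j}. 2 * (cmod (vv l) * wt l))"
    proof (rule norm_infsum_le_dominated[OF s])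
      fix l assume "l \<in> -{-j}"
      then have "l + j \<noteq> 0"
        by auto
      then have "\<bar>real_of_int l\<bar> * (cmod (vv l) * cmod (chi (l + j) t)) \<le> wt l * (cmod (vv l) * 2)"
        by (intro mult_mono cmod_chi_le_2) (auto simp: wt_def)
      then show "cmod (?f l) \<le> 2 * (cmod (vv l) * wt l)"
        by (simp add: norm_mult theta_def mult_ac)
    qed
    also have "\<dots> \<le> (\<Sum>\<^sub>\<infinity>l. 2 * (cmod (vv l) * wt l))"
      by (rule infsum_mono2[OF s s]) auto
    also have "\<dots> = 2 * D1"
      by (simp only: infsum_cmult_right' D1_def)
    finally show ?thesis
      using complex_Re_le_cmod order_trans by blast
  qed
  ultimately show ?thesis
    by (simp add: algebra_simps)
qed

lemma tsum_vv_real: "Im (tsum vv x) = 0"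
proof -
  have "cnj (tsum vv x) = (\<Sum>\<^sub>\<infinity>l. vv (- l) * cis (of_int (- l) * x))"
    unfolding tsum_def infsum_cnj[symmetric] by (simp add: vv_uminus cis_cnj)
  also have "\<dots> = tsum vv x"
    unfolding tsum_def by (rule infsum_reindex_bij_witness[of _ uminus uminus]) auto
  finally show ?thesis
    by (simp add: complex_eq_iff)
qed

text \<open>Termwise \<open>chi (l + j)\<close> differentiates to
  \<open>cis (of_int (l + j) * t)\<close>, and the series resums to e^{ijt} v(y+t). As v is real,
  the real part is the potential along the characteristic.\<close>

lemma has_real_derivative_Theta_t:
  "((\<lambda>t. Theta t y) has_real_derivative cos (of_int j * t) * Re (tsum vv (y + t))) (at t)"
proof -
  have "((\<lambda>t. \<Sum>\<^sub>\<infinity>l. theta t l * cis (of_int l * y)) has_vector_derivative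
      (\<Sum>\<^sub>\<infinity>l. vv l * cis (of_int (l + j) * t) * cis (of_int l * y))) (at t)"
  proof (rule has_vector_derivative_infsum_dominated[where a = "t - 1" and b = "t + 1"])
    show "((\<lambda>t. theta t l * cis (of_int l * y)) has_vector_derivative
        vv l * cis (of_int (l + j) * s) * cis (of_int l * y)) (at s within {t - 1..t + 1})" for l s
      unfolding theta_def
      by (intro has_vector_derivative_mult_left has_vector_derivative_mult_right has_vector_derivative_chi)
    show "continuous_on {t - 1..t + 1} (\<lambda>s. vv l * cis (of_int (l + j) * s) * cis (of_int l * y))" for l
      by (intro continuous_intros)
    show "(\<lambda>l. theta s l * cis (of_int l * y)) summable_on UNIV" for s
      by (rule dominated_summable_on[OF summable_on_cmult_right[OF summable_vv, of "\<bar>s\<bar>"]])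
         (use cmod_theta_le in \<open>simp add: norm_mult\<close>)
  qed (use summable_vv in \<open>auto simp: norm_mult\<close>)
  moreover have "(\<Sum>\<^sub>\<infinity>l. vv l * cis (of_int (l + j) * t) * cis (of_int l * y)) = cis (of_int j * t) * tsum vv (y + t)"
  proof -
    have "cis (of_int (l + j) * t) * cis (of_int l * y) = cis (of_int j * t) * cis (of_int l * (y + t))" for l
      by (simp add: cis_mult algebra_simps)
    then have "vv l * cis (of_int (l + j) * t) * cis (of_int l * y)
        = cis (of_int j * t) * (vv l * cis (of_int l * (y + t)))" for l
      by (simp add: mult.assoc mult.left_commute)
    then show ?thesis
      unfolding tsum_def by (simp only: infsum_cmult_right')
  qed
  ultimately have "((\<lambda>t. tsum (theta t) y) has_vector_derivative cis (of_int j * t) * tsum vv (y + t)) (at t)"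
    unfolding tsum_def by simp
  then have "((\<lambda>t. Re (tsum (theta t) y)) has_vector_derivative Re (cis (of_int j * t) * tsum vv (y + t))) (at t)"
    by (rule bounded_linear.has_vector_derivative[OF bounded_linear_Re])
  then show ?thesis
    by (simp add: has_real_derivative_iff_has_vector_derivative Theta_def tsum_vv_real)
qed

text \<open>Joint continuity is what differentiation under the integral over y requires.\<close>

lemma continuous_on_Theta: "continuous_on ({-T..T} \<times> S) (\<lambda>(t, y). Theta t y)"
proof -
  have "continuous_on ({-T..T} \<times> S) (\<lambda>p. \<Sum>\<^sub>\<infinity>l. theta (fst p) l * cis (of_int l * snd p))"
  proof (rule continuous_on_infsum_dominated)
    have "continuous_on UNIV (chi m)" for m
      using has_vector_derivative_chi[of m]
      by (meson continuous_at_imp_continuous_on has_vector_derivative_continuous)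
    note chi = continuous_on_compose2[OF this]
    show "continuous_on ({-T..T} \<times> S) (\<lambda>p. theta (fst p) l * cis (of_int l * snd p))" for l
      unfolding theta_def by (intro continuous_intros chi) auto
    show "cmod (theta (fst p) l * cis (of_int l * snd p)) \<le> \<bar>T\<bar> * cmod (vv l)" if "p \<in> {-T..T} \<times> S" for p l
    proof -
      have "\<bar>fst p\<bar> * cmod (vv l) \<le> \<bar>T\<bar> * cmod (vv l)"
        using that by (intro mult_right_mono) auto
      then show ?thesis
        using cmod_theta_le[of "fst p" l] by (simp add: norm_mult)
    qed
    show "(\<lambda>l. \<bar>T\<bar> * cmod (vv l)) summable_on UNIV"
      by (intro summable_on_cmult_right summable_vv)
  qed
  then have "continuous_on ({-T..T} \<times> S) (\<lambda>p. Re (tsum (theta (fst p)) (snd p)))"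
    unfolding tsum_def by (rule continuous_on_Re)
  then show ?thesis
    by (simp add: Theta_def case_prod_beta)
qed

lemma continuous_on_Theta_y: "continuous_on S (Theta t)"
  using has_real_derivative_Theta_y DERIV_continuous
  unfolding continuous_on_eq_continuous_within by blast

lemma bump_continuous: "continuous_on S bump"
  unfolding bump_def by (intro continuous_intros)

lemma bump_nonneg: "0 \<le> bump y"
  unfolding bump_def by simp

lemma cmod_packet_le: "cmod (packet k t) \<le> integral {a..b} bump"
  unfolding packet_def
  by (rule integral_norm_bound_integral)
     (auto intro!: integrable_continuous_real continuous_intros continuous_on_Theta_y bump_continuous
       simp: norm_mult bump_nonneg)

text \<open>The matrix of multiplication by cos(jt) v(x) in the Fourier basis, conjugated by the
  flow of free transport.\<close>

definition Ap :: "int \<Rightarrow> int \<Rightarrow> real \<Rightarrow> complex" where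
  "Ap k l t = of_real (cos (of_int j * t)) * vv (k - l) * cis (of_int (k - l) * t)"

text \<open>Differentiation under the integral brings down cos(jt) v(y+t). In the Fourier expansion
  of v each mode e^{il(y+t)} shifts the index from \<open>k\<close> to \<open>k - l\<close>, which
  yields a convolution system.\<close>

lemma has_vector_derivative_packet:
  "(packet k has_vector_derivative (- \<i> * (\<Sum>\<^sub>\<infinity>l. Ap k l t * packet l t))) (at t)"
proof -
  define fx where "fx s y = of_real (bump y) * (- (\<i> * (cos (of_int j * s) * Re (tsum vv (y + s)))) * cis (- (Theta s y + of_int k * y)))" for s y
  define T where "T = \<bar>t\<bar> + 1"
  have t: "- T < t" "t < T"
    by (auto simp: T_def)
  have "((\<lambda>s. integral (cbox a b) (\<lambda>y. of_real (bump y) * cis (- (Theta s y + of_int k * y)))) has_vector_derivative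
      integral (cbox a b) (fx t)) (at t within {-T..T})"
  proof (rule leibniz_rule_vector_derivative)
    fix s y
    have "((\<lambda>s. cis (- (Theta s y + of_int k * y))) has_vector_derivative
        (- (cos (of_int j * s) * Re (tsum vv (y + s)))) *\<^sub>R (\<i> * cis (- (Theta s y + of_int k * y)))) (at s)"
    proof -
      have "((\<lambda>s. - (Theta s y + of_int k * y)) has_vector_derivative - (cos (of_int j * s) * Re (tsum vv (y + s)))) (at s)"
        using has_real_derivative_Theta_t[of y s]
        by (auto simp: has_real_derivative_iff_has_vector_derivative[symmetric] intro!: derivative_eq_intros)
      moreover have "(cis has_vector_derivative \<i> * cis u) (at u)" for u
        by (auto simp: has_vector_derivative_def intro!: derivative_eq_intros)
      ultimately show ?thesis
        using vector_diff_chain_at by (force simp: o_def)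
    qed
    then have "((\<lambda>s. of_real (bump y) * cis (- (Theta s y + of_int k * y))) has_vector_derivative fx s y) (at s)"
      unfolding fx_def by (intro has_vector_derivative_mult_right) (simp add: scaleR_conv_of_real mult_ac)
    then show "((\<lambda>s. of_real (bump y) * cis (- (Theta s y + of_int k * y))) has_vector_derivative fx s y) (at s within {-T..T})"
      by (rule has_vector_derivative_at_within)
  next
    show "(\<lambda>y. of_real (bump y) * cis (- (Theta s y + of_int k * y))) integrable_on cbox a b" for s
      unfolding cbox_interval
      by (intro integrable_continuous_real continuous_intros bump_continuous continuous_on_Theta_y)
    have V: "continuous_on A (\<lambda>p. tsum vv (snd p + fst p))" for A :: "(real \<times> real) set"
      by (rule continuous_on_compose2[OF continuous_on_tsum[OF summable_vv, of UNIV]]) (auto intro!: continuous_intros)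
    have bump2: "continuous_on A (\<lambda>p. bump (snd p))" for A :: "(real \<times> real) set"
      by (rule continuous_on_compose2[OF bump_continuous[of UNIV]]) (auto intro!: continuous_intros)
    show "continuous_on ({-T..T} \<times> cbox a b) (\<lambda>(s, y). fx s y)"
      using continuous_on_Theta[of T "cbox a b"] unfolding fx_def case_prod_beta
      by (intro continuous_intros V bump2)
  qed (use t in auto)
  then have 1: "(packet k has_vector_derivative integral {a..b} (fx t)) (at t)"
    using t by (simp only: packet_def[abs_def] cbox_interval at_within_Icc_at)
  \<comment> \<open>The contribution of mode \<open>l\<close> of v to \<open>fx t\<close>, arranged
    so that its integral is a multiple of \<open>packet (k - l) t\<close>.\<close>
  define c where "c l y = - \<i> * cos (of_int j * t) * (vv l * cis (of_int l * t) * (of_real (bump y) * cis (- (Theta t y + of_int (k - l) * y))))"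
    for l y
  have "bounded (bump ` {a..b})"
    by (intro compact_imp_bounded compact_continuous_image bump_continuous) auto
  then obtain B where "\<forall>z\<in>bump ` {a..b}. norm z \<le> B"
    unfolding bounded_iff by blast
  then have B: "\<bar>bump y\<bar> \<le> B" if "y \<in> {a..b}" for y
    using that by auto
  have c_sum: "(\<Sum>\<^sub>\<infinity>l. c l y) = fx t y" for y
  proof -
    have e: "cis (of_int l * t) * cis (- (Theta t y + of_int (k - l) * y))
        = cis (of_int l * (y + t)) * cis (- (Theta t y + of_int k * y))" for l
      by (simp add: cis_mult algebra_simps)
    have "c l y = - \<i> * cos (of_int j * t) * of_real (bump y) * vv l
        * (cis (of_int l * t) * cis (- (Theta t y + of_int (k - l) * y)))" for l
      unfolding c_def by (simp only: mult_ac)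
    then have "c l y = - \<i> * cos (of_int j * t) * of_real (bump y) * cis (- (Theta t y + of_int k * y))
        * (vv l * cis (of_int l * (y + t)))" for l
      unfolding e by (simp only: mult_ac)
    then have "(\<Sum>\<^sub>\<infinity>l. c l y) = - \<i> * cos (of_int j * t) * of_real (bump y) * cis (- (Theta t y + of_int k * y))
        * tsum vv (y + t)"
      unfolding tsum_def by (simp only: infsum_cmult_right')
    moreover have "tsum vv (y + t) = of_real (Re (tsum vv (y + t)))"
      by (simp add: complex_eq_iff tsum_vv_real)
    ultimately show ?thesis
      unfolding fx_def by (simp add: mult_ac)
  qed
  have "((\<lambda>l. integral {a..b} (c l)) has_sum integral {a..b} (\<lambda>y. \<Sum>\<^sub>\<infinity>l. c l y)) UNIV"
  proof (rule has_sum_integral_dominated)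
    show "continuous_on {a..b} (c l)" for l
      unfolding c_def by (intro continuous_intros bump_continuous continuous_on_Theta_y)
    show "cmod (c l y) \<le> B * cmod (vv l)" if "y \<in> {a..b}" for l y
    proof -
      have "\<bar>cos (of_int j * t)\<bar> * (cmod (vv l) * \<bar>bump y\<bar>) \<le> 1 * (cmod (vv l) * B)"
        using B[OF that] by (intro mult_mono) auto
      then show ?thesis
        unfolding c_def by (simp add: norm_mult mult_ac)
    qed
  qed (intro summable_on_cmult_right summable_vv)
  moreover have "integral {a..b} (c l) = - \<i> * (Ap k (k - l) t * packet (k - l) t)" for l
    unfolding c_def packet_def Ap_def by (simp add: integral_mult_right mult.assoc)
  ultimately have "((\<lambda>l. - \<i> * (Ap k (k - l) t * packet (k - l) t)) has_sum integral {a..b} (fx t)) UNIV"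
    by (simp only: c_sum)
  then have "integral {a..b} (fx t) = - \<i> * (\<Sum>\<^sub>\<infinity>l. Ap k (k - l) t * packet (k - l) t)"
    by (metis infsumI infsum_cmult_right')
  also have "(\<Sum>\<^sub>\<infinity>l. Ap k (k - l) t * packet (k - l) t) = (\<Sum>\<^sub>\<infinity>l. Ap k l t * packet l t)"
    by (rule infsum_diff_shift)
  finally show ?thesis
    using 1 by simp
qed

end

section \<open>Decay of the packet coefficients and persistence of their mass\<close>

context wave_packet
begin

text \<open>Non-stationary phase with parameter (t, k) and size \<open>lam\<close> = t + |k|. The
  slope of the phase divided by \<open>lam\<close> has uniformly bounded derivatives, since
  \<open>theta t\<close> is at most t times a rapidly decreasing sequence, and the assumption keeps
  it away from 0; so its inverse is controlled as well.\<close>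

lemma packet_non_stationary:
  assumes c: "0 < c"
  shows "\<exists>C\<ge>0. \<forall>t k. 0 \<le> t \<longrightarrow> 1 \<le> t + \<bar>real_of_int k\<bar> \<longrightarrow>
    (\<forall>y\<in>{a..b}. c * (t + \<bar>real_of_int k\<bar>) \<le> \<bar>Theta_y t y + of_int k\<bar>) \<longrightarrow>
    cmod (packet k t) \<le> C / (t + \<bar>real_of_int k\<bar>) ^ 4"
proof -
  define P where "P = {(t, k :: int). 0 \<le> t \<and> 1 \<le> t + \<bar>real_of_int k\<bar> \<and>
    (\<forall>y\<in>{a..b}. c * (t + \<bar>real_of_int k\<bar>) \<le> \<bar>Theta_y t y + of_int k\<bar>)}"
  define lam where "lam p = fst p + \<bar>real_of_int (snd p)\<bar>" for p :: "real \<times> int"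
  define S where "S p y = - (Theta (fst p) y + of_int (snd p) * y)" for p :: "real \<times> int" and y
  define S' where "S' p y = - (Theta_y (fst p) y + of_int (snd p))" for p :: "real \<times> int" and y
  have S'_abs: "\<bar>S' p y\<bar> = \<bar>Theta_y (fst p) y + of_int (snd p)\<bar>" for p y
    unfolding S'_def by (rule abs_minus_cancel)
  have lam: "1 \<le> lam p" "fst p \<le> lam p" "\<bar>real_of_int (snd p)\<bar> \<le> lam p" "0 \<le> fst p"
    and S'_ge: "\<And>y. y \<in> {a..b} \<Longrightarrow> c * lam p \<le> \<bar>S' p y\<bar>" if "p \<in> P" for p
    using that by (auto simp: P_def lam_def S'_abs)
  have ratio: "c \<le> \<bar>S' p y / lam p\<bar>" if "p \<in> P" "y \<in> {a..b}" for p y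
    using S'_ge[OF that] lam(1)[OF that(1)] by (simp add: abs_div field_simps)
  have "ubd {} a b P n (\<lambda>p y. Re (tsum (\<lambda>l. - (\<i> * of_int l * theta (fst p) l) / lam p) y) + - of_int (snd p) / lam p)" for n
  proof (intro ubd_add ubd_Re_tsum ubd_const)
    show "rapid (\<lambda>l. of_real (wt l) * vv l)"
      by (rule rapid_dominated[OF rapid_vv, of _ 1 1]) (simp add: norm_mult mult.commute)
    show "cmod (- (\<i> * of_int l * theta (fst p) l) / lam p) \<le> cmod (of_real (wt l) * vv l)" if "p \<in> P" for p l
    proof -
      have "cmod (\<i> * of_int l * theta (fst p) l) \<le> \<bar>fst p\<bar> * (cmod (vv l) * wt l)"
        by (rule cmod_l_theta_le)
      also have "\<dots> \<le> lam p * (cmod (vv l) * wt l)"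
        using lam[OF that] by (intro mult_right_mono) auto
      finally show ?thesis
        using lam(1)[OF that] by (simp add: norm_divide norm_mult field_simps)
    qed
    show "\<bar>- of_int (snd p) / lam p\<bar> \<le> 1" if "p \<in> P" for p
      using lam[OF that] by (simp add: abs_div field_simps)
  qed
  moreover have "Re (tsum (\<lambda>l. - (\<i> * of_int l * theta (fst p) l) / lam p) y) + - of_int (snd p) / lam p = S' p y / lam p" for p y
  proof -
    have "tsum (\<lambda>l. - (\<i> * of_int l * theta (fst p) l) / lam p) y
        = (\<Sum>\<^sub>\<infinity>l. of_real (- inverse (lam p)) * (\<i> * of_int l * theta (fst p) l * cis (of_int l * y)))"
      unfolding tsum_def by (simp add: divide_inverse mult_ac)
    also have "\<dots> = of_real (- inverse (lam p)) * tsum (\<lambda>l. \<i> * of_int l * theta (fst p) l) y"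
      unfolding tsum_def by (simp only: infsum_cmult_right')
    finally have "Re (tsum (\<lambda>l. - (\<i> * of_int l * theta (fst p) l) / lam p) y) = - inverse (lam p) * Theta_y (fst p) y"
      unfolding Theta_y_def
      by (simp only: times_complex.sel Re_complex_of_real Im_complex_of_real mult_zero_left diff_0_right)
    then show ?thesis
      unfolding S'_def by (simp add: divide_inverse algebra_simps)
  qed
  ultimately have "ubd {} a b P n (\<lambda>p y. S' p y / lam p)" for n
    by simp
  from ubd_inverse[OF this c ratio] have h: "ubd {} a b P n (\<lambda>p y. lam p * inverse (S' p y))" for n
    by (simp add: divide_inverse mult.commute)
  have "ubd {a, b} a b P 4 (\<lambda>p y. ((y - a) * (b - y)) ^ 4 * 1)"
    by (intro ubd_bump ubd_real_const)
  then have "ubd {a, b} a b P 4 (\<lambda>p. bump)"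
    by (simp add: bump_def[abs_def])
  then have "\<exists>C. \<forall>p\<in>P. cmod (integral {a..b} (\<lambda>y. of_real (bump y) * cis (S p y))) \<le> C / lam p ^ 4"
  proof (rule non_stationary_phase[rotated -1])
    show "(S p has_real_derivative S' p y) (at y within {a..b})" for p y
      unfolding S_def S'_def by (auto intro!: derivative_eq_intros has_real_derivative_Theta_y)
    show "S' p y \<noteq> 0" if "p \<in> P" "y \<in> {a..b}" for p y
      using ratio[OF that] c by auto
    show "0 < lam p" if "p \<in> P" for p
      using lam(1)[OF that] by simp
  qed (use ab h in auto)
  then obtain C where C: "\<And>p. p \<in> P \<Longrightarrow> cmod (packet (snd p) (fst p)) \<le> C / lam p ^ 4"
    unfolding packet_def S_def by blast
  show ?thesis
  proof (intro exI conjI allI impI)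
    show "0 \<le> \<bar>C\<bar>"
      by simp
    fix t k assume "0 \<le> t" "1 \<le> t + \<bar>real_of_int k\<bar>"
      "\<forall>y\<in>{a..b}. c * (t + \<bar>real_of_int k\<bar>) \<le> \<bar>Theta_y t y + of_int k\<bar>"
    then have p: "(t, k) \<in> P"
      by (auto simp: P_def)
    have "C / lam (t, k) ^ 4 \<le> \<bar>C\<bar> / lam (t, k) ^ 4"
      using lam(1)[OF p] by (intro divide_right_mono) auto
    then show "cmod (packet k t) \<le> \<bar>C\<bar> / (t + \<bar>real_of_int k\<bar>) ^ 4"
      using C[OF p] by (simp add: lam_def)
  qed
qed

text \<open>For bounded times the slope of \<open>Theta\<close> is at most \<open>D1 * T\<close>, so
  the phase is not stationary for large \<open>k\<close>; the remaining finitely many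
  \<open>k\<close> are bounded by the integral of the bump. The result is the common majorant over a
  time interval that the energy estimates ask for.\<close>

lemma packet_decay_locally:
  assumes "0 \<le> T"
  shows "\<exists>C\<ge>0. \<forall>k. \<forall>t\<in>{0..T}. cmod (packet k t) \<le> C * inverse (wt k ^ 2)"
proof -
  obtain C where C: "C \<ge> 0" "\<And>t k. 0 \<le> t \<Longrightarrow> 1 \<le> t + \<bar>real_of_int k\<bar> \<Longrightarrow>
    (\<forall>y\<in>{a..b}. (1 / 4) * (t + \<bar>real_of_int k\<bar>) \<le> \<bar>Theta_y t y + of_int k\<bar>) \<Longrightarrow>
    cmod (packet k t) \<le> C / (t + \<bar>real_of_int k\<bar>) ^ 4"
    using packet_non_stationary[of "1 / 4"] by auto
  \<comment> \<open>Beyond this threshold |k| / 2 is at least D1 T + T, so the slope is at least |k|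
    / 2 + T in absolute value, which exceeds (t + |k|) / 4.\<close>
  define K where "K = 1 + 2 * (D1 + 1) * T"
  define B where "B = integral {a..b} bump"
  have K: "1 \<le> K"
    using assms D1_nonneg by (simp add: K_def)
  have B: "0 \<le> B"
    using cmod_packet_le[of 0 0] norm_ge_zero order_trans unfolding B_def by blast
  show ?thesis
  proof (intro exI conjI allI ballI)
    show "0 \<le> B * (1 + K) ^ 2 + 16 * C"
      using B C(1) by simp
    fix k t assume t: "t \<in> {0..T}"
    show "cmod (packet k t) \<le> (B * (1 + K) ^ 2 + 16 * C) * inverse (wt k ^ 2)"
    proof (cases "\<bar>real_of_int k\<bar> \<le> K")
      case True
      have "cmod (packet k t) \<le> B"
        unfolding B_def by (rule cmod_packet_le)
      moreover have "B * wt k ^ 2 \<le> B * (1 + K) ^ 2"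
        using True B by (intro mult_left_mono power_mono) (auto simp: wt_def)
      then have "B \<le> B * (1 + K) ^ 2 * inverse (wt k ^ 2)"
        by (simp add: field_simps)
      moreover have "0 \<le> 16 * C * inverse (wt k ^ 2)"
        using C(1) by simp
      ultimately show ?thesis
        unfolding distrib_right by linarith
    next
      case False
      have k1: "1 \<le> \<bar>real_of_int k\<bar>"
        using False K by linarith
      have "(1 / 4) * (t + \<bar>real_of_int k\<bar>) \<le> \<bar>Theta_y t y + of_int k\<bar>" for y
      proof -
        have "\<bar>Theta_y t y\<bar> \<le> D1 * t"
          using abs_Theta_y_le[of t y] t by simp
        moreover have "D1 * t \<le> D1 * T" "t \<le> T"
          using t D1_nonneg by (auto intro: mult_left_mono)
        moreover have "2 * (D1 * T) + 2 * T \<le> \<bar>real_of_int k\<bar>"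
          using False by (simp add: K_def algebra_simps)
        moreover have "0 \<le> D1 * T"
          using D1_nonneg assms by simp
        moreover have "\<bar>real_of_int k\<bar> - \<bar>Theta_y t y\<bar> \<le> \<bar>Theta_y t y + of_int k\<bar>"
          by arith
        moreover have "(1 / 4) * (t + \<bar>real_of_int k\<bar>) = t / 4 + \<bar>real_of_int k\<bar> / 4"
          by simp
        ultimately show ?thesis
          using assms by linarith
      qed
      then have "cmod (packet k t) \<le> C / (t + \<bar>real_of_int k\<bar>) ^ 4"
        using t k1 by (intro C) auto
      also have "\<dots> \<le> C / \<bar>real_of_int k\<bar> ^ 4"
        using t k1 C(1) by (intro divide_left_mono power_mono) auto
      also have "\<dots> \<le> 16 * C * inverse (wt k ^ 2)"
      proof -
        have "wt k ^ 2 \<le> (2 * \<bar>real_of_int k\<bar>) ^ 2"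
          using k1 by (intro power_mono) (auto simp: wt_def)
        also have "\<dots> = 4 * \<bar>real_of_int k\<bar> ^ 2"
          by (simp add: power_mult_distrib)
        also have "\<dots> \<le> 16 * \<bar>real_of_int k\<bar> ^ 4"
          using k1 by (intro mult_mono power_increasing) auto
        finally have "C * wt k ^ 2 \<le> C * (16 * \<bar>real_of_int k\<bar> ^ 4)"
          using C(1) by (rule mult_left_mono)
        moreover have "0 < \<bar>real_of_int k\<bar> ^ 4" "0 < wt k ^ 2"
          using k1 by auto
        ultimately show ?thesis
          by (simp add: field_simps)
      qed
      also have "\<dots> \<le> (B * (1 + K) ^ 2 + 16 * C) * inverse (wt k ^ 2)"
        using B by (intro mult_right_mono) auto
      finally show ?thesis .
    qed
  qed
qed

text \<open>Stationary points need k = \<open>- Theta_y\<close>, which is at least 2 \<kappa> t - 2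
  D1 and thus well above \<kappa> t for large t. Below the cutoff the slope is therefore at least a
  multiple of t + |k|.\<close>

lemma packet_low_frequencies:
  "\<exists>C\<ge>0. \<exists>T\<ge>1. \<forall>t\<ge>T. \<forall>k. real_of_int k \<le> \<kappa> * t \<longrightarrow> cmod (packet k t) \<le> C / (t + \<bar>real_of_int k\<bar>) ^ 4"
proof -
  \<comment> \<open>For 0 \<le> k \<le> \<kappa> t the slope is at least \<kappa> t / 2 while t + k
    is at most (1 + \<kappa>) t; this dictates the first entry. For negative k the slope gains |k|
    in addition, and the second entry keeps c |k| below that gain.\<close>
  define c where "c = min (\<kappa> / (2 * (1 + \<kappa>))) (1 / 2)"
  have c: "0 < c" "c \<le> 1 / 2" "c * (1 + \<kappa>) \<le> \<kappa> / 2"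
    using \<kappa> by (auto simp: c_def min_def field_simps)
  obtain C where C: "C \<ge> 0" "\<And>t k. 0 \<le> t \<Longrightarrow> 1 \<le> t + \<bar>real_of_int k\<bar> \<Longrightarrow>
    (\<forall>y\<in>{a..b}. c * (t + \<bar>real_of_int k\<bar>) \<le> \<bar>Theta_y t y + of_int k\<bar>) \<Longrightarrow>
    cmod (packet k t) \<le> C / (t + \<bar>real_of_int k\<bar>) ^ 4"
    using packet_non_stationary[OF c(1)] by auto
  \<comment> \<open>Makes the bounded part \<open>2 * D1\<close> of the slope at most \<kappa> t /
    2.\<close>
  define T where "T = max 1 (4 * D1 / \<kappa>)"
  have "cmod (packet k t) \<le> C / (t + \<bar>real_of_int k\<bar>) ^ 4" if t: "T \<le> t" and k: "real_of_int k \<le> \<kappa> * t" for t k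
  proof (rule C)
    have t1: "1 \<le> t" "4 * D1 \<le> \<kappa> * t"
      using t \<kappa> by (auto simp: T_def field_simps)
    show "0 \<le> t" "1 \<le> t + \<bar>real_of_int k\<bar>"
      using t1 by auto
    have ct: "c * t + \<kappa> * (c * t) \<le> \<kappa> * t / 2"
      using mult_right_mono[OF c(3), of t] t1 by (simp add: algebra_simps)
    have c0: "0 \<le> \<kappa> * (c * t)"
      using \<kappa> c t1 by simp
    show "\<forall>y\<in>{a..b}. c * (t + \<bar>real_of_int k\<bar>) \<le> \<bar>Theta_y t y + of_int k\<bar>"
    proof
      fix y assume "y \<in> {a..b}"
      then have th: "Theta_y t y \<le> - 2 * (\<kappa> * t) + 2 * D1"
        using Theta_y_le[of y t] t1 by (simp add: mult.assoc)
      show "c * (t + \<bar>real_of_int k\<bar>) \<le> \<bar>Theta_y t y + of_int k\<bar>"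
      proof (cases "0 \<le> k")
        case True
        have "c * real_of_int k \<le> c * (\<kappa> * t)"
          using k c by (intro mult_left_mono) auto
        then have "c * (t + \<bar>real_of_int k\<bar>) \<le> \<kappa> * t / 2"
          using True ct by (simp add: algebra_simps)
        then show ?thesis
          using th k t1 by linarith
      next
        case False
        have "c * - real_of_int k \<le> 1 * - real_of_int k"
          using False c by (intro mult_right_mono) auto
        moreover have "c * (t + \<bar>real_of_int k\<bar>) = c * t + c * - real_of_int k"
          using False by (simp add: algebra_simps)
        ultimately have "c * (t + \<bar>real_of_int k\<bar>) \<le> \<kappa> * t / 2 + - real_of_int k"
          using ct c0 by linarith
        then show ?thesis
          using th t1 False c0 mult_nonneg_nonneg[of \<kappa> t] \<kappa> by linarith
      qed
    qed
  qed
  then show ?thesis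
    using C(1) by (intro exI[of _ C] conjI exI[of _ T]) (auto simp: T_def)
qed

lemma cmod_vv_le: "cmod (vv l) \<le> D1"
proof -
  have "(\<Sum>l\<in>{l}. cmod (vv l) * wt l) \<le> D1"
    unfolding D1_def by (intro finite_sum_le_infsum summable_vv_wt) auto
  moreover have "cmod (vv l) * 1 \<le> cmod (vv l) * wt l"
    by (intro mult_left_mono) auto
  ultimately show ?thesis
    by simp
qed

lemma vv_swap: "vv (l - k) = cnj (vv (k - l))"
  using vv_uminus[of "k - l"] by simp

text \<open>At time 0 the phase is trivial, and the coefficient of index 0 is the integral of a
  continuous nonnegative function that is positive at the midpoint.\<close>

lemma packet_0_0: "0 < cmod (packet 0 0)"
proof -
  have "0 < integral {a..b} bump"
  proof (rule ccontr)
    have "0 \<le> integral {a..b} bump"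
      using cmod_packet_le[of 0 0] norm_ge_zero order_trans by blast
    moreover assume "\<not> 0 < integral {a..b} bump"
    ultimately have "(bump has_integral 0) {a..b}"
      using integrable_integral[OF integrable_continuous_real[OF bump_continuous]] by (metis antisym not_less)
    moreover have "(a + b) / 2 \<in> cbox a b"
      using ab by auto
    ultimately have "bump ((a + b) / 2) = 0"
      using has_integral_0_cbox_imp_0[OF bump_continuous, of a b "(a + b) / 2"] ab bump_nonneg by simp
    moreover have "0 < ((a + b) / 2 - a) * (b - (a + b) / 2)"
      using ab by (intro mult_pos_pos) (auto simp: field_simps)
    ultimately show False
      unfolding bump_def by simp
  qed
  moreover have "packet 0 0 = of_real (integral {a..b} bump)"
    unfolding packet_def
    using integral_linear[of bump "{a..b}" complex_of_real, OF integrable_continuous_real[OF bump_continuous]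
        bounded_linear_of_real]
    by (simp add: o_def)
  ultimately show ?thesis
    by simp
qed

lemma packet_summable_square:
  assumes "0 \<le> t"
  shows "(\<lambda>k. (cmod (packet k t))\<^sup>2) summable_on UNIV"
proof -
  obtain C where C: "0 \<le> C" "\<And>k. cmod (packet k t) \<le> C * inverse (wt k ^ 2)"
    using packet_decay_locally[OF assms] assms by auto
  show ?thesis
  proof (rule dominated_summable_on)
    show "(\<lambda>k. (C * 1) * (C * inverse (wt k ^ 2))) summable_on UNIV"
      by (intro summable_on_cmult_right summable_on_inverse_wt_square)
    have "inverse (wt k ^ 2) \<le> 1" for k
      using one_le_power[OF wt_ge_1[of k], of 2] by (simp add: field_simps)
    then have le: "C * inverse (wt k ^ 2) \<le> C * 1" for k
      using C(1) by (rule mult_left_mono)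
    have "cmod (packet k t) * cmod (packet k t) \<le> (C * 1) * (C * inverse (wt k ^ 2))" for k
      by (intro mult_mono order_trans[OF C(2) le] C(2)) (use C(1) in auto)
    then show "norm ((cmod (packet k t))\<^sup>2) \<le> (C * 1) * (C * inverse (wt k ^ 2))" for k
      by (simp add: power2_eq_square)
  qed
qed

text \<open>The system of the packet is Hermitian because v is real, so the square sum never drops
  below its value at time 0, where the coefficient of index 0 alone is a positive
  contribution.\<close>

lemma packet_mass: "\<exists>\<mu>>0. \<forall>t\<ge>0. \<mu> \<le> (\<Sum>\<^sub>\<infinity>k. (cmod (packet k t))\<^sup>2)"
proof (intro exI conjI allI impI)
  have "(cmod (packet 0 0))\<^sup>2 \<le> (\<Sum>\<^sub>\<infinity>k. (cmod (packet k 0))\<^sup>2)"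
    using finite_sum_le_infsum[OF packet_summable_square[of 0], of "{0}"] by simp
  moreover have "0 < (cmod (packet 0 0))\<^sup>2"
    using packet_0_0 by simp
  ultimately show "0 < (\<Sum>\<^sub>\<infinity>k. (cmod (packet k 0))\<^sup>2)"
    by linarith
  fix t :: real assume t: "0 \<le> t"
  obtain C where C: "0 \<le> C" "\<And>k s. s \<in> {0..t} \<Longrightarrow> cmod (packet k s) \<le> C * inverse (wt k ^ 2)"
    using packet_decay_locally[OF t] by blast
  show "(\<Sum>\<^sub>\<infinity>k. (cmod (packet k 0))\<^sup>2) \<le> (\<Sum>\<^sub>\<infinity>k. (cmod (packet k t))\<^sup>2)"
  proof (rule energy_nondecreasing[where A = Ap and \<alpha> = D1, OF t has_vector_derivative_packet _ _ C(2)])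
    show "Ap l k s = cnj (Ap k l s)" for k l s
    proof -
      have "cis (of_int (l - k) * s) = cnj (cis (of_int (k - l) * s))"
        by (simp add: cis_cnj algebra_simps)
      then show ?thesis
        unfolding Ap_def vv_swap[of l k] by simp
    qed
    show "cmod (Ap k l s) \<le> D1" for k l s
    proof -
      have "\<bar>cos (of_int j * s)\<bar> * cmod (vv (k - l)) \<le> 1 * D1"
        by (intro mult_mono cmod_vv_le) auto
      then show ?thesis
        unfolding Ap_def by (simp add: norm_mult)
    qed
    show "(\<lambda>k. C * inverse (wt k ^ 2)) summable_on UNIV"
      by (intro summable_on_cmult_right summable_on_inverse_wt_square)
  qed
qed

end

section \<open>An exact solution close to the wave packet\<close>

lemma infsum_tail_small:
  fixes f :: "'a \<Rightarrow> real"
  assumes "f summable_on UNIV" "0 < \<epsilon>"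
  obtains X where "finite X" "(\<Sum>\<^sub>\<infinity>x\<in>-X. f x) < \<epsilon>"
proof -
  have "((\<lambda>X. sum f X) \<longlongrightarrow> infsum f UNIV) (finite_subsets_at_top UNIV)"
    by (rule infsum_tendsto[OF assms(1)])
  then have "\<forall>\<^sub>F X in finite_subsets_at_top UNIV. dist (sum f X) (infsum f UNIV) < \<epsilon>"
    using assms(2) by (rule tendstoD)
  then obtain X where "finite X" "dist (sum f X) (infsum f UNIV) < \<epsilon>"
    unfolding eventually_finite_subsets_at_top by blast
  then show ?thesis
    using infsum_split_finite[OF assms(1), of X] by (intro that[of X]) (auto simp: dist_real_def)
qed

context wave_packet
begin

text \<open>Conjugation by $e^{it|D|}$, which makes the system bounded.\<close>

definition Ax :: "int \<Rightarrow> int \<Rightarrow> real \<Rightarrow> complex" where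
  "Ax k l t = of_real (cos (of_int j * t)) * vv (k - l) * cis (of_int (\<bar>k\<bar> - \<bar>l\<bar>) * t)"

text \<open>The packet carried over from the frame of free transport to that of the half-wave flow;
  the factor is 1 for nonnegative \<open>k\<close>, where the two flows agree.\<close>

definition framed :: "int \<Rightarrow> real \<Rightarrow> complex" where
  "framed k t = cis (of_int (\<bar>k\<bar> - k) * t) * packet k t"

lemma cmod_framed [simp]: "cmod (framed k t) = cmod (packet k t)"
  by (simp add: framed_def norm_mult)

lemma Ax_hermitian: "Ax l k t = cnj (Ax k l t)"
proof -
  have "cis (of_int (\<bar>l\<bar> - \<bar>k\<bar>) * t) = cnj (cis (of_int (\<bar>k\<bar> - \<bar>l\<bar>) * t))"
    by (simp add: cis_cnj algebra_simps)
  then show ?thesis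
    unfolding Ax_def vv_swap[of l k] by simp
qed

lemma cmod_Ax_le: "cmod (Ax k l t) \<le> cmod (vv (k - l))"
  using mult_right_mono[OF abs_cos_le_one norm_ge_zero, of "of_int j * t" "vv (k - l)"]
  by (simp add: Ax_def norm_mult)

text \<open>The last term is the whole defect of the packet as an approximate solution: it vanishes
  for k \<ge> 0 and is 2 \<i> |k| times the coefficient for k < 0, the price of replacing |D| by -i
  d/dx.\<close>

lemma has_vector_derivative_framed:
  "(framed k has_vector_derivative
    (- \<i> * (\<Sum>\<^sub>\<infinity>l. Ax k l t * framed l t) + \<i> * of_int (\<bar>k\<bar> - k) * framed k t)) (at t)"
proof -
  let ?c = "\<lambda>k t. cis (real_of_int (\<bar>k\<bar> - k) * t)"
  have "((\<lambda>t. cis (of_int n * t)) has_vector_derivative \<i> * of_int n * cis (of_int n * t)) (at t)" for n :: int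
    by (auto simp: has_vector_derivative_def scaleR_conv_of_real fun_eq_iff algebra_simps intro!: derivative_eq_intros)
  from this[of "\<bar>k\<bar> - k"] have "(?c k has_vector_derivative \<i> * of_int (\<bar>k\<bar> - k) * ?c k t) (at t)" .
  from has_vector_derivative_mult[OF this has_vector_derivative_packet[of k t]]
  have "(framed k has_vector_derivative
      (?c k t * (- \<i> * (\<Sum>\<^sub>\<infinity>l. Ap k l t * packet l t)) + \<i> * of_int (\<bar>k\<bar> - k) * ?c k t * packet k t)) (at t)"
    unfolding framed_def[abs_def] .
  moreover have "?c k t * (\<Sum>\<^sub>\<infinity>l. Ap k l t * packet l t) = (\<Sum>\<^sub>\<infinity>l. Ax k l t * framed l t)"
  proof -
    have e: "?c k t * cis (of_int (k - l) * t) = cis (of_int (\<bar>k\<bar> - \<bar>l\<bar>) * t) * ?c l t" for l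
      by (simp add: cis_mult algebra_simps)
    have "?c k t * (Ap k l t * packet l t) = of_real (cos (of_int j * t)) * vv (k - l) * packet l t * (?c k t * cis (of_int (k - l) * t))" for l
      unfolding Ap_def by (simp only: mult_ac)
    then have "?c k t * (Ap k l t * packet l t) = Ax k l t * framed l t" for l
      unfolding e Ax_def framed_def by (simp only: mult_ac)
    then show ?thesis
      by (simp only: infsum_cmult_right'[symmetric])
  qed
  ultimately show ?thesis
    by (simp add: framed_def mult.assoc mult.left_commute)
qed

text \<open>The budget: the packet has mass at least \<mu>, of which at most \<mu> / 4 lies below
  the cutoff, and its difference \<open>w\<close> to the exact solution has mass at most \<mu> / 8.
  Above the cutoff |packet|^2 \<le> 2 |x|^2 + 2 |w|^2, so twice the mass of x there is at least
  \<mu> - \<mu> / 4 - \<mu> / 4.\<close>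

lemma high_frequency_solution:
  assumes m: "2 \<le> m"
  obtains x :: "int \<Rightarrow> real \<Rightarrow> complex" and \<delta> T where
    "\<And>k t. (x k has_vector_derivative (- \<i> * (\<Sum>\<^sub>\<infinity>l. Ax k l t * x l t))) (at t)"
    "\<And>T. \<exists>C\<ge>0. \<forall>k. \<forall>t\<in>{-T..T}. cmod (x k t) \<le> C * inverse (wt k ^ m)"
    "0 < \<delta>" "1 \<le> T"
    "\<And>t. T \<le> t \<Longrightarrow> \<delta> \<le> (\<Sum>\<^sub>\<infinity>k\<in>{k. \<kappa> * t < of_int k}. (cmod (x k t))\<^sup>2)"
proof -
  obtain \<mu> where \<mu>: "0 < \<mu>" "\<And>t. 0 \<le> t \<Longrightarrow> \<mu> \<le> (\<Sum>\<^sub>\<infinity>k. (cmod (packet k t))\<^sup>2)"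
    using packet_mass by blast
  obtain C T1 where C: "0 \<le> C" and T1: "1 \<le> T1" and low: "\<And>t k. T1 \<le> t \<Longrightarrow> real_of_int k \<le> \<kappa> * t \<Longrightarrow>
      cmod (packet k t) \<le> C / (t + \<bar>real_of_int k\<bar>) ^ 4"
    using packet_low_frequencies by blast
  define S where "S = (\<Sum>\<^sub>\<infinity>k. inverse (wt k ^ 2))"
  have S: "0 \<le> S"
    unfolding S_def by (intro infsum_nonneg) auto
  \<comment> \<open>Chosen so that the L^2 size of the defect at time s is at most
    \<open>G / s\<^sup>2\<close>, whose integral from \<open>T0\<close> onwards is
    \<open>G / T0\<close>.\<close>
  define G where "G = 2 * C * sqrt S"
  have G: "0 \<le> G"
    using C S by (simp add: G_def)
  \<comment> \<open>The square root of the admissible energy factor: one \<open>\<rho>\<close> pays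
    for the initial truncation, the other for the accumulated defect.\<close>
  define \<rho> where "\<rho> = sqrt (1 + \<mu> / 8)"
  have \<rho>: "1 < \<rho>" "\<rho> * \<rho> = 1 + \<mu> / 8"
    using \<mu>(1) by (auto simp: \<rho>_def)
  \<comment> \<open>The three entries make the low-frequency bound valid, the accumulated defect at
    most \<open>ln \<rho>\<close>, and the packet mass below the cutoff at most \<mu> / 4.\<close>
  define T0 where "T0 = max T1 (max (G / ln \<rho>) (4 * C\<^sup>2 * S / \<mu>))"
  have T0: "T1 \<le> T0" "1 \<le> T0" "G / T0 \<le> ln \<rho>" "4 * C\<^sup>2 * S \<le> \<mu> * T0"
  proof -
    show "T1 \<le> T0" and 1: "1 \<le> T0"
      using T1 by (auto simp: T0_def)
    have "0 < ln \<rho>" "G / ln \<rho> \<le> T0" "4 * C\<^sup>2 * S / \<mu> \<le> T0"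
      using \<rho> by (auto simp: T0_def)
    then show "G / T0 \<le> ln \<rho>" "4 * C\<^sup>2 * S \<le> \<mu> * T0"
      using 1 \<mu>(1) by (auto simp: field_simps)
  qed
  have "(\<lambda>k. (cmod (packet k T0))\<^sup>2) summable_on UNIV"
    using T0 by (intro packet_summable_square) auto
  moreover have "0 < \<rho> - 1"
    using \<rho> by simp
  ultimately obtain X where X: "finite X" "(\<Sum>\<^sub>\<infinity>k\<in>-X. (cmod (packet k T0))\<^sup>2) < \<rho> - 1"
    by (rule infsum_tail_small)
  \<comment> \<open>Finitely many modes satisfy the weighted bound for every \<open>m\<close>,
    whereas the decay proved for the packet has a fixed order; the discarded tail is small in
    L^2.\<close>
  define x0 where "x0 k = (if k \<in> X then framed k T0 else 0)" for k
  obtain x where x0: "\<And>k. x k T0 = x0 k"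
    and dx: "\<And>k t. (x k has_vector_derivative (\<Sum>\<^sub>\<infinity>l. - \<i> * Ax k l t * x l t)) (at t)"
    and decay: "\<And>T. \<exists>C\<ge>0. \<forall>k. \<forall>t\<in>{-T..T}. cmod (x k t) \<le> C * inverse (wt k ^ m)"
  proof (rule linear_system_solvable[where K = "\<lambda>k l t. - \<i> * Ax k l t" and \<alpha> = "\<lambda>l. cmod (vv l)" and m = m
        and ?a0.0 = x0 and ?t0.0 = T0])
    show "continuous_on UNIV (\<lambda>t. - \<i> * Ax k l t)" for k l
      unfolding Ax_def by (intro continuous_intros)
    show "cmod (- \<i> * Ax k l s) \<le> cmod (vv (k - l))" for k l s
      using cmod_Ax_le[of k l s] by (simp add: norm_mult)
    show "(\<lambda>l. cmod (vv l) * wt l ^ m) summable_on UNIV"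
      by (rule rapid_summable[OF rapid_vv])
    show "cmod (x0 k) * wt k ^ m \<le> (\<Sum>k\<in>X. cmod (framed k T0) * wt k ^ m)" for k
    proof (cases "k \<in> X")
      case True
      then show ?thesis
        using X(1) by (simp add: x0_def) (rule member_le_sum, auto)
    next
      case False
      then show ?thesis
        by (simp add: x0_def sum_nonneg)
    qed
  qed blast
  have dx': "(x k has_vector_derivative (- \<i> * (\<Sum>\<^sub>\<infinity>l. Ax k l t * x l t))) (at t)" for k t
    using dx[of k t] by (simp only: mult.assoc infsum_cmult_right')
  define w where "w k t = x k t - framed k t" for k t
  have energy: "(\<Sum>\<^sub>\<infinity>k. (cmod (w k t))\<^sup>2) \<le> \<mu> / 8" and w2: "(\<lambda>k. (cmod (w k t))\<^sup>2) summable_on UNIV"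
    if t: "T0 \<le> t" for t
  proof -
    obtain Cx where Cx: "0 \<le> Cx" "\<And>k s. s \<in> {-t..t} \<Longrightarrow> cmod (x k s) \<le> Cx * inverse (wt k ^ m)"
      using decay[of t] by blast
    obtain Cp where Cp: "0 \<le> Cp" "\<And>k s. s \<in> {0..t} \<Longrightarrow> cmod (packet k s) \<le> Cp * inverse (wt k ^ 2)"
      using packet_decay_locally[of t] t T0 by fastforce
    have x2: "cmod (x k s) \<le> Cx * inverse (wt k ^ 2)" if "s \<in> {-t..t}" for k s
    proof -
      have "inverse (wt k ^ m) \<le> inverse (wt k ^ 2)"
        using m by (intro le_imp_inverse_le power_increasing) auto
      from mult_left_mono[OF this Cx(1)] show ?thesis
        using Cx(2)[OF that, of k] by linarith
    qed
    have wb: "cmod (w k s) \<le> (Cx + Cp) * inverse (wt k ^ 2)" if "s \<in> {T0..t}" for k s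
      using norm_triangle_ineq4[of "x k s" "framed k s"] x2[of s k] Cp(2)[of s k] that T0
      unfolding w_def by (simp add: distrib_right)
    have sum: "(\<lambda>k. (Cx + Cp) * inverse (wt k ^ 2)) summable_on UNIV"
      by (intro summable_on_cmult_right summable_on_inverse_wt_square)
    show "(\<lambda>k. (cmod (w k t))\<^sup>2) summable_on UNIV"
    proof (rule dominated_summable_on)
      show "(\<lambda>k. (Cx + Cp) * ((Cx + Cp) * inverse (wt k ^ 2))) summable_on UNIV"
        by (intro summable_on_cmult_right summable_on_inverse_wt_square)
      have le: "(Cx + Cp) * inverse (wt k ^ 2) \<le> (Cx + Cp) * 1" for k
        using Cx(1) Cp(1) one_le_power[OF wt_ge_1[of k], of 2]
        by (intro mult_left_mono) (auto simp: field_simps)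
      have "cmod (w k t) * cmod (w k t) \<le> (Cx + Cp) * ((Cx + Cp) * inverse (wt k ^ 2))" for k
        using wb[of t k] le[of k] t Cx(1) Cp(1) by (intro mult_mono) auto
      then show "norm ((cmod (w k t))\<^sup>2) \<le> (Cx + Cp) * ((Cx + Cp) * inverse (wt k ^ 2))" for k
        by (simp add: power2_eq_square)
    qed
    have "1 + (\<Sum>\<^sub>\<infinity>k. (cmod (w k t))\<^sup>2) \<le> (1 + (\<Sum>\<^sub>\<infinity>k. (cmod (w k T0))\<^sup>2)) * exp (- G / t - - G / T0)"
    proof (rule energy_estimate[where A = Ax and F = "\<lambda>k t. - (\<i> * of_int (\<bar>k\<bar> - k) * framed k t)"
          and \<alpha> = D1 and \<beta> = "\<lambda>k. (Cx + Cp) * inverse (wt k ^ 2)" and \<eta> = "\<lambda>s. G / s\<^sup>2", OF t _ Ax_hermitian])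
      show "cmod (Ax k l s) \<le> D1" for k l s
        using cmod_Ax_le[of k l s] cmod_vv_le[of "k - l"] by linarith
      show "cmod (w k s) \<le> (Cx + Cp) * inverse (wt k ^ 2)" if "s \<in> {T0..t}" for k s
        by (rule wb[OF that])
      show "(\<lambda>k. (Cx + Cp) * inverse (wt k ^ 2)) summable_on UNIV"
        by (rule sum)
      fix s assume s: "s \<in> {T0..t}"
      then have s1: "1 \<le> s"
        using T0 by auto
      show "0 \<le> G / s\<^sup>2"
        using G by simp
      show "((\<lambda>s. - G / s) has_real_derivative G / s\<^sup>2) (at s)"
        using s1 by (auto intro!: derivative_eq_intros simp: power2_eq_square)
      show "(w k has_vector_derivative - \<i> * (\<Sum>\<^sub>\<infinity>l. Ax k l s * w l s) + - (\<i> * of_int (\<bar>k\<bar> - k) * framed k s)) (at s)" for k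
      proof -
        have ax: "(\<lambda>l. Ax k l s * z l) summable_on UNIV" if "\<And>l. cmod (z l) \<le> B" for z :: "int \<Rightarrow> complex" and B
        proof (rule dominated_summable_on)
          show "(\<lambda>l. cmod (vv (k - l)) * B) summable_on UNIV"
            using summable_vv by (intro summable_on_cmult_left) (subst summable_on_diff_shift, simp)
          show "cmod (Ax k l s * z l) \<le> cmod (vv (k - l)) * B" for l
            unfolding norm_mult by (intro mult_mono cmod_Ax_le that) auto
        qed
        have le1: "inverse (wt l ^ 2) \<le> 1" for l
          using one_le_power[OF wt_ge_1[of l], of 2] by (simp add: field_simps)
        have "cmod (x l s) \<le> Cx" for l
          using x2[of s l] mult_left_mono[OF le1[of l] Cx(1)] s T0 by auto
        moreover have "cmod (framed l s) \<le> integral {a..b} bump" for l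
          by (simp add: cmod_packet_le)
        ultimately have sum_w: "(\<Sum>\<^sub>\<infinity>l. Ax k l s * w l s) = (\<Sum>\<^sub>\<infinity>l. Ax k l s * x l s) - (\<Sum>\<^sub>\<infinity>l. Ax k l s * framed l s)"
          unfolding w_def right_diff_distrib by (intro infsum_diff ax)
        have "(w k has_vector_derivative (- \<i> * (\<Sum>\<^sub>\<infinity>l. Ax k l s * x l s) -
            (- \<i> * (\<Sum>\<^sub>\<infinity>l. Ax k l s * framed l s) + \<i> * of_int (\<bar>k\<bar> - k) * framed k s))) (at s)"
          unfolding w_def[abs_def]
          by (rule has_vector_derivative_diff[OF dx'[of k s] has_vector_derivative_framed[of k s]])
        then show ?thesis
          unfolding sum_w by (simp add: algebra_simps)
      qed
      show "(\<Sum>k\<in>Y. (cmod (- (\<i> * of_int (\<bar>k\<bar> - k) * framed k s)))\<^sup>2) \<le> (G / s\<^sup>2)\<^sup>2" if "finite Y" for Y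
      proof -
        have "(cmod (- (\<i> * of_int (\<bar>k\<bar> - k) * framed k s)))\<^sup>2 \<le> (2 * C / s\<^sup>2)\<^sup>2 * inverse (wt k ^ 2)" for k
        proof (cases "0 \<le> k")
          case False
          let ?K = "\<bar>real_of_int k\<bar>"
          have p: "cmod (packet k s) \<le> C / (s + ?K) ^ 4"
            using s T0 s1 \<kappa> False by (intro low) (auto intro: order_trans[of _ 0])
          have F: "cmod (- (\<i> * of_int (\<bar>k\<bar> - k) * framed k s)) = 2 * ?K * cmod (packet k s)"
            using False by (simp add: norm_mult)
          have "cmod (- (\<i> * of_int (\<bar>k\<bar> - k) * framed k s)) \<le> 2 * ?K * (C / (s + ?K) ^ 4)"
            unfolding F by (intro mult_left_mono p) auto
          also have "\<dots> \<le> 2 * C / s\<^sup>2 * inverse (wt k)"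
          proof -
            \<comment> \<open>Of the four factors s + |k|, one absorbs |k|, two give the integrable
              rate in s, and the last dominates \<open>wt k\<close> because s \<ge> 1.\<close>
            have "?K * (s\<^sup>2 * wt k) \<le> (s + ?K) * ((s + ?K)\<^sup>2 * (s + ?K))"
              using s1 by (intro mult_mono power_mono) (auto simp: wt_def)
            also have "\<dots> = (s + ?K) ^ 4"
              by (simp add: power2_eq_square power4_eq_xxxx)
            finally have "2 * C * (?K * (s\<^sup>2 * wt k)) \<le> 2 * C * (s + ?K) ^ 4"
              using C by (intro mult_left_mono) auto
            then have "(2 * C * ?K) * (s\<^sup>2 * wt k) \<le> 2 * C * (s + ?K) ^ 4"
              by (simp only: mult.assoc)
            moreover have "u / q \<le> v / r" if "u * r \<le> v * q" "0 < q" "0 < r" for u v q r :: real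
              using that by (simp add: field_simps)
            moreover have "0 < (s + ?K) ^ 4" "0 < s\<^sup>2 * wt k"
              using s1 by (auto intro!: zero_less_power add_pos_nonneg mult_pos_pos)
            ultimately have "2 * C * ?K / (s + ?K) ^ 4 \<le> 2 * C / (s\<^sup>2 * wt k)"
              by blast
            then show ?thesis
              by (simp add: divide_inverse mult_ac)
          qed
          finally have "(cmod (- (\<i> * of_int (\<bar>k\<bar> - k) * framed k s)))\<^sup>2 \<le> (2 * C / s\<^sup>2 * inverse (wt k))\<^sup>2"
            by (intro power_mono) auto
          then show ?thesis
            by (simp only: power_mult_distrib power_inverse)
        qed simp
        then have "(\<Sum>k\<in>Y. (cmod (- (\<i> * of_int (\<bar>k\<bar> - k) * framed k s)))\<^sup>2) \<le> (2 * C / s\<^sup>2)\<^sup>2 * (\<Sum>k\<in>Y. inverse (wt k ^ 2))"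
          unfolding sum_distrib_left by (rule sum_mono)
        also have "\<dots> \<le> (2 * C / s\<^sup>2)\<^sup>2 * S"
          unfolding S_def
          by (intro mult_left_mono finite_sum_le_infsum summable_on_inverse_wt_square that) auto
        also have "\<dots> = (G / s\<^sup>2)\<^sup>2"
          using S by (simp add: G_def power_mult_distrib power_divide)
        finally show ?thesis .
      qed
    qed
    also have "\<dots> \<le> \<rho> * \<rho>"
    proof (rule mult_mono)
      \<comment> \<open>At \<open>T0\<close> the difference vanishes on \<open>X\<close> and has the
        size of the packet elsewhere.\<close>
      have "(\<Sum>\<^sub>\<infinity>k. (cmod (w k T0))\<^sup>2) = (\<Sum>\<^sub>\<infinity>k\<in>-X. (cmod (packet k T0))\<^sup>2)"
        by (rule infsum_cong_neutral) (auto simp: w_def x0 x0_def)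
      then show "1 + (\<Sum>\<^sub>\<infinity>k. (cmod (w k T0))\<^sup>2) \<le> \<rho>"
        using X(2) by simp
      have "- G / t - - G / T0 \<le> ln \<rho>"
        using T0 t G by (auto intro: order_trans[OF _ T0(3)])
      then show "exp (- G / t - - G / T0) \<le> \<rho>"
        using \<rho> by (metis exp_le_cancel_iff exp_ln less_trans zero_less_one)
    qed (use \<rho> in auto)
    finally show "(\<Sum>\<^sub>\<infinity>k. (cmod (w k t))\<^sup>2) \<le> \<mu> / 8"
      using \<rho>(2) by simp
  qed
  show ?thesis
  proof (rule that[OF dx' decay])
    show "0 < \<mu> / 4" "1 \<le> T0"
      using \<mu> T0 by auto
    fix t assume t: "T0 \<le> t"
    then have t1: "1 \<le> t"
      using T0 by simp
    let ?H = "{k. \<kappa> * t < real_of_int k}"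
    have packet2: "(\<lambda>k. (cmod (packet k t))\<^sup>2) summable_on UNIV"
      using t1 by (intro packet_summable_square) auto
    have x2: "(\<lambda>k. (cmod (x k t))\<^sup>2) summable_on UNIV"
    proof (rule dominated_summable_on)
      show "(\<lambda>k. 2 * (cmod (w k t))\<^sup>2 + 2 * (cmod (packet k t))\<^sup>2) summable_on UNIV"
        by (intro summable_on_add summable_on_cmult_right w2 packet2 t)
      show "norm ((cmod (x k t))\<^sup>2) \<le> 2 * (cmod (w k t))\<^sup>2 + 2 * (cmod (packet k t))\<^sup>2" for k
      proof -
        have "cmod (x k t) \<le> cmod (w k t) + cmod (packet k t)"
          using norm_triangle_ineq[of "w k t" "framed k t"] by (simp add: w_def)
        then have "(cmod (x k t))\<^sup>2 \<le> (cmod (w k t) + cmod (packet k t))\<^sup>2"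
          by (intro power_mono) auto
        also have "\<dots> \<le> 2 * (cmod (w k t))\<^sup>2 + 2 * (cmod (packet k t))\<^sup>2"
          using sum_squares_bound[of "cmod (w k t)" "cmod (packet k t)"] by (simp add: power2_sum)
        finally show ?thesis
          by simp
      qed
    qed
    have "\<mu> \<le> (\<Sum>\<^sub>\<infinity>k. (cmod (packet k t))\<^sup>2)"
      using t1 by (intro \<mu>) auto
    also have "\<dots> = (\<Sum>\<^sub>\<infinity>k\<in>?H \<union> -?H. (cmod (packet k t))\<^sup>2)"
      by simp
    also have "\<dots> = (\<Sum>\<^sub>\<infinity>k\<in>?H. (cmod (packet k t))\<^sup>2) + (\<Sum>\<^sub>\<infinity>k\<in>-?H. (cmod (packet k t))\<^sup>2)"
      by (intro infsum_Un_disjoint summable_on_subset_banach[OF packet2]) auto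
    also have "(\<Sum>\<^sub>\<infinity>k\<in>-?H. (cmod (packet k t))\<^sup>2) \<le> \<mu> / 4"
    proof -
      \<comment> \<open>Of the eight powers of t + |k| in the squared bound, one gives smallness in
        t and two give summability in k.\<close>
      have s: "(\<lambda>k. C\<^sup>2 / t * inverse (wt k ^ 2)) summable_on A" for A
        by (rule summable_on_subset_banach[OF summable_on_cmult_right[OF summable_on_inverse_wt_square]]) auto
      have "(\<Sum>\<^sub>\<infinity>k\<in>-?H. (cmod (packet k t))\<^sup>2) \<le> (\<Sum>\<^sub>\<infinity>k\<in>-?H. C\<^sup>2 / t * inverse (wt k ^ 2))"
      proof (rule infsum_mono[OF summable_on_subset_banach[OF packet2] s])
        fix k assume "k \<in> -?H"
        let ?q = "t + \<bar>real_of_int k\<bar>"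
        have "cmod (packet k t) \<le> C / ?q ^ 4"
          using \<open>k \<in> -?H\<close> t T0 by (intro low) auto
        then have "(cmod (packet k t))\<^sup>2 \<le> (C / ?q ^ 4)\<^sup>2"
          by (intro power_mono) auto
        also have "\<dots> = C\<^sup>2 / (?q ^ 4)\<^sup>2"
          by (simp add: power_divide)
        also have "\<dots> \<le> C\<^sup>2 / (t * wt k ^ 2)"
        proof (rule divide_left_mono)
          have q: "1 \<le> ?q"
            using t1 by simp
          have "t * wt k ^ 2 \<le> ?q * ?q ^ 2"
            using t1 by (intro mult_mono power_mono) (auto simp: wt_def)
          also have "\<dots> = ?q ^ 3"
            by (simp add: power2_eq_square power3_eq_cube)
          also have "\<dots> \<le> ?q ^ 8"
            using q by (intro power_increasing) auto
          finally show "t * wt k ^ 2 \<le> (?q ^ 4)\<^sup>2"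
            by (simp add: power_mult[symmetric])
          show "0 < (?q ^ 4)\<^sup>2 * (t * wt k ^ 2)"
            using q t1 by (intro mult_pos_pos zero_less_power) auto
        qed auto
        finally show "(cmod (packet k t))\<^sup>2 \<le> C\<^sup>2 / t * inverse (wt k ^ 2)"
          by (simp add: divide_inverse mult_ac)
      qed auto
      also have "\<dots> \<le> (\<Sum>\<^sub>\<infinity>k. C\<^sup>2 / t * inverse (wt k ^ 2))"
        using t1 by (intro infsum_mono2 s) auto
      also have "\<dots> = C\<^sup>2 / t * S"
        unfolding S_def by (rule infsum_cmult_right')
      also have "\<dots> \<le> \<mu> / 4"
      proof -
        have "4 * C\<^sup>2 * S \<le> \<mu> * t"
          using T0(4) t \<mu>(1) by (meson mult_left_mono less_imp_le order_trans)
        then show ?thesis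
          using t1 by (simp add: field_simps)
      qed
      finally show ?thesis .
    qed
    also have "(\<Sum>\<^sub>\<infinity>k\<in>?H. (cmod (packet k t))\<^sup>2) \<le> (\<Sum>\<^sub>\<infinity>k\<in>?H. 2 * (cmod (x k t))\<^sup>2 + 2 * (cmod (w k t))\<^sup>2)"
    proof (rule infsum_mono)
      show "(\<lambda>k. (cmod (packet k t))\<^sup>2) summable_on ?H"
        by (rule summable_on_subset_banach[OF packet2]) auto
      show "(\<lambda>k. 2 * (cmod (x k t))\<^sup>2 + 2 * (cmod (w k t))\<^sup>2) summable_on ?H"
        by (intro summable_on_add summable_on_cmult_right summable_on_subset_banach[OF x2]
            summable_on_subset_banach[OF w2[OF t]]) auto
      fix k
      have "cmod (packet k t) \<le> cmod (x k t) + cmod (w k t)"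
        using norm_triangle_ineq4[of "x k t" "w k t"] by (simp add: w_def)
      then have "(cmod (packet k t))\<^sup>2 \<le> (cmod (x k t) + cmod (w k t))\<^sup>2"
        by (intro power_mono) auto
      also have "\<dots> \<le> 2 * (cmod (x k t))\<^sup>2 + 2 * (cmod (w k t))\<^sup>2"
        using sum_squares_bound[of "cmod (x k t)" "cmod (w k t)"] by (simp add: power2_sum)
      finally show "(cmod (packet k t))\<^sup>2 \<le> 2 * (cmod (x k t))\<^sup>2 + 2 * (cmod (w k t))\<^sup>2" .
    qed
    also have "(\<Sum>\<^sub>\<infinity>k\<in>?H. 2 * (cmod (x k t))\<^sup>2 + 2 * (cmod (w k t))\<^sup>2)
        = 2 * (\<Sum>\<^sub>\<infinity>k\<in>?H. (cmod (x k t))\<^sup>2) + 2 * (\<Sum>\<^sub>\<infinity>k\<in>?H. (cmod (w k t))\<^sup>2)"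
      by (subst infsum_add) (auto simp: infsum_cmult_right' intro!: summable_on_cmult_right
          summable_on_subset_banach[OF x2] summable_on_subset_banach[OF w2[OF t]])
    also have "(\<Sum>\<^sub>\<infinity>k\<in>?H. (cmod (w k t))\<^sup>2) \<le> (\<Sum>\<^sub>\<infinity>k. (cmod (w k t))\<^sup>2)"
      by (intro infsum_mono2 w2 t summable_on_subset_banach[OF w2[OF t]]) auto
    also note energy[OF t]
    finally show "\<mu> / 4 \<le> (\<Sum>\<^sub>\<infinity>k\<in>?H. (cmod (x k t))\<^sup>2)"
      by linarith
  qed
qed

end

section \<open>Fourier coefficients\<close>

text \<open>Passes from the Lebesgue integral in \<open>fcoef\<close> to the gauge integral used in
  the preceding sections.\<close>

lemma fcoef_eq_integral:
  assumes "continuous_on {0..2 * pi} f"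
  shows "fcoef f k = of_real (1 / (2 * pi)) * integral {0..2 * pi} (\<lambda>x. f x * cis (- (of_int k * x)))"
proof -
  have "set_integrable lborel {0..2 * pi} (\<lambda>x. f x * cis (- (of_int k * x)))"
    by (intro borel_integrable_atLeastAtMost' continuous_intros assms)
  then show ?thesis
    unfolding fcoef_def by (simp add: set_borel_integral_eq_integral(2))
qed

lemma cmod_fcoef_le:
  assumes "continuous_on {0..2 * pi} f" "\<And>x. x \<in> {0..2 * pi} \<Longrightarrow> cmod (f x) \<le> B"
  shows "cmod (fcoef f k) \<le> B"
proof -
  have "cmod (integral {0..2 * pi} (\<lambda>x. f x * cis (- (of_int k * x)))) \<le> integral {0..2 * pi} (\<lambda>x. B)"
    by (rule integral_norm_bound_integral)
       (auto intro!: integrable_continuous_real continuous_intros assms simp: norm_mult)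
  then show ?thesis
    unfolding fcoef_eq_integral[OF assms(1)] by (simp add: norm_mult norm_divide field_simps)
qed

lemma cis_int_2pi [simp]: "cis (of_int k * (2 * pi)) = 1" "cis (- (of_int k * (2 * pi))) = 1"
  using cis_multiple_2pi[of "of_int k"] cis_multiple_2pi[of "- of_int k"] by (simp_all add: mult.commute)

text \<open>Integration by parts over one period; the equal end values cancel the boundary
  terms.\<close>

lemma fcoef_deriv:
  assumes der: "\<And>x. (f has_vector_derivative f' x) (at x)" and cont: "continuous_on UNIV f'"
    and per: "f (2 * pi) = f 0"
  shows "fcoef f' k = \<i> * of_int k * fcoef f k"
proof -
  have f: "continuous_on A f" for A
    using der by (meson continuous_at_imp_continuous_on has_vector_derivative_continuous)
  have f': "continuous_on A f'" for A
    using cont continuous_on_subset by blast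
  let ?e = "\<lambda>x. cis (- (of_int k * x))"
  have "((\<lambda>x. f x * ?e x) has_vector_derivative (f x * (- (\<i> * of_int k) * ?e x) + f' x * ?e x)) (at x within {0..2 * pi})" for x
    by (intro has_vector_derivative_mult has_vector_derivative_at_within[OF der])
       (auto simp: has_vector_derivative_def scaleR_conv_of_real fun_eq_iff algebra_simps intro!: derivative_eq_intros)
  then have "((\<lambda>x. f x * (- (\<i> * of_int k) * ?e x) + f' x * ?e x) has_integral f (2 * pi) * ?e (2 * pi) - f 0 * ?e 0) {0..2 * pi}"
    by (intro fundamental_theorem_of_calculus) auto
  then have "integral {0..2 * pi} (\<lambda>x. f x * (- (\<i> * of_int k) * ?e x) + f' x * ?e x) = 0"
    using per by (simp add: integral_unique)
  moreover have "integral {0..2 * pi} (\<lambda>x. f x * (- (\<i> * of_int k) * ?e x) + f' x * ?e x)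
      = integral {0..2 * pi} (\<lambda>x. f x * (- (\<i> * of_int k) * ?e x)) + integral {0..2 * pi} (\<lambda>x. f' x * ?e x)"
    by (intro integral_add integrable_continuous_real continuous_intros f f')
  moreover have "integral {0..2 * pi} (\<lambda>x. f x * (- (\<i> * of_int k) * ?e x)) = - (\<i> * of_int k) * integral {0..2 * pi} (\<lambda>x. f x * ?e x)"
    by (subst integral_mult_right[symmetric]) (simp add: mult_ac)
  ultimately show ?thesis
    unfolding fcoef_eq_integral[OF f] fcoef_eq_integral[OF f'] by (simp add: algebra_simps add_eq_0_iff)
qed

section \<open>Fourier coefficients of a smooth real periodic function\<close>

lemma smooth_real_derivatives:
  assumes "smooth_real v" "periodic_2pi v"
  shows "((deriv ^^ n) v has_real_derivative (deriv ^^ Suc n) v x) (at x)"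
    and "(deriv ^^ n) v (x + 2 * pi) = (deriv ^^ n) v x"
proof -
  show der: "((deriv ^^ n) v has_real_derivative (deriv ^^ Suc n) v x) (at x)" for n x
    using assms(1) unfolding smooth_real_def
    by (simp add: DERIV_deriv_iff_real_differentiable)
  show "(deriv ^^ n) v (x + 2 * pi) = (deriv ^^ n) v x"
  proof (induction n arbitrary: x)
    case (Suc n)
    have "((\<lambda>x. (deriv ^^ n) v (x + 2 * pi)) has_real_derivative (deriv ^^ Suc n) v (x + 2 * pi)) (at x)"
      using der[of n "x + 2 * pi"] unfolding DERIV_shift .
    then have "((deriv ^^ n) v has_real_derivative (deriv ^^ Suc n) v (x + 2 * pi)) (at x)"
      by (simp only: Suc.IH)
    then show ?case
      using der DERIV_unique by blast
  qed (use assms(2) in \<open>simp add: periodic_2pi_def\<close>)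
qed

text \<open>The coefficient of the m-th derivative is (ik)^m times the original one and is bounded
  by the maximum of that derivative. For k \<noteq> 0 the weight \<open>wt k\<close> is at most 2
  |k|, hence the factor \<open>2 ^ m\<close>.\<close>

lemma rapid_fcoef:
  assumes "smooth_real v" "periodic_2pi v"
  shows "rapid (fcoef (\<lambda>x. complex_of_real (v x)))"
proof -
  define u where "u n x = complex_of_real ((deriv ^^ n) v x)" for n x
  have der: "(u n has_vector_derivative u (Suc n) x) (at x)" for n x
    unfolding u_def[abs_def] using smooth_real_derivatives(1)[OF assms, of n x]
    by (intro has_vector_derivative_of_real) (simp add: has_real_derivative_iff_has_vector_derivative)
  have cont: "continuous_on A (u n)" for n A
    using der[of n] by (meson continuous_at_imp_continuous_on has_vector_derivative_continuous)
  have per: "u n (2 * pi) = u n 0" for n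
    using smooth_real_derivatives(2)[OF assms, of n 0] by (simp add: u_def)
  have c: "fcoef (u n) k = (\<i> * of_int k) ^ n * fcoef (u 0) k" for n k
  proof (induction n)
    case (Suc n)
    then show ?case
      using fcoef_deriv[OF der cont per, of n k] by (simp add: mult.assoc)
  qed simp
  have "\<exists>B. \<forall>k. cmod (fcoef (u n) k) \<le> B" for n
  proof -
    have "bounded (u n ` {0..2 * pi})"
      by (intro compact_imp_bounded compact_continuous_image cont) auto
    then obtain B where "\<forall>z\<in>u n ` {0..2 * pi}. norm z \<le> B"
      unfolding bounded_iff by blast
    then show ?thesis
      by (intro exI[of _ B] allI cmod_fcoef_le cont) auto
  qed
  then obtain B where B: "\<And>n k. cmod (fcoef (u n) k) \<le> B n"
    by metis
  have "cmod (fcoef (u 0) k) * wt k ^ m \<le> \<bar>B 0\<bar> + 2 ^ m * \<bar>B m\<bar>" for m k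
  proof (cases "k = 0")
    case True
    then show ?thesis
      using B[of 0 0] by (simp add: wt_def add_increasing2)
  next
    case False
    have "wt k ^ m \<le> (2 * \<bar>real_of_int k\<bar>) ^ m"
      using False by (intro power_mono) (auto simp: wt_def)
    then have "cmod (fcoef (u 0) k) * wt k ^ m \<le> cmod (fcoef (u 0) k) * (2 * \<bar>real_of_int k\<bar>) ^ m"
      by (rule mult_left_mono) simp
    also have "\<dots> = 2 ^ m * cmod (fcoef (u m) k)"
      unfolding c[of m k] by (simp add: norm_mult norm_power power_mult_distrib)
    also have "\<dots> \<le> 2 ^ m * \<bar>B m\<bar>"
      using B[of m k] by (intro mult_left_mono) auto
    finally show ?thesis
      by simp
  qed
  then show ?thesis
    unfolding rapid_def u_def by auto
qed

lemma fcoef_uminus: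
  assumes "continuous_on {0..2 * pi} v"
  shows "fcoef (\<lambda>x. complex_of_real (v x)) (- k) = cnj (fcoef (\<lambda>x. complex_of_real (v x)) k)"
proof -
  have c: "continuous_on {0..2 * pi} (\<lambda>x. complex_of_real (v x))"
    by (intro continuous_intros assms)
  have "(\<lambda>x. complex_of_real (v x) * cis (- (of_int k * x))) integrable_on {0..2 * pi}"
    by (intro integrable_continuous_real continuous_intros assms)
  from integral_linear[OF this bounded_linear_cnj]
  have "integral {0..2 * pi} (\<lambda>x. complex_of_real (v x) * cis (of_int k * x))
      = cnj (integral {0..2 * pi} (\<lambda>x. complex_of_real (v x) * cis (- (of_int k * x))))"
    by (simp add: o_def cis_cnj)
  then show ?thesis
    unfolding fcoef_eq_integral[OF c] by simp
qed

lemma fcoef_1: "fcoef (\<lambda>x. 1) k = (if k = 0 then 1 else 0)"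
proof (cases "k = 0")
  case True
  then show ?thesis
    by (subst fcoef_eq_integral) (auto simp: scaleR_conv_of_real)
next
  case False
  \<comment> \<open>Orthogonality from differentiation: the constant has derivative 0, so i k times
    its coefficient vanishes.\<close>
  have "fcoef (\<lambda>x. 0) k = \<i> * of_int k * fcoef (\<lambda>x. 1) k"
    by (rule fcoef_deriv) auto
  moreover have "fcoef (\<lambda>x. 0) k = 0"
    by (subst fcoef_eq_integral) auto
  ultimately show ?thesis
    using False by simp
qed

text \<open>Mode \<open>l\<close> of the series shifts the index of \<open>u\<close> by
  \<open>l\<close>, and domination allows summation under the integral. This links multiplication by
  the potential to the matrix system.\<close>

lemma fcoef_mult_tsum:
  assumes u: "continuous_on {0..2 * pi} u" and \<alpha>: "(\<lambda>l. cmod (\<alpha> l)) summable_on UNIV"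
  shows "fcoef (\<lambda>x. u x * tsum \<alpha> x) k = (\<Sum>\<^sub>\<infinity>l. fcoef u (k - l) * \<alpha> l)"
proof -
  define c where "c l x = \<alpha> l * (u x * cis (- (of_int (k - l) * x)))" for l x
  have "bounded (u ` {0..2 * pi})"
    by (intro compact_imp_bounded compact_continuous_image u) auto
  then obtain B where B: "\<forall>z\<in>u ` {0..2 * pi}. norm z \<le> B"
    unfolding bounded_iff by blast
  have "((\<lambda>l. integral {0..2 * pi} (c l)) has_sum integral {0..2 * pi} (\<lambda>x. \<Sum>\<^sub>\<infinity>l. c l x)) UNIV"
  proof (rule has_sum_integral_dominated)
    show "continuous_on {0..2 * pi} (c l)" for l
      unfolding c_def by (intro continuous_intros u)
    show "cmod (c l x) \<le> cmod (\<alpha> l) * B" if "x \<in> {0..2 * pi}" for l x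
      using B that by (auto simp: c_def norm_mult intro!: mult_left_mono)
  qed (intro summable_on_cmult_left \<alpha>)
  moreover have "(\<Sum>\<^sub>\<infinity>l. c l x) = u x * tsum \<alpha> x * cis (- (of_int k * x))" for x
  proof -
    have "cis (- (of_int (k - l) * x)) = cis (of_int l * x) * cis (- (of_int k * x))" for l
      by (simp add: cis_mult algebra_simps)
    then have "c l x = (u x * cis (- (of_int k * x))) * (\<alpha> l * cis (of_int l * x))" for l
      unfolding c_def by (simp add: mult_ac)
    then show ?thesis
      unfolding tsum_def by (simp only: infsum_cmult_right') (simp only: mult_ac)
  qed
  ultimately have "integral {0..2 * pi} (\<lambda>x. u x * tsum \<alpha> x * cis (- (of_int k * x))) = (\<Sum>\<^sub>\<infinity>l. integral {0..2 * pi} (c l))"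
    by (simp add: infsumI)
  moreover have "continuous_on {0..2 * pi} (\<lambda>x. u x * tsum \<alpha> x)"
    by (intro continuous_intros u continuous_on_tsum \<alpha>)
  ultimately have "fcoef (\<lambda>x. u x * tsum \<alpha> x) k = (\<Sum>\<^sub>\<infinity>l. of_real (1 / (2 * pi)) * integral {0..2 * pi} (c l))"
    by (simp only: fcoef_eq_integral infsum_cmult_right')
  also have "\<dots> = (\<Sum>\<^sub>\<infinity>l. fcoef u (k - l) * \<alpha> l)"
    unfolding fcoef_eq_integral[OF u] c_def by (simp add: integral_mult_right mult_ac)
  finally show ?thesis .
qed

lemma fcoef_tsum:
  assumes "(\<lambda>l. cmod (\<alpha> l)) summable_on UNIV"
  shows "fcoef (tsum \<alpha>) k = \<alpha> k"
proof -
  have "fcoef (\<lambda>x. 1 * tsum \<alpha> x) k = (\<Sum>\<^sub>\<infinity>l. fcoef (\<lambda>x. 1) (k - l) * \<alpha> l)"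
    by (rule fcoef_mult_tsum) (use assms in auto)
  also have "\<dots> = (\<Sum>\<^sub>\<infinity>l\<in>{k}. \<alpha> l)"
    by (rule infsum_cong_neutral) (auto simp: fcoef_1)
  finally show ?thesis
    by simp
qed

section \<open>Sobolev norms of trigonometric series\<close>

text \<open>The Sobolev weight uses up at most \<open>n\<close> of the \<open>Suc n\<close> powers
  of decay; the remaining one, squared, is the summable \<open>inverse (wt k ^ 2)\<close>. The
  quadratic dependence on \<open>B\<close> turns a Lipschitz bound on the coefficients into one on
  the norm.\<close>

lemma Hr_series_bound:
  assumes c: "\<And>k. cmod (c k) \<le> B * inverse (wt k ^ Suc n)" and B: "0 \<le> B" and r: "r \<le> real n"
  shows "(\<lambda>k. (real_of_int \<bar>k\<bar> + 1) powr (2 * r) * (cmod (c k))\<^sup>2) summable_on UNIV"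
    and "(\<Sum>\<^sub>\<infinity>k. (real_of_int \<bar>k\<bar> + 1) powr (2 * r) * (cmod (c k))\<^sup>2) \<le> B\<^sup>2 * (\<Sum>\<^sub>\<infinity>k. inverse (wt k ^ 2))"
proof -
  have le: "(real_of_int \<bar>k\<bar> + 1) powr (2 * r) * (cmod (c k))\<^sup>2 \<le> B\<^sup>2 * inverse (wt k ^ 2)" for k
  proof -
    have "(real_of_int \<bar>k\<bar> + 1) powr (2 * r) = wt k powr (2 * r)"
      by (simp add: wt_def add.commute)
    also have "\<dots> \<le> wt k powr real (2 * n)"
      using r by (intro powr_mono) auto
    also have "\<dots> = (wt k ^ n)\<^sup>2"
      by (subst powr_realpow) (simp_all add: power_mult[symmetric] mult.commute)
    finally have "(real_of_int \<bar>k\<bar> + 1) powr (2 * r) * (cmod (c k))\<^sup>2 \<le> (wt k ^ n)\<^sup>2 * (B * inverse (wt k ^ Suc n))\<^sup>2"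
      by (intro mult_mono power_mono c) auto
    also have "\<dots> = B\<^sup>2 * inverse (wt k ^ 2)"
      by (simp add: power_mult_distrib power_inverse field_simps)
    finally show ?thesis .
  qed
  have s: "(\<lambda>k. B\<^sup>2 * inverse (wt k ^ 2)) summable_on UNIV"
    by (intro summable_on_cmult_right summable_on_inverse_wt_square)
  show sum: "(\<lambda>k. (real_of_int \<bar>k\<bar> + 1) powr (2 * r) * (cmod (c k))\<^sup>2) summable_on UNIV"
    by (rule dominated_summable_on[OF s]) (use le in auto)
  have "(\<Sum>\<^sub>\<infinity>k. (real_of_int \<bar>k\<bar> + 1) powr (2 * r) * (cmod (c k))\<^sup>2) \<le> (\<Sum>\<^sub>\<infinity>k. B\<^sup>2 * inverse (wt k ^ 2))"
    by (rule infsum_mono[OF sum s le])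
  then show "(\<Sum>\<^sub>\<infinity>k. (real_of_int \<bar>k\<bar> + 1) powr (2 * r) * (cmod (c k))\<^sup>2) \<le> B\<^sup>2 * (\<Sum>\<^sub>\<infinity>k. inverse (wt k ^ 2))"
    by (simp only: infsum_cmult_right')
qed

lemma vector_derivative_lipschitz:
  fixes f :: "real \<Rightarrow> complex"
  assumes "\<And>x. x \<in> {a..b} \<Longrightarrow> (f has_vector_derivative f' x) (at x)" "\<And>x. x \<in> {a..b} \<Longrightarrow> norm (f' x) \<le> B"
    and "s \<in> {a..b}" "t \<in> {a..b}"
  shows "norm (f s - f t) \<le> B * \<bar>s - t\<bar>"
proof -
  have *: "norm (f y - f x) \<le> B * (y - x)" if xy: "x < y" "x \<in> {a..b}" "y \<in> {a..b}" for x y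
  proof -
    have "norm (f y - f x) \<le> B * y - B * x"
    proof (rule differentiable_bound_general[OF xy(1), where f' = f' and \<phi>' = "\<lambda>_. B"])
      show "continuous_on {x..y} f"
        by (intro continuous_at_imp_continuous_on ballI has_vector_derivative_continuous[OF assms(1)])
           (use xy in auto)
      show "((*) B has_vector_derivative B) (at z)" for z
        by (auto simp: has_real_derivative_iff_has_vector_derivative[symmetric] intro!: derivative_eq_intros)
    qed (use assms xy in \<open>auto intro!: continuous_intros\<close>)
    then show ?thesis
      by (simp add: algebra_simps)
  qed
  show ?thesis
    using *[of s t] *[of t s] assms(3,4)
    by (cases s t rule: linorder_cases) (auto simp: norm_minus_commute)
qed

theorem mainTheorem16:
  fixes v :: "real \<Rightarrow> real" and j :: int
  assumes "periodic_2pi v" and "smooth_real v" and "j \<noteq> 0"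
    and "fcoef (\<lambda>x. complex_of_real (v x)) j \<noteq> 0"
  shows "\<forall>r>0. \<exists>\<psi>. half_wave_solution_Hr r (\<lambda>t x. cos (of_int j * t) * v x) \<psi> \<and>
           (\<exists>C>0. \<exists>T>0. \<forall>t>T. Hr_norm r (\<psi> t) \<ge> C * japanese t powr r)"
proof (intro allI impI)
  fix r :: real assume r: "0 < r"
  define n where "n = nat \<lceil>r\<rceil>"
  have n: "r \<le> real n"
    unfolding n_def by linarith
  \<comment> \<open>One power of decay pays for the factor |k| in the time derivative; the other n +
    1 are what \<open>Hr_series_bound\<close> asks for.\<close>
  define m where "m = n + 2"
  define vv where "vv = fcoef (\<lambda>x. complex_of_real (v x))"
  have v_cont: "continuous_on A v" for A
    using smooth_real_derivatives(1)[OF assms(2,1), of 0]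
    by (auto intro!: continuous_at_imp_continuous_on intro: DERIV_isCont)
  have vv_uminus: "vv (- l) = cnj (vv l)" for l
    unfolding vv_def by (intro fcoef_uminus v_cont)
  \<comment> \<open>Since v is real, \<open>vv (- j)\<close> is the conjugate of
    \<open>vv j\<close>, so the assumption at index j makes the resonant coefficient
    nonzero.\<close>
  have "- \<i> * of_int j * vv (- j) \<noteq> 0"
    using assms(3,4) unfolding vv_uminus by (simp add: vv_def)
  then obtain a b \<kappa> where ab: "a < b" "0 < \<kappa>"
    "\<And>y. y \<in> {a..b} \<Longrightarrow> Re (- \<i> * of_int j * vv (- j) * cis (- (of_int j * y))) \<le> - 2 * \<kappa>"
    using exists_interval_Re_negative assms(3) by metis
  interpret wave_packet vv j a b \<kappa>
    by unfold_locales (use ab vv_uminus rapid_fcoef[OF assms(2,1)] in \<open>auto simp: vv_def\<close>)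
  have "2 \<le> m"
    by (simp add: m_def)
  then obtain x :: "int \<Rightarrow> real \<Rightarrow> complex" and \<delta> T where
    dx: "\<And>k t. (x k has_vector_derivative (- \<i> * (\<Sum>\<^sub>\<infinity>l. Ax k l t * x l t))) (at t)"
    and decay: "\<And>T. \<exists>C\<ge>0. \<forall>k. \<forall>t\<in>{-T..T}. cmod (x k t) \<le> C * inverse (wt k ^ m)"
    and \<delta>: "0 < \<delta>" and T: "1 \<le> T"
    and mass: "\<And>t. T \<le> t \<Longrightarrow> \<delta> \<le> (\<Sum>\<^sub>\<infinity>k\<in>{k. \<kappa> * t < of_int k}. (cmod (x k t))\<^sup>2)"
    by (rule high_frequency_solution) blast
  \<comment> \<open>Undoes the conjugation by e^{it|D|} and returns to the Fourier coefficients of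
    the half-wave solution.\<close>
  define y where "y k t = cis (- (of_int \<bar>k\<bar> * t)) * x k t" for k t
  define \<psi> where "\<psi> t = tsum (\<lambda>k. y k t)" for t
  have cmod_y [simp]: "cmod (y k t) = cmod (x k t)" for k t
    by (simp add: y_def norm_mult)
  have wt_le: "inverse (wt k ^ m) \<le> inverse (wt k ^ Suc n)" for k
    by (intro le_imp_inverse_le power_increasing) (auto simp: m_def)
  have y_sum: "(\<lambda>k. cmod (y k t)) summable_on UNIV" for t
  proof -
    obtain C where C: "\<And>k s. s \<in> {-\<bar>t\<bar>..\<bar>t\<bar>} \<Longrightarrow> cmod (x k s) \<le> C * inverse (wt k ^ m)"
      using decay by blast
    have "t \<in> {-\<bar>t\<bar>..\<bar>t\<bar>}"
      by auto
    then show ?thesis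
      by (intro dominated_summable_on[OF summable_on_cmult_right[OF summable_on_inverse_wt_power[OF \<open>2 \<le> m\<close>], of C]])
         (simp add: C)
  qed
  have \<psi>_coef: "fcoef (\<psi> t) k = y k t" for t k
    unfolding \<psi>_def by (rule fcoef_tsum[OF y_sum])
  have \<psi>_cont: "continuous_on A (\<psi> t)" for A t
    unfolding \<psi>_def by (rule continuous_on_tsum[OF y_sum])
  have V_coef: "fcoef (\<lambda>z. complex_of_real (cos (of_int j * t) * v z) * \<psi> t z) k
      = (\<Sum>\<^sub>\<infinity>l. of_real (cos (of_int j * t)) * vv (k - l) * y l t)" for t k
  proof -
    have "fcoef (\<lambda>z. complex_of_real (cos (of_int j * t) * v z)) i = of_real (cos (of_int j * t)) * vv i" for i
      unfolding vv_def by (subst (1 2) fcoef_eq_integral)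
        (auto intro!: continuous_intros v_cont simp: mult.assoc integral_mult_right)
    moreover have "fcoef (\<lambda>z. complex_of_real (cos (of_int j * t) * v z) * \<psi> t z) k
        = (\<Sum>\<^sub>\<infinity>l. fcoef (\<lambda>z. complex_of_real (cos (of_int j * t) * v z)) (k - l) * y l t)"
      unfolding \<psi>_def by (rule fcoef_mult_tsum[OF _ y_sum]) (intro continuous_intros v_cont)
    ultimately show ?thesis
      by (simp only:)
  qed
  have dy: "(y k has_vector_derivative (- \<i> * (of_int \<bar>k\<bar> * y k t + (\<Sum>\<^sub>\<infinity>l. of_real (cos (of_int j * t)) * vv (k - l) * y l t)))) (at t)" for k t
  proof -
    let ?c = "\<lambda>k t. cis (- (real_of_int k * t))"
    have "(?c i has_vector_derivative - (\<i> * of_int i) * ?c i t) (at t)" for i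
      by (auto simp: has_vector_derivative_def scaleR_conv_of_real fun_eq_iff algebra_simps intro!: derivative_eq_intros)
    from has_vector_derivative_mult[OF this dx]
    have "(y k has_vector_derivative (?c \<bar>k\<bar> t * (- \<i> * (\<Sum>\<^sub>\<infinity>l. Ax k l t * x l t)) + - (\<i> * of_int \<bar>k\<bar>) * ?c \<bar>k\<bar> t * x k t)) (at t)"
      unfolding y_def[abs_def] .
    moreover have "?c \<bar>k\<bar> t * (\<Sum>\<^sub>\<infinity>l. Ax k l t * x l t) = (\<Sum>\<^sub>\<infinity>l. of_real (cos (of_int j * t)) * vv (k - l) * y l t)"
    proof -
      have e: "?c \<bar>k\<bar> t * cis (of_int (\<bar>k\<bar> - \<bar>l\<bar>) * t) = ?c \<bar>l\<bar> t" for l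
        by (simp add: cis_mult algebra_simps)
      have "?c \<bar>k\<bar> t * (Ax k l t * x l t) = of_real (cos (of_int j * t)) * vv (k - l) * ((?c \<bar>k\<bar> t * cis (of_int (\<bar>k\<bar> - \<bar>l\<bar>) * t)) * x l t)" for l
        unfolding Ax_def by (simp only: mult_ac)
      then have "?c \<bar>k\<bar> t * (Ax k l t * x l t) = of_real (cos (of_int j * t)) * vv (k - l) * y l t" for l
        unfolding e y_def .
      then show ?thesis
        by (simp only: infsum_cmult_right'[symmetric])
    qed
    ultimately show ?thesis
      by (simp add: y_def algebra_simps)
  qed
  have Hr: "in_Hr r (\<psi> t)" for t
    unfolding in_Hr_def
  proof (intro conjI)
    have "cis (of_int l * (z + 2 * pi)) = cis (of_int l * z)" for l :: int and z
      by (simp add: distrib_left cis_mult[symmetric])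
    then show "periodic_2pi (\<psi> t)"
      unfolding periodic_2pi_def \<psi>_def tsum_def by simp
    show "\<psi> t \<in> borel_measurable borel"
      by (intro borel_measurable_continuous_onI \<psi>_cont)
    show "set_integrable lborel {0..2 * pi} (\<lambda>z. (cmod (\<psi> t z))\<^sup>2)"
      by (intro borel_integrable_atLeastAtMost' continuous_intros \<psi>_cont)
    obtain C where C: "0 \<le> C" "\<And>k s. s \<in> {-\<bar>t\<bar>..\<bar>t\<bar>} \<Longrightarrow> cmod (x k s) \<le> C * inverse (wt k ^ m)"
      using decay by blast
    have "t \<in> {-\<bar>t\<bar>..\<bar>t\<bar>}"
      by auto
    from order_trans[OF C(2)[OF this] mult_left_mono[OF wt_le C(1)]]
    have "cmod (fcoef (\<psi> t) k) \<le> C * inverse (wt k ^ Suc n)" for k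
      unfolding \<psi>_coef cmod_y .
    then show "(\<lambda>k. (real_of_int \<bar>k\<bar> + 1) powr (2 * r) * (cmod (fcoef (\<psi> t) k))\<^sup>2) summable_on UNIV"
      using C(1) n by (rule Hr_series_bound(1))
  qed
  \<comment> \<open>Each coefficient is Lipschitz in time with a constant of order
    \<open>inverse (wt k ^ Suc n)\<close>, locally uniformly, so the H^r norm of the increment is at
    most a multiple of \<open>\<bar>s - t\<bar>\<close>.\<close>
  have cont: "((\<lambda>s. Hr_norm r (\<lambda>z. \<psi> s z - \<psi> t z)) \<longlongrightarrow> 0) (at t)" for t
  proof -
    obtain C where C: "0 \<le> C" "\<And>k s. s \<in> {-(\<bar>t\<bar> + 1)..\<bar>t\<bar> + 1} \<Longrightarrow> cmod (x k s) \<le> C * inverse (wt k ^ m)"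
      using decay by blast
    define M where "M = (\<Sum>\<^sub>\<infinity>l. cmod (vv l) * wt l ^ m)"
    have M: "0 \<le> M"
      unfolding M_def by (intro infsum_nonneg) auto
    \<comment> \<open>\<open>C\<close> bounds the term with the factor |k|, and \<open>C * M\<close>
      the convolution with the potential.\<close>
    define L where "L = C * (1 + M)"
    have L: "0 \<le> L"
      using C M by (simp add: L_def)
    have dy_le: "cmod (- \<i> * (of_int \<bar>k\<bar> * y k s + (\<Sum>\<^sub>\<infinity>l. of_real (cos (of_int j * s)) * vv (k - l) * y l s))) \<le> L * inverse (wt k ^ Suc n)"
      if s: "s \<in> {-(\<bar>t\<bar> + 1)..\<bar>t\<bar> + 1}" for k s
    proof -
      have "cmod (\<Sum>\<^sub>\<infinity>l. of_real (cos (of_int j * s)) * vv (k - l) * y l s) \<le> C * M * inverse (wt k ^ m)"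
        unfolding M_def
      proof (rule weighted_convolution(2)[OF rapid_summable[OF rapid_vv] norm_ge_zero _ C(1)])
        have "\<bar>cos (of_int j * s)\<bar> * (cmod (vv (k - l)) * cmod (x l s)) \<le> 1 * (cmod (vv (k - l)) * (C * inverse (wt l ^ m)))" for l
          by (intro mult_mono C s) auto
        then show "cmod (of_real (cos (of_int j * s)) * vv (k - l) * y l s) \<le> cmod (vv (k - l)) * (C * inverse (wt l ^ m))" for l
          by (simp add: norm_mult mult.assoc)
      qed
      also have "\<dots> \<le> C * M * inverse (wt k ^ Suc n)"
        using C M wt_le by (intro mult_left_mono) auto
      finally have 1: "cmod (\<Sum>\<^sub>\<infinity>l. of_real (cos (of_int j * s)) * vv (k - l) * y l s) \<le> C * M * inverse (wt k ^ Suc n)" .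
      have "cmod (of_int \<bar>k\<bar> * y k s) \<le> wt k * (C * inverse (wt k ^ m))"
        unfolding norm_mult by (intro mult_mono) (use C(2)[OF s] in \<open>auto simp: wt_def\<close>)
      also have "\<dots> = C * inverse (wt k ^ Suc n)"
        by (simp add: m_def field_simps)
      finally have 2: "cmod (of_int \<bar>k\<bar> * y k s) \<le> C * inverse (wt k ^ Suc n)" .
      have "cmod (- \<i> * (of_int \<bar>k\<bar> * y k s + (\<Sum>\<^sub>\<infinity>l. of_real (cos (of_int j * s)) * vv (k - l) * y l s)))
          \<le> cmod (of_int \<bar>k\<bar> * y k s) + cmod (\<Sum>\<^sub>\<infinity>l. of_real (cos (of_int j * s)) * vv (k - l) * y l s)"
      proof -
        have "cmod (- \<i> * (z + z')) \<le> cmod z + cmod z'" for z z'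
          using norm_triangle_ineq[of z z'] by (simp add: norm_mult)
        then show ?thesis .
      qed
      also have "\<dots> \<le> C * inverse (wt k ^ Suc n) + C * M * inverse (wt k ^ Suc n)"
        by (intro add_mono 1 2)
      finally show ?thesis
        by (simp add: L_def algebra_simps)
    qed
    have lip: "cmod (y k s - y k t) \<le> (L * \<bar>s - t\<bar>) * inverse (wt k ^ Suc n)" if s: "s \<in> {-(\<bar>t\<bar> + 1)..\<bar>t\<bar> + 1}" for k s
    proof -
      have "t \<in> {-(\<bar>t\<bar> + 1)..\<bar>t\<bar> + 1}"
        by auto
      from vector_derivative_lipschitz[OF dy dy_le s this, of k] show ?thesis
        by (simp add: mult_ac)
    qed
    define S where "S = (\<Sum>\<^sub>\<infinity>k. inverse (wt k ^ 2))"
    have bound: "Hr_norm r (\<lambda>z. \<psi> s z - \<psi> t z) \<le> sqrt (2 * pi * S) * L * \<bar>s - t\<bar>" if s: "s \<in> {-(\<bar>t\<bar> + 1)..\<bar>t\<bar> + 1}" for s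
    proof -
      have "(\<lambda>z. \<psi> s z - \<psi> t z) = tsum (\<lambda>k. y k s - y k t)"
      proof
        fix z
        have sm: "(\<lambda>l. y l u * cis (of_int l * z)) summable_on UNIV" for u
          by (rule dominated_summable_on[OF y_sum[of u]]) (simp add: norm_mult)
        show "\<psi> s z - \<psi> t z = tsum (\<lambda>k. y k s - y k t) z"
          unfolding \<psi>_def tsum_def infsum_diff[OF sm sm, symmetric] by (simp add: left_diff_distrib)
      qed
      moreover have "(\<lambda>k. cmod (y k s - y k t)) summable_on UNIV"
        by (rule dominated_summable_on[OF summable_on_add[OF y_sum[of s] y_sum[of t]]])
           (simp only: real_norm_def abs_norm_cancel norm_triangle_ineq4)
      ultimately have c: "fcoef (\<lambda>z. \<psi> s z - \<psi> t z) k = y k s - y k t" for k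
        by (simp add: fcoef_tsum)
      have "(\<Sum>\<^sub>\<infinity>k. (real_of_int \<bar>k\<bar> + 1) powr (2 * r) * (cmod (fcoef (\<lambda>z. \<psi> s z - \<psi> t z) k))\<^sup>2) \<le> (L * \<bar>s - t\<bar>)\<^sup>2 * S"
        unfolding S_def c by (rule Hr_series_bound(2)[OF lip[OF s] _ n]) (use L in auto)
      then have "Hr_norm r (\<lambda>z. \<psi> s z - \<psi> t z) \<le> sqrt (2 * pi * ((L * \<bar>s - t\<bar>)\<^sup>2 * S))"
        unfolding Hr_norm_def by (intro real_sqrt_le_mono mult_left_mono) auto
      also have "\<dots> = sqrt (2 * pi * S) * L * \<bar>s - t\<bar>"
        using L by (simp add: real_sqrt_mult)
      finally show ?thesis .
    qed
    have "\<forall>\<^sub>F s in at t. s \<in> {-(\<bar>t\<bar> + 1)<..<\<bar>t\<bar> + 1}"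
      by (intro eventually_at_in_open') auto
    then have ev: "\<forall>\<^sub>F s in at t. norm (Hr_norm r (\<lambda>z. \<psi> s z - \<psi> t z)) \<le> sqrt (2 * pi * S) * L * \<bar>s - t\<bar>"
    proof eventually_elim
      case (elim s)
      have "0 \<le> Hr_norm r (\<lambda>z. \<psi> s z - \<psi> t z)"
        unfolding Hr_norm_def by (intro real_sqrt_ge_zero mult_nonneg_nonneg infsum_nonneg) auto
      then show ?case
        using bound[of s] elim by auto
    qed
    have "((\<lambda>s. sqrt (2 * pi * S) * L * \<bar>s - t\<bar>) \<longlongrightarrow> sqrt (2 * pi * S) * L * \<bar>t - t\<bar>) (at t)"
      by (intro tendsto_intros)
    then show ?thesis
      using Lim_null_comparison[OF ev] by simp
  qed
  have sol: "half_wave_solution_Hr r (\<lambda>t x. cos (of_int j * t) * v x) \<psi>"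
    unfolding half_wave_solution_Hr_def \<psi>_coef V_coef using Hr cont dy by blast
  \<comment> \<open>Above the cutoff the Sobolev weight is at least (\<kappa> t)^{2r}, so the fixed
    mass there forces the rate t^r. The half in \<open>\<kappa> / 2\<close> comes from the
    comparison \<open>japanese t \<le> 2 * t\<close>, valid for t \<ge> 1.\<close>
  have growth: "sqrt (2 * pi * \<delta>) * (\<kappa> / 2) powr r * japanese t powr r \<le> Hr_norm r (\<psi> t)" if t: "T < t" for t
  proof -
    let ?H = "{k. \<kappa> * t < real_of_int k}"
    have t1: "1 \<le> t"
      using t T by simp
    have sH: "(\<lambda>k. (real_of_int \<bar>k\<bar> + 1) powr (2 * r) * (cmod (x k t))\<^sup>2) summable_on A" for A
      using Hr[of t] summable_on_subset_banach unfolding in_Hr_def \<psi>_coef cmod_y by blast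
    have s2: "(\<lambda>k. (\<kappa> * t) powr (2 * r) * (cmod (x k t))\<^sup>2) summable_on ?H"
    proof (rule dominated_summable_on[OF sH])
      fix k assume "k \<in> ?H"
      then show "norm ((\<kappa> * t) powr (2 * r) * (cmod (x k t))\<^sup>2) \<le> (real_of_int \<bar>k\<bar> + 1) powr (2 * r) * (cmod (x k t))\<^sup>2"
        using \<kappa> t1 r by (auto intro!: mult_right_mono powr_mono2)
    qed
    have "(\<kappa> * t) powr (2 * r) * \<delta> \<le> (\<kappa> * t) powr (2 * r) * (\<Sum>\<^sub>\<infinity>k\<in>?H. (cmod (x k t))\<^sup>2)"
      using mass[of t] t by (intro mult_left_mono) auto
    also have "\<dots> = (\<Sum>\<^sub>\<infinity>k\<in>?H. (\<kappa> * t) powr (2 * r) * (cmod (x k t))\<^sup>2)"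
      by (rule infsum_cmult_right'[symmetric])
    also have "\<dots> \<le> (\<Sum>\<^sub>\<infinity>k\<in>?H. (real_of_int \<bar>k\<bar> + 1) powr (2 * r) * (cmod (x k t))\<^sup>2)"
      using \<kappa> t1 r by (intro infsum_mono[OF s2 sH]) (auto intro!: mult_right_mono powr_mono2)
    also have "\<dots> \<le> (\<Sum>\<^sub>\<infinity>k. (real_of_int \<bar>k\<bar> + 1) powr (2 * r) * (cmod (x k t))\<^sup>2)"
      by (intro infsum_mono2 sH) auto
    finally have "sqrt (2 * pi * ((\<kappa> * t) powr (2 * r) * \<delta>)) \<le> Hr_norm r (\<psi> t)"
      unfolding Hr_norm_def \<psi>_coef cmod_y by (intro real_sqrt_le_mono mult_left_mono) auto
    moreover have "sqrt (2 * pi * ((\<kappa> * t) powr (2 * r) * \<delta>)) = sqrt (2 * pi * \<delta>) * (\<kappa> * t) powr r"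
    proof -
      have "(\<kappa> * t) powr (2 * r) = ((\<kappa> * t) powr r)\<^sup>2"
        by (simp add: power2_eq_square powr_add[symmetric])
      then show ?thesis
        by (simp add: real_sqrt_mult)
    qed
    moreover have "(\<kappa> / 2) powr r * japanese t powr r \<le> (\<kappa> * t) powr r"
    proof -
      have "1 \<le> t\<^sup>2"
        by (rule one_le_power[OF t1])
      moreover have "(2 * t)\<^sup>2 = 4 * t\<^sup>2"
        by (simp add: power_mult_distrib)
      ultimately have "1 + t\<^sup>2 \<le> (2 * t)\<^sup>2"
        by linarith
      then have "japanese t \<le> 2 * t"
        unfolding japanese_def using t1 by (intro real_le_lsqrt) auto
      then have "(\<kappa> / 2 * japanese t) powr r \<le> (\<kappa> / 2 * (2 * t)) powr r"
        using \<kappa> r by (intro powr_mono2 mult_left_mono) (auto simp: japanese_def)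
      moreover have "(\<kappa> / 2 * japanese t) powr r = (\<kappa> / 2) powr r * japanese t powr r"
        by (rule powr_mult)
      moreover have "\<kappa> / 2 * (2 * t) = \<kappa> * t"
        by simp
      ultimately show ?thesis
        by (simp only:)
    qed
    then have "sqrt (2 * pi * \<delta>) * ((\<kappa> / 2) powr r * japanese t powr r) \<le> sqrt (2 * pi * \<delta>) * (\<kappa> * t) powr r"
      using \<delta> by (intro mult_left_mono) auto
    ultimately show ?thesis
      by (simp only: mult.assoc)
  qed
  show "\<exists>\<psi>. half_wave_solution_Hr r (\<lambda>t x. cos (of_int j * t) * v x) \<psi> \<and>
           (\<exists>C>0. \<exists>T>0. \<forall>t>T. Hr_norm r (\<psi> t) \<ge> C * japanese t powr r)"
    using sol growth \<delta> \<kappa> T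
    by (intro exI[of _ \<psi>] conjI exI[of _ "sqrt (2 * pi * \<delta>) * (\<kappa> / 2) powr r"] exI[of _ T]) auto
qed

end
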